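(* Let $\mathcal I$ be a multinomial or fixed-mean Gaussian inference family on the hypergraph $H$ (as in the context), let $\rho$ be the spectral radius (Perron–Frobenius eigenvalue) of the $0$-$1$ matrix $\mathcal M$ on $\vec E$ with $\mathcal M_{e,e'}=1$ iff $e\rightharpoonup e'$, and fix norms on each $\mathbb{R}^{r_i}$ with induced operator norms $\|\cdot\|$. Let $$L_{\rho^{-1}}=\{\{b_\alpha,b_i\}\in L(\mathcal I):\ \|\mathrm{Corr}_{b_\alpha}(\phi_i,\phi_j)\|<\rho^{-1}\ \text{for all }\alpha\in F\text{ and distinct }i,j\in\alpha\}$$ (with $\rho^{-1}=\infty$ if $\rho=0$). Then the Hessian $\nabla^2F_{\mathrm B}$ of the Bethe free energy is positive definite at every point of $L_{\rho^{-1}}$.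
   Context: Hypergraph $H=(V,F)$ (finite $V$, finite collection $F$ of nonempty subsets), $d_i=|\{\alpha:i\in\alpha\}|$; $\vec E=\{(\alpha\to i):i\in\alpha\}$, $s(\alpha\to i)=\alpha$, $t(\alpha\to i)=i$; $e\rightharpoonup e'$ iff $t(e)\in s(e')$, $t(e)\ne t(e')$, $s(e)\ne s(e')$. For a distribution $p$, $\mathrm{Corr}_p(y,x)=\mathrm{Var}_p(y)^{-1/2}\mathrm{Cov}_p(y,x)\mathrm{Var}_p(x)^{-1/2}$. Multinomial family: each $\mathcal X_i=\{1,\dots,N_i\}$, $\phi_i(x)=(\mathbf 1[x=k])_{k=1}^{N_i-1}$; $L$ is the set of families of strictly positive probability functions $b_\alpha$ on $\prod_{i\in\alpha}\mathcal X_i$ and $b_i$ on $\mathcal X_i$ with $b_i$ the $x_i$-marginal of $b_\alpha$; for given positive $\Psi_\alpha$, $F_{\mathrm B}=-\sum_\alpha\sum b_\alpha\log\Psi_\alpha+\sum_\alpha\sum b_\alpha\log b_\alpha+\sum_i(1-d_i)\sum b_i\log b_i$ on the relatively open convex set $L$. Fixed-mean Gaussian family: $H$ is a simple graph $G=(V,E)$ with edges as factors, $\mu\in\mathbb{R}^V$, $\phi_i(x_i)=(x_i-\mu_i)^2$; $L=\{(\eta_{ii}),(\eta_{ij}):\eta_{ii}>0,\eta_{ii}\eta_{jj}-\eta_{ij}^2>0\}$, $b_{ij}$ the Gaussian with mean $(\mu_i,\mu_j)$ and covariance $\begin{pmatrix}\eta_{ii}&\eta_{ij}\\\eta_{ij}&\eta_{jj}\end{pmatrix}$,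 $b_i$ its marginal; $F_{\mathrm B}(\eta)=\ell(\eta)-\tfrac12\sum_{ij}\log(\eta_{ii}\eta_{jj}-\eta_{ij}^2)-\tfrac12\sum_i(1-d_i)\log\eta_{ii}$ up to a constant, $\ell$ linear. *)

theory Defs
  imports
    "HOL-Analysis.Analysis"
    "Jordan_Normal_Form.Spectral_Radius"
begin

section \<open>Hypergraphs and the directed-edge matrix\<close>

definition hypergraph :: "'v set \<Rightarrow> 'v set set \<Rightarrow> bool" where
  "hypergraph V F \<longleftrightarrow> finite V \<and> (\<forall>\<alpha>\<in>F. \<alpha> \<noteq> {} \<and> \<alpha> \<subseteq> V)"

definition simple_graph :: "'v set \<Rightarrow> 'v set set \<Rightarrow> bool" where
  "simple_graph V E \<longleftrightarrow> finite V \<and> (\<forall>e\<in>E. card e = 2 \<and> e \<subseteq> V)"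

definition degree_of :: "'v set set \<Rightarrow> 'v \<Rightarrow> nat" where
  "degree_of F i = card {\<alpha>\<in>F. i \<in> \<alpha>}"

text \<open>The directed edge \<open>\<alpha> \<rightarrow> i\<close> is the pair \<open>(\<alpha>, i)\<close>.\<close>

definition directed_edges :: "'v set set \<Rightarrow> ('v set \<times> 'v) set" where
  "directed_edges F = {(\<alpha>, i). \<alpha> \<in> F \<and> i \<in> \<alpha>}"

definition edge_succ :: "'v set \<times> 'v \<Rightarrow> 'v set \<times> 'v \<Rightarrow> bool" where
  "edge_succ e e' \<longleftrightarrow> snd e \<in> fst e' \<and> snd e \<noteq> snd e' \<and> fst e \<noteq> fst e'"

definition succ_matrix :: "('v set \<times> 'v) list \<Rightarrow> complex mat" where
  "succ_matrix es = mat (length es) (length es)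
     (\<lambda>(k, l). if edge_succ (es ! k) (es ! l) then 1 else 0)"

text \<open>The rows and columns are ordered by an arbitrary enumeration of the directed edges; the
  spectral radius does not depend on it.  The \<open>0 \<times> 0\<close> matrix has empty spectrum, on
  which \<^const>\<open>spectral_radius\<close> is unspecified, so its spectral radius is set to \<open>0\<close>.\<close>

definition rho :: "'v set set \<Rightarrow> real" where
  "rho F = (if directed_edges F = {} then 0
     else spectral_radius (succ_matrix
       (SOME es. distinct es \<and> set es = directed_edges F)))"


section \<open>Norms and operator norms\<close>

definition is_norm :: "nat \<Rightarrow> (real vec \<Rightarrow> real) \<Rightarrow> bool" where
  "is_norm n \<nu> \<longleftrightarrow>
     (\<forall>v\<in>carrier_vec n. 0 \<le> \<nu> v \<and> (\<nu> v = 0 \<longleftrightarrow> v = 0\<^sub>v n)) \<and>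
     (\<forall>a. \<forall>v\<in>carrier_vec n. \<nu> (a \<cdot>\<^sub>v v) = \<bar>a\<bar> * \<nu> v) \<and>
     (\<forall>v\<in>carrier_vec n. \<forall>w\<in>carrier_vec n. \<nu> (v + w) \<le> \<nu> v + \<nu> w)"

definition op_norm :: "(real vec \<Rightarrow> real) \<Rightarrow> (real vec \<Rightarrow> real) \<Rightarrow> real mat \<Rightarrow> real" where
  "op_norm \<nu>_out \<nu>_in A =
     Sup {\<nu>_out (A *\<^sub>v v) | v. v \<in> carrier_vec (dim_col A) \<and> \<nu>_in v \<le> 1}"


section \<open>Covariance and correlation matrices\<close>

text \<open>\<open>y\<close> and \<open>x\<close> are statistics with values in \<open>\<real>\<^sup>m\<close> and \<open>\<real>\<^sup>n\<close>.\<close>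

definition Cov :: "'a measure \<Rightarrow> nat \<Rightarrow> ('a \<Rightarrow> real vec) \<Rightarrow> nat \<Rightarrow> ('a \<Rightarrow> real vec) \<Rightarrow> real mat" where
  "Cov p m y n x = mat m n (\<lambda>(k, l).
     (LINT w|p. vec_index (y w) k * vec_index (x w) l) -
     (LINT w|p. vec_index (y w) k) * (LINT w|p. vec_index (x w) l))"

definition pos_def_mat :: "nat \<Rightarrow> real mat \<Rightarrow> bool" where
  "pos_def_mat n B \<longleftrightarrow> B \<in> carrier_mat n n \<and> transpose_mat B = B \<and>
     (\<forall>v\<in>carrier_vec n. v \<noteq> 0\<^sub>v n \<longrightarrow> 0 < scalar_prod v (B *\<^sub>v v))"

text \<open>\<open>A\<^sup>-\<^sup>1\<^sup>/\<^sup>2\<close>: the unique positive definite matrix whose square is the inverse of the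
  positive definite \<open>n \<times> n\<close> matrix \<open>A\<close>.\<close>

definition inv_sqrt_mat :: "nat \<Rightarrow> real mat \<Rightarrow> real mat" where
  "inv_sqrt_mat n A = (THE B. pos_def_mat n B \<and> inverts_mat A (B * B))"

definition Corr :: "'a measure \<Rightarrow> nat \<Rightarrow> ('a \<Rightarrow> real vec) \<Rightarrow> nat \<Rightarrow> ('a \<Rightarrow> real vec) \<Rightarrow> real mat" where
  "Corr p m y n x =
     inv_sqrt_mat m (Cov p m y m y) * Cov p m y n x * inv_sqrt_mat n (Cov p n x n x)"


section \<open>Hessians on relatively open convex sets\<close>

text \<open>Points are real-valued functions of a coordinate.  For a relatively open convex set \<open>L\<close>
  of finite dimension and \<open>x \<in> L\<close>, the set below is the direction space of the affine
  hull of \<open>L\<close>.\<close>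

definition tangent_dirs :: "('c \<Rightarrow> real) set \<Rightarrow> ('c \<Rightarrow> real) \<Rightarrow> ('c \<Rightarrow> real) set" where
  "tangent_dirs L x = {h. \<forall>\<^sub>F t in nhds (0::real). (\<lambda>c. x c + t * h c) \<in> L}"

text \<open>\<open>Q\<close> is the Hessian form of \<open>f\<close> at \<open>x\<close> along \<open>L\<close>:
  \<open>Q h k = \<partial>\<^sub>s \<partial>\<^sub>t f (x + s h + t k)\<close> at \<open>s = t = 0\<close>, both derivatives being required to exist.\<close>

definition has_hessian ::
  "('c \<Rightarrow> real) set \<Rightarrow> (('c \<Rightarrow> real) \<Rightarrow> real) \<Rightarrow> ('c \<Rightarrow> real) \<Rightarrow>
   (('c \<Rightarrow> real) \<Rightarrow> ('c \<Rightarrow> real) \<Rightarrow> real) \<Rightarrow> bool" where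
  "has_hessian L f x Q \<longleftrightarrow>
     (\<forall>h\<in>tangent_dirs L x. \<forall>k\<in>tangent_dirs L x. \<exists>g.
        (\<forall>\<^sub>F s in nhds 0.
           ((\<lambda>t. f (\<lambda>c. x c + s * h c + t * k c)) has_real_derivative g s) (at 0)) \<and>
        (g has_real_derivative Q h k) (at 0))"

definition pos_def_form ::
  "('c \<Rightarrow> real) set \<Rightarrow> (('c \<Rightarrow> real) \<Rightarrow> ('c \<Rightarrow> real) \<Rightarrow> real) \<Rightarrow> bool" where
  "pos_def_form T Q \<longleftrightarrow>
     (\<forall>h\<in>T. \<forall>k\<in>T. Q h k = Q k h) \<and>
     (\<forall>h\<in>T. \<forall>h'\<in>T. \<forall>k\<in>T. \<forall>a a'.
        Q (\<lambda>c. a * h c + a' * h' c) k = a * Q h k + a' * Q h' k) \<and>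
     (\<forall>h\<in>T. h \<noteq> (\<lambda>c. 0) \<longrightarrow> 0 < Q h h)"

definition hessian_pos_def ::
  "('c \<Rightarrow> real) set \<Rightarrow> (('c \<Rightarrow> real) \<Rightarrow> real) \<Rightarrow> ('c \<Rightarrow> real) \<Rightarrow> bool" where
  "hessian_pos_def L f x \<longleftrightarrow> (\<exists>Q. has_hessian L f x Q \<and> pos_def_form (tangent_dirs L x) Q)"


section \<open>The multinomial family\<close>

definition states :: "('v \<Rightarrow> nat) \<Rightarrow> 'v \<Rightarrow> nat set" where
  "states N i = {1..N i}"

definition configs :: "('v \<Rightarrow> nat) \<Rightarrow> 'v set \<Rightarrow> ('v \<Rightarrow> nat) set" where
  "configs N \<alpha> = PiE \<alpha> (states N)"

text \<open>A family of beliefs is one function: \<open>b (Factor \<alpha> x)\<close> is \<open>b\<^sub>\<alpha>(x)\<close> and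
  \<open>b (Node i k)\<close> is \<open>b\<^sub>i(k)\<close>; it is \<open>0\<close> at arguments that name no value of the family.\<close>

datatype 'v mn_coord = Factor "'v set" "'v \<Rightarrow> nat" | Node 'v nat

definition mn_coords :: "'v set \<Rightarrow> 'v set set \<Rightarrow> ('v \<Rightarrow> nat) \<Rightarrow> 'v mn_coord set" where
  "mn_coords V F N =
     {Factor \<alpha> x | \<alpha> x. \<alpha> \<in> F \<and> x \<in> configs N \<alpha>} \<union> {Node i k | i k. i \<in> V \<and> k \<in> states N i}"

definition mn_L :: "'v set \<Rightarrow> 'v set set \<Rightarrow> ('v \<Rightarrow> nat) \<Rightarrow> ('v mn_coord \<Rightarrow> real) set" where
  "mn_L V F N = {b.
     (\<forall>c. c \<notin> mn_coords V F N \<longrightarrow> b c = 0) \<and>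
     (\<forall>c\<in>mn_coords V F N. 0 < b c) \<and>
     (\<forall>\<alpha>\<in>F. (\<Sum>x\<in>configs N \<alpha>. b (Factor \<alpha> x)) = 1) \<and>
     (\<forall>i\<in>V. (\<Sum>k\<in>states N i. b (Node i k)) = 1) \<and>
     (\<forall>\<alpha>\<in>F. \<forall>i\<in>\<alpha>. \<forall>k\<in>states N i.
        b (Node i k) = (\<Sum>x\<in>{x\<in>configs N \<alpha>. x i = k}. b (Factor \<alpha> x)))}"

definition mn_bethe ::
  "'v set \<Rightarrow> 'v set set \<Rightarrow> ('v \<Rightarrow> nat) \<Rightarrow> ('v set \<Rightarrow> ('v \<Rightarrow> nat) \<Rightarrow> real) \<Rightarrow>
   ('v mn_coord \<Rightarrow> real) \<Rightarrow> real" where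
  "mn_bethe V F N \<Psi> b =
     - (\<Sum>\<alpha>\<in>F. \<Sum>x\<in>configs N \<alpha>. b (Factor \<alpha> x) * ln (\<Psi> \<alpha> x))
     + (\<Sum>\<alpha>\<in>F. \<Sum>x\<in>configs N \<alpha>. b (Factor \<alpha> x) * ln (b (Factor \<alpha> x)))
     + (\<Sum>i\<in>V. (1 - real (degree_of F i)) *
          (\<Sum>k\<in>states N i. b (Node i k) * ln (b (Node i k))))"

definition mn_law ::
  "('v \<Rightarrow> nat) \<Rightarrow> ('v mn_coord \<Rightarrow> real) \<Rightarrow> 'v set \<Rightarrow> ('v \<Rightarrow> nat) measure" where
  "mn_law N b \<alpha> = point_measure (configs N \<alpha>) (\<lambda>x. ennreal (b (Factor \<alpha> x)))"

definition mn_dim :: "('v \<Rightarrow> nat) \<Rightarrow> 'v \<Rightarrow> nat" where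
  "mn_dim N i = N i - 1"

text \<open>Vector entries are indexed from \<open>0\<close>, states from \<open>1\<close>.\<close>

definition mn_stat :: "('v \<Rightarrow> nat) \<Rightarrow> 'v \<Rightarrow> nat \<Rightarrow> real vec" where
  "mn_stat N i x = Matrix.vec (mn_dim N i) (\<lambda>k. if x = Suc k then 1 else 0)"

definition mn_corr ::
  "('v \<Rightarrow> nat) \<Rightarrow> ('v mn_coord \<Rightarrow> real) \<Rightarrow> 'v set \<Rightarrow> 'v \<Rightarrow> 'v \<Rightarrow> real mat" where
  "mn_corr N b \<alpha> i j =
     Corr (mn_law N b \<alpha>) (mn_dim N i) (\<lambda>x. mn_stat N i (x i)) (mn_dim N j) (\<lambda>x. mn_stat N j (x j))"

text \<open>In \<^typ>\<open>ereal\<close>, \<open>inverse 0 = \<infinity>\<close>.\<close>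

definition mn_L_rho ::
  "'v set \<Rightarrow> 'v set set \<Rightarrow> ('v \<Rightarrow> nat) \<Rightarrow> ('v \<Rightarrow> real vec \<Rightarrow> real) \<Rightarrow> ('v mn_coord \<Rightarrow> real) set" where
  "mn_L_rho V F N \<nu> = {b \<in> mn_L V F N. \<forall>\<alpha>\<in>F. \<forall>i\<in>\<alpha>. \<forall>j\<in>\<alpha>. i \<noteq> j \<longrightarrow>
     ereal (op_norm (\<nu> i) (\<nu> j) (mn_corr N b \<alpha> i j)) < inverse (ereal (rho F))}"


section \<open>The fixed-mean Gaussian family\<close>

text \<open>\<open>\<eta> (Diag i)\<close> is \<open>\<eta>\<^sub>i\<^sub>i\<close> and \<open>\<eta> (Off {i, j})\<close> is \<open>\<eta>\<^sub>i\<^sub>j\<close> for an edge \<open>{i, j}\<close>;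
  other arguments are mapped to \<open>0\<close>.\<close>

datatype 'v ga_coord = Diag 'v | Off "'v set"

definition ga_L :: "'v set \<Rightarrow> 'v set set \<Rightarrow> ('v ga_coord \<Rightarrow> real) set" where
  "ga_L V E = {\<eta>.
     (\<forall>c. c \<notin> Diag ` V \<union> Off ` E \<longrightarrow> \<eta> c = 0) \<and>
     (\<forall>i\<in>V. 0 < \<eta> (Diag i)) \<and>
     (\<forall>i j. i \<noteq> j \<and> {i, j} \<in> E \<longrightarrow> 0 < \<eta> (Diag i) * \<eta> (Diag j) - (\<eta> (Off {i, j}))\<^sup>2)}"

text \<open>\<open>lin\<close> holds the coefficients of the linear part and \<open>\<kappa>\<close> is the additive constant.\<close>

definition ga_bethe ::
  "'v set \<Rightarrow> 'v set set \<Rightarrow> ('v ga_coord \<Rightarrow> real) \<Rightarrow> real \<Rightarrow> ('v ga_coord \<Rightarrow> real) \<Rightarrow> real" where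
  "ga_bethe V E lin \<kappa> \<eta> =
     (\<Sum>c\<in>Diag ` V \<union> Off ` E. lin c * \<eta> c)
     - 1/2 * (\<Sum>e\<in>E. ln ((\<Prod>i\<in>e. \<eta> (Diag i)) - (\<eta> (Off e))\<^sup>2))
     - 1/2 * (\<Sum>i\<in>V. (1 - real (degree_of E i)) * ln (\<eta> (Diag i)))
     + \<kappa>"

text \<open>Joint law of \<open>(x\<^sub>i, x\<^sub>j)\<close>: the bivariate normal density written out with the inverse of
  the \<open>2 \<times> 2\<close> covariance matrix.\<close>

definition ga_law ::
  "('v \<Rightarrow> real) \<Rightarrow> ('v ga_coord \<Rightarrow> real) \<Rightarrow> 'v \<Rightarrow> 'v \<Rightarrow> (real \<times> real) measure" where
  "ga_law \<mu> \<eta> i j =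
     (let a = \<eta> (Diag i); d = \<eta> (Diag j); c = \<eta> (Off {i, j}); D = a * d - c\<^sup>2 in
      density lborel (\<lambda>(x, y). ennreal
        (exp (- (d * (x - \<mu> i)\<^sup>2 - 2 * c * (x - \<mu> i) * (y - \<mu> j) + a * (y - \<mu> j)\<^sup>2) / (2 * D))
         / (2 * pi * sqrt D))))"

definition ga_stat :: "('v \<Rightarrow> real) \<Rightarrow> 'v \<Rightarrow> real \<Rightarrow> real vec" where
  "ga_stat \<mu> i x = Matrix.vec 1 (\<lambda>_. (x - \<mu> i)\<^sup>2)"

definition ga_corr ::
  "('v \<Rightarrow> real) \<Rightarrow> ('v ga_coord \<Rightarrow> real) \<Rightarrow> 'v \<Rightarrow> 'v \<Rightarrow> real mat" where
  "ga_corr \<mu> \<eta> i j =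
     Corr (ga_law \<mu> \<eta> i j) 1 (\<lambda>w. ga_stat \<mu> i (fst w)) 1 (\<lambda>w. ga_stat \<mu> j (snd w))"

definition ga_L_rho ::
  "'v set \<Rightarrow> 'v set set \<Rightarrow> ('v \<Rightarrow> real) \<Rightarrow> ('v \<Rightarrow> real vec \<Rightarrow> real) \<Rightarrow> ('v ga_coord \<Rightarrow> real) set" where
  "ga_L_rho V E \<mu> \<nu> = {\<eta> \<in> ga_L V E. \<forall>i j. i \<noteq> j \<and> {i, j} \<in> E \<longrightarrow>
     ereal (op_norm (\<nu> i) (\<nu> j) (ga_corr \<mu> \<eta> i j)) < inverse (ereal (rho E))}"

end

(* Along a path from a point with independent variables to the given point, the Hessian form starts
   positive definite, so it suffices that it never degenerates.  A vector h in the radical produces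
   messages on the directed edges: with w_i = h_i / b_i, the stationarity of the form in the factor
   directions splits h_alpha / b_alpha into one-variable functions y_{alpha,i}, and
   m_{alpha->i} = w_i - y_{alpha,i} is the sum over j in alpha - {i} of the conditional expectations
   of y_{alpha,j} given x_i; stationarity in the node directions gives w_i = sum over alpha of
   m_{alpha->i}, hence y_{alpha,j} is the sum of m_{beta->j} over beta different from alpha.  In
   whitened coordinates the conditional expectation is the correlation matrix, so the norms of the
   messages satisfy n <= c M^T n with c rho < 1, which forces n = 0. *)

theory Submission
  imports Defs "HOL-Probability.Distributions"
begin

section \<open>Positive definiteness along a homotopy\<close>

text \<open>The form is a difference: the coefficients 1 - d_i are negative at nodes of degree above
  one, so no term-by-term estimate gives its sign. The spectral condition controls only the radical,
  because the message inequality speaks of solutions of linear equations; the sign has to be carried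
  over from a point where it can be computed, and this is what the path is for. Both paths keep the
  one-node marginals fixed, so the functions of mean zero and the whitening at each node are the
  same for all parameters, and each correlation matrix is merely multiplied by a number in [0,1] (t
  for the multinomial family, t^2 for the Gaussian one); hence one constant c serves the whole path.
  It is the maximum of finitely many operator norms, which is how strictness below 1/rho becomes c
  rho < 1. Of the norms only subadditivity, homogeneity and definiteness enter, so they may differ
  from node to node. The Gaussian directions are not functions on a state space: there h_i / eta_ii
  plays the role of w_i, and the splitting is the solution of a two by two linear system on each
  edge.\<close>

definition supp_sphere :: "'c set \<Rightarrow> ('c \<Rightarrow> real) set" where
  "supp_sphere C = {h. (\<forall>c. c \<notin> C \<longrightarrow> h c = 0) \<and> (\<Sum>c\<in>C. (h c)\<^sup>2) = 1}"

text \<open>Directions are functions on the whole coordinate type with the product topology.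
  Vanishing outside the finite \<open>C\<close> makes the sphere a closed subset of a product of
  intervals [-1,1] and single points, which is compact by Tychonoff; so such functions can be
  handled as vectors of a finite-dimensional space.\<close>

lemma compact_supp_sphere:
  assumes "finite C"
  shows "compact (supp_sphere C :: ('c \<Rightarrow> real) set)"
proof -
  let ?K = "PiE UNIV (\<lambda>c. if c \<in> C then {-1..1::real} else {0})"
  have cont: "continuous_on UNIV (\<lambda>h::'c \<Rightarrow> real. \<Sum>c\<in>C. (h c)\<^sup>2)"
    by (intro continuous_intros continuous_on_product_coordinates)
  have cl: "closed {h::'c \<Rightarrow> real. (\<Sum>c\<in>C. (h c)\<^sup>2) = 1}"
    by (intro closed_Collect_eq cont continuous_on_const)
  have "compactin (product_topology (\<lambda>_. euclideanreal) (UNIV::'c set)) ?K"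
    by (subst compactin_PiE) auto
  then have "compact ?K"
    by (simp add: euclidean_product_topology)
  moreover have "supp_sphere C = ?K \<inter> {h. (\<Sum>c\<in>C. (h c)\<^sup>2) = 1}"
  proof -
    have "-1 \<le> h c \<and> h c \<le> 1" if "c \<in> C" "(\<Sum>c\<in>C. (h c)\<^sup>2) = 1" for h :: "'c \<Rightarrow> real" and c
    proof -
      have "(h c)\<^sup>2 \<le> 1"
        using that member_le_sum[of c C "\<lambda>c. (h c)\<^sup>2"] assms by simp
      then show ?thesis by (simp add: abs_square_le_1 abs_le_iff)
    qed
    then show ?thesis by (fastforce simp: supp_sphere_def PiE_iff split: if_splits)
  qed
  ultimately show ?thesis
    using cl by (simp add: compact_Int_closed)
qed

lemma normalize_supp_sphere:
  fixes h :: "'c \<Rightarrow> real"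
  assumes "finite C" "\<And>c. c \<notin> C \<Longrightarrow> h c = 0" "h \<noteq> (\<lambda>c. 0)"
  obtains r where "r > 0" "(\<lambda>c. r * h c) \<in> supp_sphere C" "r\<^sup>2 * (\<Sum>c\<in>C. (h c)\<^sup>2) = 1"
proof -
  define S where "S = (\<Sum>c\<in>C. (h c)\<^sup>2)"
  obtain c where "h c \<noteq> 0" using assms(3) by auto
  then have "c \<in> C" using assms(2) by auto
  then have "0 < S" unfolding S_def using assms(1) \<open>h c \<noteq> 0\<close> by (intro sum_pos2[of C c]) auto
  have "(1 / sqrt S)\<^sup>2 * S = 1" using \<open>0 < S\<close> by (simp add: power_divide)
  moreover have "(\<lambda>c. 1 / sqrt S * h c) \<in> supp_sphere C"
    using assms(2) calculation
    by (simp add: supp_sphere_def power_mult_distrib power_divide flip: sum_divide_distrib) (simp add: S_def)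
  moreover have "1 / sqrt S > 0" using \<open>0 < S\<close> by simp
  ultimately show ?thesis using that S_def by blast
qed

lemma supp_sphere_lower_bound:
  assumes "finite C" "continuous_on UNIV g" "\<And>h. h \<in> supp_sphere C \<Longrightarrow> g h > (0::real)"
  obtains \<delta> where "\<delta> > 0" "\<And>h. h \<in> supp_sphere C \<Longrightarrow> \<delta> \<le> g h"
proof (cases "supp_sphere C = {}")
  case True
  then show ?thesis using that[of 1] by auto
next
  case False
  obtain x where "x \<in> supp_sphere C" "\<forall>y\<in>supp_sphere C. g x \<le> g y"
    using continuous_attains_inf[OF compact_supp_sphere[OF assms(1)] False
        continuous_on_subset[OF assms(2) subset_UNIV]] by auto
  then show ?thesis using that[of "g x"] assms(3) by auto
qed

text \<open>A quadratic polynomial in \<open>e\<close> without constant term that never becomes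
  negative has slope zero at the origin. Applied to the form at g + e k, this is the fact that null
  vectors of a semidefinite form lie in its radical.\<close>

lemma semidefinite_null_orthogonal:
  assumes "\<And>e. 0 \<le> 2 * e * u + e\<^sup>2 * v"
  shows "u = (0::real)"
proof (rule ccontr)
  assume "u \<noteq> 0"
  \<comment> \<open>A step against the slope, short enough for the linear term to win; the summand 1
    covers \<open>v = 0\<close>.\<close>
  define e where "e = - u / (\<bar>v\<bar> + 1)"
  have p: "\<bar>v\<bar> + 1 > 0" by simp
  have "2 * e * u + e\<^sup>2 * v \<le> 2 * e * u + e\<^sup>2 * (\<bar>v\<bar> + 1)"
    by (intro add_left_mono mult_left_mono) auto
  also have "\<dots> = - u\<^sup>2 / (\<bar>v\<bar> + 1)"
    using p unfolding e_def by (simp add: power2_eq_square divide_simps)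
  also have "\<dots> < 0" using p \<open>u \<noteq> 0\<close> by (simp add: divide_simps)
  finally show False using assms[of e] by simp
qed

text \<open>At the first parameter where the form is not positive definite it is still positive
  semidefinite, so that a null vector of it would lie in its radical.\<close>

lemma pos_def_homotopy:
  fixes Q :: "real \<Rightarrow> ('c \<Rightarrow> real) \<Rightarrow> ('c \<Rightarrow> real) \<Rightarrow> real"
  assumes C: "finite C" and T: "closed T" "\<And>h c. h \<in> T \<Longrightarrow> c \<notin> C \<Longrightarrow> h c = 0"
    and lin: "\<And>h k a b. h \<in> T \<Longrightarrow> k \<in> T \<Longrightarrow> (\<lambda>c. a * h c + b * k c) \<in> T"
    and sym: "\<And>t h k. h \<in> T \<Longrightarrow> k \<in> T \<Longrightarrow> Q t h k = Q t k h"
    and bil: "\<And>t h h' k a b. h \<in> T \<Longrightarrow> h' \<in> T \<Longrightarrow> k \<in> T \<Longrightarrow>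
      Q t (\<lambda>c. a * h c + b * h' c) k = a * Q t h k + b * Q t h' k"
    and cont: "continuous_on ({0..1} \<times> UNIV) (\<lambda>(t, h). Q t h h)"
    and Q0: "\<And>h. h \<in> T \<Longrightarrow> h \<noteq> (\<lambda>c. 0) \<Longrightarrow> Q 0 h h > 0"
    and nondeg: "\<And>t h. t \<in> {0..1} \<Longrightarrow> h \<in> T \<Longrightarrow> (\<And>k. k \<in> T \<Longrightarrow> Q t h k = 0) \<Longrightarrow> h = (\<lambda>c. 0)"
    and h: "h \<in> T" "h \<noteq> (\<lambda>c. 0)"
  shows "Q 1 h h > 0"
proof (rule ccontr)
  assume neg: "\<not> Q 1 h h > 0"
  have quad: "Q t (\<lambda>c. a * h c + b * k c) (\<lambda>c. a * h c + b * k c) =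
      a\<^sup>2 * Q t h h + 2 * (a * b) * Q t h k + b\<^sup>2 * Q t k k" if "h \<in> T" "k \<in> T" for t h k a b
    using that bil[of h k "\<lambda>c. a * h c + b * k c" t a b] lin[of h k a b]
      bil[of h k h t a b] bil[of h k k t a b] sym[of h "\<lambda>c. a * h c + b * k c" t]
      sym[of k "\<lambda>c. a * h c + b * k c" t] sym[of h k t]
    by (simp add: algebra_simps power2_eq_square)
  have scale: "Q t (\<lambda>c. r * h c) (\<lambda>c. r * h c) = r\<^sup>2 * Q t h h" if "h \<in> T" for t h r
    using quad[OF that that, of t r 0] by simp
  have scaleT: "(\<lambda>c. r * h c) \<in> T" if "h \<in> T" for h r
    using lin[OF that that, of r 0] by simp
  define A where "A = {p \<in> {0..1} \<times> UNIV. (case p of (t, h) \<Rightarrow> Q t h h) \<le> 0}"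
  \<comment> \<open>All pairs of a parameter and a normalized direction at which positivity fails.
    Compactness yields a pair with least parameter, that is, the first failure.\<close>
  define Z where "Z = ({0..1} \<times> supp_sphere C) \<inter> (({0..1} \<times> T) \<inter> A)"
  have "closed A" unfolding A_def
    by (rule continuous_on_closed_Collect_le[OF cont]) (auto intro: closed_Times)
  then have "compact Z"
    unfolding Z_def using T(1) compact_supp_sphere[OF C]
    by (intro compact_Int_closed compact_Times closed_Int closed_Times) auto
  obtain r where r: "r > 0" "(\<lambda>c. r * h c) \<in> supp_sphere C"
    using normalize_supp_sphere[OF C T(2)[OF h(1)] h(2)] by blast
  have "(1, \<lambda>c. r * h c) \<in> Z"
    using r h neg scale[OF h(1)] scaleT[OF h(1)] by (auto simp: Z_def A_def mult_nonneg_nonpos)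
  then have "Z \<noteq> {}" by auto
  have "continuous_on Z fst" by (intro continuous_intros)
  then obtain p where p: "p \<in> Z" "\<forall>y\<in>Z. fst p \<le> fst y"
    using continuous_attains_inf[OF \<open>compact Z\<close> \<open>Z \<noteq> {}\<close>, of fst] by blast
  obtain t g where tg: "p = (t, g)" by (cases p)
  have t: "0 \<le> t" "t \<le> 1" and g: "g \<in> supp_sphere C" "g \<in> T" "Q t g g \<le> 0"
    using p(1) by (auto simp: Z_def A_def tg)
  have g0: "g \<noteq> (\<lambda>c. 0)" using g(1) by (auto simp: supp_sphere_def)
  have "t \<noteq> 0" using Q0[OF g(2) g0] g(3) by auto
  have before: "Q s k k > 0" if s: "0 \<le> s" "s < t" and k: "k \<in> T" "k \<noteq> (\<lambda>c. 0)" for s k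
  proof (rule ccontr)
    assume n: "\<not> Q s k k > 0"
    obtain r where r: "r > 0" "(\<lambda>c. r * k c) \<in> supp_sphere C"
      using normalize_supp_sphere[OF C T(2)[OF k(1)] k(2)] by blast
    have "(s, \<lambda>c. r * k c) \<in> Z"
      using r n scale[OF k(1)] scaleT[OF k(1)] s t k by (auto simp: Z_def A_def mult_nonneg_nonpos)
    then show False using p(2) s(2) tg by auto
  qed
  \<comment> \<open>Limit from the left of positive values; that filter is nontrivial because
    \<open>Q0\<close> excludes a failure at parameter 0.\<close>
  have psd: "Q t k k \<ge> 0" if "k \<in> T" for k
  proof (cases "k = (\<lambda>c. 0)")
    case True
    then show ?thesis using scale[OF that, of t 0] by simp
  next
    case False
    have "continuous_on {0..1} ((\<lambda>(t, h). Q t h h) \<circ> (\<lambda>s. (s, k)))"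
      by (rule continuous_on_compose) (auto intro!: continuous_intros continuous_on_subset[OF cont])
    then have "((\<lambda>s. Q s k k) \<longlongrightarrow> Q t k k) (at t within {0..1})"
      using t by (auto simp: continuous_on_def comp_def)
    then have "((\<lambda>s. Q s k k) \<longlongrightarrow> Q t k k) (at t within {0..<t})"
      by (rule tendsto_within_subset) (use t in auto)
    moreover have "\<forall>\<^sub>F s in at t within {0..<t}. 0 \<le> Q s k k"
      using before[OF _ _ that False] by (auto simp: eventually_at_filter less_imp_le)
    moreover have "at t within {0..<t} \<noteq> bot"
      using t \<open>t \<noteq> 0\<close> by (auto simp: trivial_limit_within islimpt_Ico)
    ultimately show ?thesis by (rule tendsto_lowerbound)
  qed
  have "Q t g k = 0" if "k \<in> T" for k
  proof (rule semidefinite_null_orthogonal)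
    fix e
    have "0 \<le> Q t (\<lambda>c. 1 * g c + e * k c) (\<lambda>c. 1 * g c + e * k c)"
      by (intro psd lin g that)
    also have "\<dots> \<le> 2 * e * Q t g k + e\<^sup>2 * Q t k k"
      unfolding quad[OF g(2) that] using g(3) by simp
    finally show "0 \<le> 2 * e * Q t g k + e\<^sup>2 * Q t k k" .
  qed
  then have "g = (\<lambda>c. 0)" using nondeg[of t g] t g(2) by auto
  then show False using g0 by simp
qed

section \<open>Norms and the spectral radius\<close>

text \<open>The type \<open>real vec\<close> contains vectors of every dimension, so compactness is
  borrowed from functions supported on \<open>{..<n}\<close>, and continuity is asked of
  \<open>g\<close> composed with \<open>Matrix.vec n\<close>.\<close>

lemma vec_sphere_lower_bound:
  fixes g :: "real vec \<Rightarrow> real"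
  assumes cont: "continuous_on UNIV (\<lambda>h. g (Matrix.vec n h))"
    and pos: "\<And>v. v \<in> carrier_vec n \<Longrightarrow> v \<noteq> 0\<^sub>v n \<Longrightarrow> g v > 0"
  obtains \<delta> where "\<delta> > 0" "\<And>v. v \<in> carrier_vec n \<Longrightarrow> scalar_prod v v = 1 \<Longrightarrow> \<delta> \<le> g v"
proof -
  have nz: "Matrix.vec n h \<noteq> 0\<^sub>v n" if "h \<in> supp_sphere {..<n}" for h :: "nat \<Rightarrow> real"
  proof
    assume "Matrix.vec n h = 0\<^sub>v n"
    then have "h k = 0" if "k < n" for k
      using that by (metis index_vec index_zero_vec(1))
    then show False using that by (simp add: supp_sphere_def)
  qed
  obtain \<delta> where d: "\<delta> > 0" "\<And>h. h \<in> supp_sphere {..<n} \<Longrightarrow> \<delta> \<le> g (Matrix.vec n h)"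
    using supp_sphere_lower_bound[OF _ cont] pos nz by (metis finite_lessThan vec_carrier)
  show ?thesis
  proof (rule that[OF d(1)])
    fix v :: "real vec" assume v: "v \<in> carrier_vec n" "scalar_prod v v = 1"
    let ?h = "\<lambda>k. if k < n then vec_index v k else 0"
    have "?h \<in> supp_sphere {..<n}"
      using v by (simp add: supp_sphere_def scalar_prod_def power2_eq_square lessThan_atLeast0)
    moreover have "Matrix.vec n ?h = v" using v(1) by (intro eq_vecI) auto
    ultimately show "\<delta> \<le> g v" using d(2)[of ?h] by simp
  qed
qed

lemma scalar_prod_self_pos:
  fixes v :: "real vec"
  assumes "v \<in> carrier_vec n" "v \<noteq> 0\<^sub>v n"
  shows "scalar_prod v v > 0"
proof -
  obtain k where "k < n" "vec_index v k \<noteq> 0"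
    using assms by (metis carrier_vecD eq_vecI index_zero_vec)
  then show ?thesis using assms(1)
    unfolding scalar_prod_def by (intro sum_pos2[of _ k]) (auto simp flip: power2_eq_square)
qed

lemma scalar_prod_self_nonneg: "scalar_prod v v \<ge> (0::real)"
  unfolding scalar_prod_def by (intro sum_nonneg) auto

lemma abs_index_le_sqrt_scalar_prod:
  fixes v :: "real vec"
  assumes "k < dim_vec v"
  shows "\<bar>vec_index v k\<bar> \<le> sqrt (scalar_prod v v)"
proof -
  have "(vec_index v k)\<^sup>2 \<le> scalar_prod v v"
    unfolding scalar_prod_def power2_eq_square using assms by (intro member_le_sum) auto
  then show ?thesis by (metis real_sqrt_abs real_sqrt_le_iff)
qed

lemma normalize_vec:
  fixes v :: "real vec"
  assumes "v \<in> carrier_vec n" "v \<noteq> 0\<^sub>v n"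
  shows "scalar_prod ((1 / sqrt (scalar_prod v v)) \<cdot>\<^sub>v v) ((1 / sqrt (scalar_prod v v)) \<cdot>\<^sub>v v) = 1"
proof -
  define s where "s = sqrt (scalar_prod v v)"
  have "s > 0" "scalar_prod v v = s * s" using scalar_prod_self_pos[OF assms] by (auto simp: s_def)
  then show ?thesis unfolding s_def[symmetric] using assms(1)
    by (simp add: smult_scalar_prod_distrib[of _ n] scalar_prod_smult_distrib[of _ n])
qed

lemma is_norm_triangle:
  "is_norm n \<nu> \<Longrightarrow> v \<in> carrier_vec n \<Longrightarrow> w \<in> carrier_vec n \<Longrightarrow> \<nu> (v + w) \<le> \<nu> v + \<nu> w"
  by (simp add: is_norm_def)

lemma is_norm_smult:
  "is_norm n \<nu> \<Longrightarrow> v \<in> carrier_vec n \<Longrightarrow> \<nu> (a \<cdot>\<^sub>v v) = \<bar>a\<bar> * \<nu> v"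
  by (simp add: is_norm_def)

text \<open>The triangle inequality is applied to one coordinate at a time: the induction runs over
  the vector cut off after its first \<open>m\<close> entries.\<close>

lemma is_norm_le_sum:
  assumes "is_norm n \<nu>"
  shows "\<nu> (Matrix.vec n h) \<le> (\<Sum>k<n. \<bar>h k\<bar> * \<nu> (unit_vec n k))"
proof -
  have "\<nu> (Matrix.vec n (\<lambda>k. if k < m then h k else 0)) \<le> (\<Sum>k<m. \<bar>h k\<bar> * \<nu> (unit_vec n k))"
    if "m \<le> n" for m
    using that
  proof (induction m)
    case 0
    have "Matrix.vec n (\<lambda>k. 0) = (0\<^sub>v n :: real vec)" by auto
    moreover have "\<nu> (0\<^sub>v n) = 0" using assms by (simp add: is_norm_def)
    ultimately show ?case by simp
  next
    case (Suc m)
    have "Matrix.vec n (\<lambda>k. if k < Suc m then h k else 0) =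
        Matrix.vec n (\<lambda>k. if k < m then h k else 0) + h m \<cdot>\<^sub>v unit_vec n m"
      using Suc.prems by (intro eq_vecI) (auto simp: less_Suc_eq)
    then have "\<nu> (Matrix.vec n (\<lambda>k. if k < Suc m then h k else 0)) \<le>
        \<nu> (Matrix.vec n (\<lambda>k. if k < m then h k else 0)) + \<nu> (h m \<cdot>\<^sub>v unit_vec n m)"
      by (simp add: is_norm_triangle[OF assms])
    also have "\<nu> (h m \<cdot>\<^sub>v unit_vec n m) = \<bar>h m\<bar> * \<nu> (unit_vec n m)"
      using assms by (simp add: is_norm_def)
    finally show ?case using Suc.IH Suc.prems by (simp add: Suc_le_lessD less_imp_le)
  qed
  moreover have "Matrix.vec n (\<lambda>k. if k < n then h k else 0) = Matrix.vec n h" by auto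
  ultimately show ?thesis using order_refl[of n] by force
qed

text \<open>By the previous bound, applied to a difference, every norm is Lipschitz for a weighted
  sum of absolute values, and that sum is visibly continuous and zero at the base point.\<close>

lemma is_norm_continuous:
  assumes "is_norm n \<nu>"
  shows "continuous_on UNIV (\<lambda>h::nat \<Rightarrow> real. \<nu> (Matrix.vec n h))"
proof -
  have diff: "\<nu> (Matrix.vec n h) - \<nu> (Matrix.vec n g) \<le> (\<Sum>k<n. \<bar>h k - g k\<bar> * \<nu> (unit_vec n k))"
    for h g :: "nat \<Rightarrow> real"
  proof -
    have "Matrix.vec n h = Matrix.vec n g + Matrix.vec n (\<lambda>k. h k - g k)" by auto
    then have "\<nu> (Matrix.vec n h) \<le> \<nu> (Matrix.vec n g) + \<nu> (Matrix.vec n (\<lambda>k. h k - g k))"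
      using assms by (simp add: is_norm_def)
    then show ?thesis using is_norm_le_sum[OF assms, of "\<lambda>k. h k - g k"] by linarith
  qed
  have "((\<lambda>h. \<nu> (Matrix.vec n h)) \<longlongrightarrow> \<nu> (Matrix.vec n g)) (at g)" for g :: "nat \<Rightarrow> real"
  proof -
    let ?b = "\<lambda>h. \<Sum>k<n. \<bar>h k - g k\<bar> * \<nu> (unit_vec n k)"
    have "continuous_on UNIV ?b"
      by (intro continuous_intros continuous_on_product_coordinates)
    then have "(?b \<longlongrightarrow> ?b g) (at g)" unfolding continuous_on_def by blast
    then have "(?b \<longlongrightarrow> 0) (at g)" by simp
    moreover have "\<bar>\<nu> (Matrix.vec n h) - \<nu> (Matrix.vec n g)\<bar> \<le> ?b h" for h
      using diff[of h g] diff[of g h] by (simp add: abs_minus_commute)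
    then have bnd: "\<forall>h. norm (\<nu> (Matrix.vec n h) - \<nu> (Matrix.vec n g)) \<le> ?b h"
      by (simp only: real_norm_def) blast
    ultimately have "((\<lambda>h. \<nu> (Matrix.vec n h) - \<nu> (Matrix.vec n g)) \<longlongrightarrow> 0) (at g)"
      using Lim_null_comparison[OF always_eventually[OF bnd]] by blast
    then show ?thesis by (rule LIM_zero_cancel)
  qed
  then show ?thesis by (simp add: continuous_on_def)
qed

text \<open>One half of the equivalence of norms in finite dimension: a positive minimum on the
  Euclidean sphere, extended by homogeneity.\<close>

lemma is_norm_lower_bound:
  assumes "is_norm n \<nu>"
  obtains \<delta> where "\<delta> > 0" "\<And>v. v \<in> carrier_vec n \<Longrightarrow> \<delta> * sqrt (scalar_prod v v) \<le> \<nu> v"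
proof -
  have "\<nu> v > 0" if "v \<in> carrier_vec n" "v \<noteq> 0\<^sub>v n" for v
    using assms that by (metis is_norm_def order_le_imp_less_or_eq)
  then obtain \<delta> where d: "\<delta> > 0" "\<And>v. v \<in> carrier_vec n \<Longrightarrow> scalar_prod v v = 1 \<Longrightarrow> \<delta> \<le> \<nu> v"
    using vec_sphere_lower_bound[OF is_norm_continuous[OF assms]] by blast
  show ?thesis
  proof (rule that[OF d(1)])
    fix v :: "real vec" assume v: "v \<in> carrier_vec n"
    show "\<delta> * sqrt (scalar_prod v v) \<le> \<nu> v"
    proof (cases "v = 0\<^sub>v n")
      case True
      then show ?thesis using assms by (simp add: is_norm_def)
    next
      case False
      define s where "s = sqrt (scalar_prod v v)"
      have "s > 0" using scalar_prod_self_pos[OF v False] by (simp add: s_def)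
      have "\<delta> \<le> \<nu> ((1 / s) \<cdot>\<^sub>v v)"
        using d(2) normalize_vec[OF v False] v by (simp add: s_def)
      also have "\<dots> = \<bar>1 / s\<bar> * \<nu> v" by (rule is_norm_smult[OF assms v])
      finally show ?thesis using \<open>s > 0\<close> unfolding s_def[symmetric] by (simp add: field_simps)
    qed
  qed
qed

text \<open>A crude constant, the sum of the squared absolute row sums. Only its existence matters:
  for the finiteness of operator norms, and for the shift that turns a positive definite matrix into
  a contraction.\<close>

lemma mult_mat_vec_bound:
  fixes A :: "real mat"
  assumes A: "A \<in> carrier_mat m n"
  obtains K where "K \<ge> 0"
    "\<And>v. v \<in> carrier_vec n \<Longrightarrow> scalar_prod (A *\<^sub>v v) (A *\<^sub>v v) \<le> K * scalar_prod v v"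
proof -
  define R where "R i = (\<Sum>j<n. \<bar>A $$ (i, j)\<bar>)" for i
  have le: "\<bar>vec_index (A *\<^sub>v v) i\<bar> \<le> R i * sqrt (scalar_prod v v)"
    if "v \<in> carrier_vec n" "i < m" for v i
  proof -
    have "\<bar>vec_index (A *\<^sub>v v) i\<bar> = \<bar>\<Sum>j<n. A $$ (i, j) * vec_index v j\<bar>"
      using A that by (simp add: scalar_prod_def lessThan_atLeast0)
    also have "\<dots> \<le> (\<Sum>j<n. \<bar>A $$ (i, j)\<bar> * \<bar>vec_index v j\<bar>)"
      by (rule order_trans[OF sum_abs]) (simp add: abs_mult)
    also have "\<dots> \<le> (\<Sum>j<n. \<bar>A $$ (i, j)\<bar> * sqrt (scalar_prod v v))"
      using that by (intro sum_mono mult_left_mono abs_index_le_sqrt_scalar_prod) auto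
    finally show ?thesis by (simp add: R_def sum_distrib_right)
  qed
  show ?thesis
  proof (rule that)
    show "0 \<le> (\<Sum>i<m. (R i)\<^sup>2)" by (simp add: sum_nonneg)
    fix v :: "real vec" assume v: "v \<in> carrier_vec n"
    have "scalar_prod (A *\<^sub>v v) (A *\<^sub>v v) = (\<Sum>i<m. \<bar>vec_index (A *\<^sub>v v) i\<bar>\<^sup>2)"
      using A v by (simp add: scalar_prod_def lessThan_atLeast0 power2_eq_square)
    also have "\<dots> \<le> (\<Sum>i<m. (R i * sqrt (scalar_prod v v))\<^sup>2)"
      using le[OF v] by (intro sum_mono power_mono) auto
    also have "\<dots> = (\<Sum>i<m. (R i)\<^sup>2) * scalar_prod v v"
      by (simp add: power_mult_distrib scalar_prod_self_nonneg sum_distrib_right)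
    finally show "scalar_prod (A *\<^sub>v v) (A *\<^sub>v v) \<le> (\<Sum>i<m. (R i)\<^sup>2) * scalar_prod v v" .
  qed
qed

text \<open>\<open>op_norm\<close> is a supremum, hence informative only once its set is known to be
  bounded. The unit ball of \<open>\<nu>\<close> lies in a Euclidean ball of radius 1 /
  \<open>\<delta>\<close>, so the entries of the image vectors are bounded, and with them their
  \<open>\<mu>\<close>-norms.\<close>

lemma
  assumes A: "A \<in> carrier_mat m n" and out: "is_norm m \<mu>" and inn: "is_norm n \<nu>"
  shows op_norm_nonneg: "0 \<le> op_norm \<mu> \<nu> A"
    and op_norm_bound: "v \<in> carrier_vec n \<Longrightarrow> \<mu> (A *\<^sub>v v) \<le> op_norm \<mu> \<nu> A * \<nu> v"
proof -
  let ?S = "{\<mu> (A *\<^sub>v v) | v. v \<in> carrier_vec (dim_col A) \<and> \<nu> v \<le> 1}"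
  obtain \<delta> where d: "\<delta> > 0" "\<And>v. v \<in> carrier_vec n \<Longrightarrow> \<delta> * sqrt (scalar_prod v v) \<le> \<nu> v"
    using is_norm_lower_bound[OF inn] by blast
  obtain K where K: "K \<ge> 0"
    "\<And>v. v \<in> carrier_vec n \<Longrightarrow> scalar_prod (A *\<^sub>v v) (A *\<^sub>v v) \<le> K * scalar_prod v v"
    using mult_mat_vec_bound[OF A] by blast
  let ?K = "\<Sum>k<m. (sqrt K / \<delta>) * \<mu> (unit_vec m k)"
  have "\<mu> (A *\<^sub>v v) \<le> ?K" if v: "v \<in> carrier_vec n" "\<nu> v \<le> 1" for v
  proof -
    have "sqrt (scalar_prod v v) \<le> 1 / \<delta>"
      using d(2)[OF v(1)] v(2) d(1) by (simp add: pos_le_divide_eq mult.commute)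
    then have "sqrt K * sqrt (scalar_prod v v) \<le> sqrt K * (1 / \<delta>)"
      using K(1) by (intro mult_left_mono) auto
    moreover have "sqrt (scalar_prod (A *\<^sub>v v) (A *\<^sub>v v)) \<le> sqrt K * sqrt (scalar_prod v v)"
      using K(2)[OF v(1)] by (simp flip: real_sqrt_mult)
    ultimately have "\<bar>vec_index (A *\<^sub>v v) k\<bar> \<le> sqrt K / \<delta>" if "k < m" for k
      using abs_index_le_sqrt_scalar_prod[of k "A *\<^sub>v v"] A that by simp
    moreover have "A *\<^sub>v v = Matrix.vec m (\<lambda>k. vec_index (A *\<^sub>v v) k)" using A by auto
    moreover have "0 \<le> \<mu> (unit_vec m k)" for k using out by (simp add: is_norm_def)
    ultimately show ?thesis using is_norm_le_sum[OF out, of "\<lambda>k. vec_index (A *\<^sub>v v) k"]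
      by (smt (verit) lessThan_iff mult_right_mono sum_mono)
  qed
  then have bdd: "bdd_above ?S" using A by (auto simp: bdd_above_def)
  have upper: "\<mu> (A *\<^sub>v v) \<le> op_norm \<mu> \<nu> A" if "v \<in> carrier_vec n" "\<nu> v \<le> 1" for v
    unfolding op_norm_def using that A by (intro cSup_upper bdd) auto
  have Av0: "\<mu> (A *\<^sub>v 0\<^sub>v n) = 0"
  proof -
    have "A *\<^sub>v 0\<^sub>v n = 0\<^sub>v m" using A by (intro eq_vecI) auto
    then show ?thesis using out by (simp add: is_norm_def)
  qed
  have n0: "\<nu> (0\<^sub>v n) = 0" using inn by (simp add: is_norm_def)
  show "0 \<le> op_norm \<mu> \<nu> A" using upper[of "0\<^sub>v n"] Av0 n0 by simp
  show "\<mu> (A *\<^sub>v v) \<le> op_norm \<mu> \<nu> A * \<nu> v" if v: "v \<in> carrier_vec n"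
  proof (cases "v = 0\<^sub>v n")
    case True
    then show ?thesis using Av0 n0 by simp
  next
    case False
    then have p: "\<nu> v > 0" using inn v by (metis is_norm_def order_le_imp_less_or_eq)
    have "\<nu> ((1 / \<nu> v) \<cdot>\<^sub>v v) = \<bar>1 / \<nu> v\<bar> * \<nu> v" by (rule is_norm_smult[OF inn v])
    then have "\<mu> (A *\<^sub>v ((1 / \<nu> v) \<cdot>\<^sub>v v)) \<le> op_norm \<mu> \<nu> A"
      using p v by (intro upper) auto
    also have "A *\<^sub>v ((1 / \<nu> v) \<cdot>\<^sub>v v) = (1 / \<nu> v) \<cdot>\<^sub>v (A *\<^sub>v v)"
      using A v by (rule mult_mat_vec)
    also have "\<mu> \<dots> = \<bar>1 / \<nu> v\<bar> * \<mu> (A *\<^sub>v v)"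
      by (rule is_norm_smult[OF out mult_mat_vec_carrier[OF A v]])
    finally show ?thesis using p by (simp add: field_simps)
  qed
qed

section \<open>Nonnegative vectors subinvariant under the edge matrix\<close>

lemma smult_mat_mult_vec:
  "v \<in> carrier_vec (dim_col A) \<Longrightarrow> (a \<cdot>\<^sub>m A) *\<^sub>v v = a \<cdot>\<^sub>v (A *\<^sub>v (v :: 'a :: comm_semiring_1 vec))"
  by (intro eq_vecI) (auto simp: scalar_prod_def sum_distrib_left mult_ac)

text \<open>The hypothesis iterates to n <= c^k (M^T)^k n. Instead of a Perron-Frobenius
  eigenvector, the proof uses the growth of matrix powers: after rescaling to spectral radius below
  1 all powers are entrywise bounded, and the remaining scalar factor tends to 0.\<close>

lemma nonneg_subinvariant_zero:
  fixes F :: "'v set set" and n :: "'v set \<times> 'v \<Rightarrow> real"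
  assumes fin: "finite (directed_edges F)" and n0: "\<And>e. e \<in> directed_edges F \<Longrightarrow> 0 \<le> n e"
    and c: "0 \<le> c" "c * rho F < 1"
    and le: "\<And>e'. e' \<in> directed_edges F \<Longrightarrow> n e' \<le> c * (\<Sum>e\<in>{e \<in> directed_edges F. edge_succ e e'}. n e)"
    and e: "e \<in> directed_edges F"
  shows "n e = 0"
proof -
  \<comment> \<open>The same choice of enumeration as in \<open>rho\<close>, so that the matrix
    below is the one whose spectral radius is \<open>rho F\<close>.\<close>
  define es where "es = (SOME es. distinct es \<and> set es = directed_edges F)"
  have "\<exists>es. distinct es \<and> set es = directed_edges F"
    using finite_distinct_list[OF fin] by blast
  then have es: "distinct es" "set es = directed_edges F"
    unfolding es_def by (metis (mono_tags, lifting) someI_ex)+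
  define L where "L = length es"
  have bij: "bij_betw (\<lambda>k. es ! k) {..<L} (directed_edges F)"
    using bij_betw_nth[OF es(1)] es(2) by (simp add: L_def)
  have "L > 0" using e es(2) by (auto simp: L_def)
  define M where "M = succ_matrix es"
  have M: "M \<in> carrier_mat L L" by (simp add: M_def succ_matrix_def L_def)
  have rho: "rho F = spectral_radius M" using e by (auto simp: rho_def M_def es_def)
  have mem: "spectral_radius M \<in> cmod ` spectrum M" "\<And>x. x \<in> cmod ` spectrum M \<Longrightarrow> x \<le> spectral_radius M"
    using spectral_radius_mem_max[OF M \<open>L > 0\<close>] by auto
  then have "rho F \<ge> 0" using rho by auto
  \<comment> \<open>The strict inequality leaves room on both sides: \<open>q * rho F < 1\<close>
    keeps the powers of q M bounded, and \<open>q > c\<close> makes (c / q)^k decay.\<close>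
  obtain q where q: "q > c" "q * rho F < 1"
  proof (cases "rho F = 0")
    case True
    then show ?thesis using that[of "c + 1"] by simp
  next
    case False
    then have "rho F > 0" using \<open>rho F \<ge> 0\<close> by simp
    then have "c < 1 / rho F" using c(2) by (simp add: field_simps)
    then obtain q where "c < q" "q < 1 / rho F" using dense by blast
    then show ?thesis using that[of q] \<open>rho F > 0\<close> by (simp add: field_simps)
  qed
  then have "q > 0" using c by simp
  define P where "P = mat L L (\<lambda>(k, l). if edge_succ (es ! k) (es ! l) then q else 0)"
  have P: "P \<in> carrier_mat L L" by (simp add: P_def)
  let ?A = "map_mat complex_of_real P"
  have A: "?A \<in> carrier_mat L L" using P by simp
  have AM: "?A = complex_of_real q \<cdot>\<^sub>m M"
    by (auto simp: P_def M_def succ_matrix_def L_def)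
  have "spectral_radius ?A < 1"
  proof -
    obtain \<mu> where mu: "eigenvalue ?A \<mu>" "cmod \<mu> = spectral_radius ?A"
      using spectral_radius_mem_max(1)[OF A \<open>L > 0\<close>] by (auto simp: spectrum_def)
    then obtain v where v: "v \<in> carrier_vec L" "v \<noteq> 0\<^sub>v L" "?A *\<^sub>v v = \<mu> \<cdot>\<^sub>v v"
      using P by (auto simp: eigenvalue_def eigenvector_def)
    have "M *\<^sub>v v = (\<mu> / q) \<cdot>\<^sub>v v"
    proof -
      have "complex_of_real q \<cdot>\<^sub>v (M *\<^sub>v v) = \<mu> \<cdot>\<^sub>v v"
        using v(3) AM M v(1) by (simp add: smult_mat_mult_vec)
      then have "(1 / complex_of_real q) \<cdot>\<^sub>v (complex_of_real q \<cdot>\<^sub>v (M *\<^sub>v v)) = (1 / complex_of_real q) \<cdot>\<^sub>v (\<mu> \<cdot>\<^sub>v v)"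
        by simp
      then show ?thesis using \<open>q > 0\<close> by (simp add: smult_smult_assoc)
    qed
    then have "eigenvalue M (\<mu> / q)" using M v by (auto simp: eigenvalue_def eigenvector_def)
    then have "cmod (\<mu> / q) \<le> spectral_radius M" by (intro mem(2)) (auto simp: spectrum_def)
    then have "cmod \<mu> \<le> q * rho F" using \<open>q > 0\<close> rho by (simp add: norm_divide field_simps)
    then show ?thesis using q mu by simp
  qed
  then obtain K where K: "\<And>k. norm_bound (?A ^\<^sub>m k) K"
    using spectral_radius_jnf_norm_bound_less_1_upper_triangular[OF A] by blast
  have hom: "?A ^\<^sub>m k = map_mat complex_of_real (P ^\<^sub>m k)" for k
    by (rule of_real_hom.mat_hom_pow[OF P, symmetric])
  have PK: "(P ^\<^sub>m k) $$ (i, j) \<le> K" if "i < L" "j < L" for k i j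
  proof -
    have "cmod ((?A ^\<^sub>m k) $$ (i, j)) \<le> K"
      using K[of k] that A by (simp add: norm_bound_def)
    then show ?thesis unfolding hom using that P by simp
  qed
  have nth: "es ! l \<in> directed_edges F" if "l < L" for l
    using nth_mem[of l es] that unfolding es(2) L_def .
  have step: "n (es ! l) \<le> (c / q) * (\<Sum>j<L. n (es ! j) * P $$ (j, l))" if "l < L" for l
  proof -
    have mem: "es ! l \<in> directed_edges F" by (rule nth[OF that])
    have "(\<Sum>e\<in>{e \<in> directed_edges F. edge_succ e (es ! l)}. n e) =
        (\<Sum>e\<in>directed_edges F. if edge_succ e (es ! l) then n e else 0)"
      by (rule sum.inter_filter[OF fin])
    also have "\<dots> = (\<Sum>j<L. if edge_succ (es ! j) (es ! l) then n (es ! j) else 0)"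
      by (rule sum.reindex_bij_betw[OF bij, symmetric])
    also have "\<dots> = (\<Sum>j<L. n (es ! j) * P $$ (j, l)) / q"
      unfolding sum_divide_distrib using that \<open>q > 0\<close> by (intro sum.cong[OF refl]) (simp add: P_def)
    finally show ?thesis using le[OF mem] by simp
  qed
  \<comment> \<open>The vector multiplies from the left: the sender of a message is the row index of
    the matrix, the receiver the column index.\<close>
  have iter: "n (es ! l) \<le> (c / q) ^ k * (\<Sum>j<L. n (es ! j) * (P ^\<^sub>m k) $$ (j, l))" if "l < L" for l k
    using that
  proof (induction k arbitrary: l)
    case 0
    have "(\<Sum>j<L. n (es ! j) * (P ^\<^sub>m 0) $$ (j, l)) = (\<Sum>j<L. if j = l then n (es ! j) else 0)"
      using P 0 by (intro sum.cong) auto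
    then show ?case using 0 by simp
  next
    case (Suc k)
    have "n (es ! l) \<le> (c / q) * (\<Sum>j<L. n (es ! j) * P $$ (j, l))" by (rule step[OF Suc.prems])
    also have "\<dots> \<le> (c / q) * (\<Sum>j<L. ((c / q) ^ k * (\<Sum>i<L. n (es ! i) * (P ^\<^sub>m k) $$ (i, j))) * P $$ (j, l))"
      using c \<open>q > 0\<close> Suc.prems
      by (intro mult_left_mono sum_mono mult_right_mono Suc.IH) (auto simp: P_def)
    also have "\<dots> = (c / q) ^ Suc k * (\<Sum>j<L. \<Sum>i<L. n (es ! i) * ((P ^\<^sub>m k) $$ (i, j) * P $$ (j, l)))"
      by (simp add: sum_distrib_left sum_distrib_right mult_ac)
    also have "(\<Sum>j<L. \<Sum>i<L. n (es ! i) * ((P ^\<^sub>m k) $$ (i, j) * P $$ (j, l))) =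
        (\<Sum>i<L. n (es ! i) * (\<Sum>j<L. (P ^\<^sub>m k) $$ (i, j) * P $$ (j, l)))"
      by (subst sum.swap) (simp add: sum_distrib_left)
    also have "\<dots> = (\<Sum>i<L. n (es ! i) * (P ^\<^sub>m Suc k) $$ (i, l))"
      using P Suc.prems by (intro sum.cong) (auto simp: scalar_prod_def lessThan_atLeast0)
    finally show ?case .
  qed
  obtain l where l: "l < L" "e = es ! l" using e es(2) by (metis L_def in_set_conv_nth)
  have nn: "0 \<le> n (es ! j)" if "j < L" for j by (rule n0[OF nth[OF that]])
  have bound: "n e \<le> (c / q) ^ k * (\<Sum>j<L. n (es ! j) * K)" for k
    unfolding l(2) using c \<open>q > 0\<close> nn PK l(1)
    by (intro order_trans[OF iter[OF l(1), of k]] mult_left_mono sum_mono) auto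
  have "(\<lambda>k. (c / q) ^ k * (\<Sum>j<L. n (es ! j) * K)) \<longlonglongrightarrow> 0"
    using c q \<open>q > 0\<close> by (intro tendsto_mult_left_zero LIMSEQ_realpow_zero) auto
  then have "n e \<le> 0" by (rule LIMSEQ_le_const) (use bound in auto)
  then show ?thesis using n0[OF e] by simp
qed

text \<open>The message inequality is translated into subinvariance. For a receiver
  (\<open>\<alpha>\<close>, \<open>i\<close>), the pairs of some \<open>j\<close> in
  \<open>\<alpha>\<close> other than \<open>i\<close> and some \<open>\<beta>\<close> through
  \<open>j\<close> other than \<open>\<alpha>\<close> are exactly the directed edges that precede it
  under \<open>edge_succ\<close>.\<close>

lemma messages_zero:
  fixes F :: "'v set set" and n :: "'v set \<Rightarrow> 'v \<Rightarrow> real"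
  assumes hyp: "hypergraph V F"
    and n0: "\<And>\<alpha> i. \<alpha> \<in> F \<Longrightarrow> i \<in> \<alpha> \<Longrightarrow> 0 \<le> n \<alpha> i"
    and c: "0 \<le> c" "c * rho F < 1"
    and le: "\<And>\<alpha> i. \<alpha> \<in> F \<Longrightarrow> i \<in> \<alpha> \<Longrightarrow>
      n \<alpha> i \<le> c * (\<Sum>j\<in>\<alpha> - {i}. \<Sum>\<beta>\<in>{\<beta>\<in>F. j \<in> \<beta>} - {\<alpha>}. n \<beta> j)"
    and e: "\<alpha> \<in> F" "i \<in> \<alpha>"
  shows "n \<alpha> i = 0"
proof -
  have fin: "finite F" "\<And>\<alpha>. \<alpha> \<in> F \<Longrightarrow> finite \<alpha>"
    using hyp unfolding hypergraph_def by (auto intro: finite_subset[of _ "Pow V"] finite_subset[of _ V])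
  have "directed_edges F = Sigma F (\<lambda>\<alpha>. \<alpha>)" by (auto simp: directed_edges_def)
  then have finD: "finite (directed_edges F)" using fin by auto
  have "(\<lambda>(\<alpha>, i). n \<alpha> i) (\<alpha>, i) = 0"
  proof (rule nonneg_subinvariant_zero[OF finD _ c])
    fix e' assume "e' \<in> directed_edges F"
    then obtain \<alpha> i where e': "e' = (\<alpha>, i)" "\<alpha> \<in> F" "i \<in> \<alpha>" by (auto simp: directed_edges_def)
    have "(\<Sum>j\<in>\<alpha> - {i}. \<Sum>\<beta>\<in>{\<beta>\<in>F. j \<in> \<beta>} - {\<alpha>}. n \<beta> j) =
        (\<Sum>(j, \<beta>)\<in>Sigma (\<alpha> - {i}) (\<lambda>j. {\<beta>\<in>F. j \<in> \<beta>} - {\<alpha>}). n \<beta> j)"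
      using fin e'(2) by (intro sum.Sigma) auto
    also have "\<dots> = (\<Sum>(\<beta>, j)\<in>{e \<in> directed_edges F. edge_succ e e'}. n \<beta> j)"
      by (intro sum.reindex_bij_witness[of _ prod.swap prod.swap])
        (auto simp: e' directed_edges_def edge_succ_def)
    finally show "(\<lambda>(\<alpha>, i). n \<alpha> i) e' \<le> c * (\<Sum>e\<in>{e \<in> directed_edges F. edge_succ e e'}. (\<lambda>(\<alpha>, i). n \<alpha> i) e)"
      using le[OF e'(2,3)] by (simp add: e'(1))
  qed (use n0 e in \<open>auto simp: directed_edges_def\<close>)
  then show ?thesis by simp
qed

section \<open>Inverse square roots\<close>

lemma scalar_prod_mult_mat_vec_sum:
  fixes A :: "real mat"
  assumes "A \<in> carrier_mat n n" "u \<in> carrier_vec n" "v \<in> carrier_vec n"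
  shows "scalar_prod u (A *\<^sub>v v) = (\<Sum>i<n. \<Sum>j<n. vec_index u i * A $$ (i, j) * vec_index v j)"
  using assms by (simp add: scalar_prod_def sum_distrib_left mult.assoc lessThan_atLeast0)

lemma symmetric_scalar_prod_mult_mat_vec:
  fixes A :: "real mat"
  assumes A: "A \<in> carrier_mat n n" "transpose_mat A = A" and u: "u \<in> carrier_vec n" "v \<in> carrier_vec n"
  shows "scalar_prod u (A *\<^sub>v v) = scalar_prod (A *\<^sub>v u) v"
proof -
  have "A $$ (i, j) = A $$ (j, i)" if "i < n" "j < n" for i j
    using A that by (metis carrier_matD index_transpose_mat(1))
  then have "(\<Sum>i<n. \<Sum>j<n. vec_index u i * A $$ (i, j) * vec_index v j) =
      (\<Sum>i<n. \<Sum>j<n. vec_index v j * A $$ (j, i) * vec_index u i)"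
    by (intro sum.cong) (auto simp: mult_ac)
  also have "\<dots> = scalar_prod v (A *\<^sub>v u)"
    by (subst sum.swap) (rule scalar_prod_mult_mat_vec_sum[OF A(1) u(2,1), symmetric])
  also have "\<dots> = scalar_prod (A *\<^sub>v u) v"
    using A(1) u by (intro comm_scalar_prod[of _ n]) auto
  finally show ?thesis
    unfolding scalar_prod_mult_mat_vec_sum[OF A(1) u] .
qed

text \<open>The Taylor coefficients of (1 - x)^(-1/2), that is binomial(2k, k) / 4^k. In the rising
  factorial form their sign and the bound by 1 are immediate.\<close>

definition half_coeff :: "nat \<Rightarrow> real" where
  "half_coeff k = pochhammer (1/2) k / fact k"

lemma half_coeff_nonneg: "0 \<le> half_coeff k"
  by (simp add: half_coeff_def pochhammer_nonneg)

lemma half_coeff_le_1: "half_coeff k \<le> 1"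
proof -
  have "pochhammer (1/2) k \<le> (fact k :: real)"
  proof (induction k)
    case (Suc k)
    have "pochhammer (1/2) (Suc k) = (1/2 + real k) * pochhammer (1/2) k"
      by (rule pochhammer_rec')
    also have "\<dots> \<le> (1 + real k) * fact k"
      using Suc by (intro mult_mono) (auto simp: pochhammer_nonneg)
    finally show ?case by simp
  qed simp
  then show ?thesis by (simp add: half_coeff_def)
qed

text \<open>The square of (1 - x)^(-1/2) is 1 / (1 - x), all of whose coefficients are 1. Up to
  signs this is the Vandermonde identity for the upper arguments -1/2 and -1/2, which add up to
  -1.\<close>

lemma half_coeff_convolution: "(\<Sum>k\<le>n. half_coeff k * half_coeff (n - k)) = 1"
proof -
  have h: "half_coeff k = (-1) ^ k * ((-1/2) gchoose k)" for k
    by (simp add: half_coeff_def gbinomial_pochhammer flip: power_mult_distrib)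
  have "(\<Sum>k\<le>n. half_coeff k * half_coeff (n - k)) =
      (-1) ^ n * (\<Sum>k\<in>{0..n}. ((-1/2 :: real) gchoose k) * ((-1/2) gchoose (n - k)))"
    unfolding h sum_distrib_left atLeast0AtMost
  proof (intro sum.cong refl)
    fix k assume "k \<in> {..n}"
    then have "(-1 :: real) ^ n = (-1) ^ k * (-1) ^ (n - k)" by (simp flip: power_add)
    then show "(-1) ^ k * ((-1/2 :: real) gchoose k) * ((-1) ^ (n - k) * ((-1/2) gchoose (n - k))) =
        (-1) ^ n * (((-1/2) gchoose k) * ((-1/2) gchoose (n - k)))" by simp
  qed
  also have "\<dots> = (-1) ^ n * ((-1 :: real) gchoose n)"
    unfolding gbinomial_Vandermonde by simp
  also have "\<dots> = 1"
    by (simp add: gbinomial_pochhammer pochhammer_fact[symmetric])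
  finally show ?thesis .
qed

text \<open>The square root is the binomial series of \<open>(1 - X)\<^sup>-\<^sup>1\<^sup>/\<^sup>2\<close>, whose coefficients are nonnegative.\<close>

lemma inverse_sqrt_one_minus:
  fixes X :: "real mat"
  assumes X: "X \<in> carrier_mat n n" "transpose_mat X = X"
    and psd: "\<And>v. v \<in> carrier_vec n \<Longrightarrow> 0 \<le> scalar_prod v (X *\<^sub>v v)"
    and r: "0 \<le> r" "r < 1"
    and contr: "\<And>v. v \<in> carrier_vec n \<Longrightarrow> scalar_prod (X *\<^sub>v v) (X *\<^sub>v v) \<le> r * scalar_prod v v"
  obtains B where "pos_def_mat n B" "(1\<^sub>m n - X) * (B * B) = 1\<^sub>m n"
proof -
  define f where "f = (\<lambda>v. X *\<^sub>v v)"
  \<comment> \<open>The (i, j) entry of the k-th power of \<open>X\<close>, so that the matrix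
    series reduces to real series, one for each entry.\<close>
  define E where "E k i j = scalar_prod (unit_vec n i) ((f ^^ k) (unit_vec n j))" for k i j
  define s where "s = sqrt r"
  have s: "0 \<le> s" "s < 1" using r by (auto simp: s_def)
  have fc: "(f ^^ k) v \<in> carrier_vec n" if "v \<in> carrier_vec n" for k v
    using that X(1) by (induction k) (auto simp: f_def)
  have adj: "scalar_prod u ((f ^^ k) v) = scalar_prod ((f ^^ k) u) v"
    if "u \<in> carrier_vec n" "v \<in> carrier_vec n" for k u v
    using that
  proof (induction k arbitrary: u)
    case (Suc k)
    have "scalar_prod u ((f ^^ Suc k) v) = scalar_prod (f u) ((f ^^ k) v)"
      using symmetric_scalar_prod_mult_mat_vec[OF X Suc.prems(1) fc[OF Suc.prems(2), of k]] by (simp add: f_def)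
    also have "\<dots> = scalar_prod ((f ^^ k) (f u)) v"
      using Suc.IH[of "f u"] Suc.prems fc[OF Suc.prems(1), of 1] by simp
    finally show ?case by (simp add: funpow_swap1)
  qed simp
  have E_idx: "E k i j = vec_index ((f ^^ k) (unit_vec n j)) i" if "i < n" for k i j
    unfolding E_def using fc[of "unit_vec n j" k] that by simp
  have E_sym: "E k i j = E k j i" if "i < n" "j < n" for k i j
    unfolding E_def using that fc[of _ k]
    by (subst adj) (auto intro!: comm_scalar_prod[of _ n])
  have E_mult: "(\<Sum>l<n. E k i l * E m l j) = E (k + m) i j" if "i < n" "j < n" for k m i j
  proof -
    have "(\<Sum>l<n. E k i l * E m l j) = (\<Sum>l<n. vec_index ((f ^^ k) (unit_vec n i)) l * vec_index ((f ^^ m) (unit_vec n j)) l)"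
      using that E_sym[OF that(1)] by (intro sum.cong) (auto simp: E_idx)
    also have "\<dots> = scalar_prod ((f ^^ k) (unit_vec n i)) ((f ^^ m) (unit_vec n j))"
      using fc[of "unit_vec n j" m] by (simp add: scalar_prod_def lessThan_atLeast0)
    also have "\<dots> = scalar_prod (unit_vec n i) ((f ^^ k) ((f ^^ m) (unit_vec n j)))"
      using fc[of "unit_vec n j" m] by (intro adj[symmetric]) auto
    finally show ?thesis by (simp add: E_def funpow_add)
  qed
  have E_0: "E 0 i j = (if i = j then 1 else 0)" if "i < n" "j < n" for i j
    using that by (simp add: E_idx)
  have E_1: "E 1 i j = X $$ (i, j)" if "i < n" "j < n" for i j
    using that X(1) by (simp add: E_idx f_def)
  have norm_f: "scalar_prod ((f ^^ k) v) ((f ^^ k) v) \<le> r ^ k * scalar_prod v v" if "v \<in> carrier_vec n" for k v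
  proof (induction k)
    case (Suc k)
    have "scalar_prod ((f ^^ Suc k) v) ((f ^^ Suc k) v) \<le> r * scalar_prod ((f ^^ k) v) ((f ^^ k) v)"
      using contr[OF fc[OF that, of k]] by (simp add: f_def)
    also have "\<dots> \<le> r * (r ^ k * scalar_prod v v)" by (rule mult_left_mono[OF Suc r(1)])
    finally show ?case by (simp add: mult_ac)
  qed simp
  \<comment> \<open>The contraction hypothesis concerns squared lengths, so entries decay at the
    rate \<open>sqrt r\<close>; with coefficients at most 1 the binomial series then converges
    absolutely.\<close>
  have E_le: "\<bar>E k i j\<bar> \<le> s ^ k" if "i < n" "j < n" for k i j
  proof -
    have "\<bar>E k i j\<bar> \<le> sqrt (scalar_prod ((f ^^ k) (unit_vec n j)) ((f ^^ k) (unit_vec n j)))"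
      unfolding E_idx[OF that(1)] using fc[of "unit_vec n j" k] that by (intro abs_index_le_sqrt_scalar_prod) auto
    also have "\<dots> \<le> sqrt (r ^ k)"
      using norm_f[of "unit_vec n j" k] that by simp
    finally show ?thesis by (simp add: s_def real_sqrt_power)
  qed
  have geo: "summable (\<lambda>k. s ^ k)" using s by (intro summable_geometric) auto
  have sumc: "summable (\<lambda>k. norm (half_coeff k * E k i j))" if "i < n" "j < n" for i j
  proof (intro summable_comparison_test'[OF geo, of 0])
    fix k
    have "half_coeff k * \<bar>E k i j\<bar> \<le> 1 * s ^ k"
      using half_coeff_le_1 E_le[OF that] half_coeff_nonneg by (intro mult_mono) auto
    then show "norm (norm (half_coeff k * E k i j)) \<le> s ^ k"
      by (simp add: abs_mult half_coeff_nonneg)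
  qed
  define B where "B = mat n n (\<lambda>(i, j). \<Sum>k. half_coeff k * E k i j)"
  have B: "B \<in> carrier_mat n n" by (simp add: B_def)
  \<comment> \<open>Cauchy product and convolution identity together: the square of \<open>B\<close>
    is the Neumann series of 1 - X.\<close>
  have BB: "(\<lambda>m. E m i j) sums (B * B) $$ (i, j)" if "i < n" "j < n" for i j
  proof -
    have "(\<lambda>m. \<Sum>k\<le>m. (half_coeff k * E k i l) * (half_coeff (m - k) * E (m - k) l j)) sums
        (B $$ (i, l) * B $$ (l, j))" if "l < n" for l
      using Cauchy_product_sums[OF sumc sumc, of i l l j] that \<open>i < n\<close> \<open>j < n\<close> by (simp add: B_def)
    then have "(\<lambda>m. \<Sum>l<n. \<Sum>k\<le>m. (half_coeff k * E k i l) * (half_coeff (m - k) * E (m - k) l j)) sums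
        (\<Sum>l<n. B $$ (i, l) * B $$ (l, j))"
      by (intro sums_sum) auto
    moreover have "(\<Sum>l<n. \<Sum>k\<le>m. (half_coeff k * E k i l) * (half_coeff (m - k) * E (m - k) l j)) = E m i j" for m
    proof -
      have "(\<Sum>l<n. \<Sum>k\<le>m. (half_coeff k * E k i l) * (half_coeff (m - k) * E (m - k) l j)) =
          (\<Sum>k\<le>m. half_coeff k * half_coeff (m - k) * (\<Sum>l<n. E k i l * E (m - k) l j))"
        by (subst sum.swap) (simp add: sum_distrib_left mult_ac)
      also have "\<dots> = (\<Sum>k\<le>m. half_coeff k * half_coeff (m - k) * E m i j)"
        using that by (intro sum.cong refl) (simp add: E_mult)
      also have "\<dots> = E m i j"
        by (simp add: half_coeff_convolution flip: sum_distrib_right)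
      finally show ?thesis .
    qed
    ultimately show ?thesis using B that by (simp add: scalar_prod_def lessThan_atLeast0)
  qed
  have "(1\<^sub>m n - X) * (B * B) = 1\<^sub>m n"
  proof (rule eq_matI)
    fix i j assume ij: "i < dim_row (1\<^sub>m n :: real mat)" "j < dim_col (1\<^sub>m n :: real mat)"
    then have ij: "i < n" "j < n" by auto
    have "(\<lambda>m. \<Sum>l<n. X $$ (i, l) * E m l j) sums (\<Sum>l<n. X $$ (i, l) * (B * B) $$ (l, j))"
      using BB ij by (intro sums_sum sums_mult) auto
    \<comment> \<open>Multiplication by \<open>X\<close> shifts the Neumann series by one index, so
      the difference with the series itself is its term of index 0, the identity matrix.\<close>
    moreover have "(\<Sum>l<n. X $$ (i, l) * E m l j) = E (Suc m) i j" for m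
      using E_mult[OF ij, of 1 m] ij by (simp add: E_1[unfolded One_nat_def])
    ultimately have "(\<lambda>m. E (Suc m) i j) sums (\<Sum>l<n. X $$ (i, l) * (B * B) $$ (l, j))" by simp
    then have "(\<lambda>m. E m i j) sums ((\<Sum>l<n. X $$ (i, l) * (B * B) $$ (l, j)) + E 0 i j)"
      by (rule sums_Suc)
    then have "(B * B) $$ (i, j) = (\<Sum>l<n. X $$ (i, l) * (B * B) $$ (l, j)) + E 0 i j"
      using BB[OF ij] sums_unique2 by blast
    moreover have "((1\<^sub>m n - X) * (B * B)) $$ (i, j) =
        (\<Sum>l<n. (1\<^sub>m n - X) $$ (i, l) * (B * B) $$ (l, j))"
      using X B ij by (simp add: scalar_prod_def lessThan_atLeast0)
    moreover have "\<dots> = (\<Sum>l<n. (if i = l then (B * B) $$ (l, j) else 0) - X $$ (i, l) * (B * B) $$ (l, j))"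
      using X ij by (intro sum.cong) (auto simp: algebra_simps simp del: index_mult_mat)
    ultimately show "((1\<^sub>m n - X) * (B * B)) $$ (i, j) = 1\<^sub>m n $$ (i, j)"
      using ij by (simp add: sum_subtractf E_0 del: index_mult_mat)
  qed (use X B in auto)
  moreover have "pos_def_mat n B"
    unfolding pos_def_mat_def
  proof (intro conjI ballI impI)
    show "B \<in> carrier_mat n n" by (rule B)
    show "transpose_mat B = B"
      by (rule eq_matI) (auto simp: B_def E_sym intro!: arg_cong[where f = suminf])
    fix v :: "real vec" assume v: "v \<in> carrier_vec n" "v \<noteq> 0\<^sub>v n"
    have quad: "scalar_prod v ((f ^^ k) v) = (\<Sum>i<n. \<Sum>j<n. vec_index v i * E k i j * vec_index v j)" for k
    proof -
      have "vec_index ((f ^^ k) v) i = (\<Sum>j<n. E k i j * vec_index v j)" if "i < n" for i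
      proof -
        have "vec_index ((f ^^ k) v) i = scalar_prod (unit_vec n i) ((f ^^ k) v)"
          using fc[OF v(1), of k] that by simp
        also have "\<dots> = scalar_prod ((f ^^ k) (unit_vec n i)) v" using v(1) by (intro adj) auto
        also have "\<dots> = (\<Sum>j<n. E k i j * vec_index v j)"
          unfolding scalar_prod_def using v(1) that E_sym[OF that] by (intro sum.cong) (auto simp flip: E_idx)
        finally show ?thesis .
      qed
      then show ?thesis
        using fc[OF v(1), of k] by (simp add: scalar_prod_def lessThan_atLeast0 sum_distrib_left mult.assoc)
    qed
    have "(\<lambda>k. half_coeff k * E k i j) sums (B $$ (i, j))" if "i < n" "j < n" for i j
      using summable_norm_cancel[OF sumc[OF that]] that by (simp add: B_def summable_sums)
    then have "(\<lambda>k. \<Sum>i<n. \<Sum>j<n. vec_index v i * (half_coeff k * E k i j) * vec_index v j) sums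
        (\<Sum>i<n. \<Sum>j<n. vec_index v i * B $$ (i, j) * vec_index v j)"
      by (intro sums_sum sums_mult sums_mult2) auto
    then have sm: "(\<lambda>k. half_coeff k * scalar_prod v ((f ^^ k) v)) sums scalar_prod v (B *\<^sub>v v)"
      unfolding quad scalar_prod_mult_mat_vec_sum[OF B v(1) v(1)]
      by (simp add: sum_distrib_left mult_ac)
    \<comment> \<open>An even power gives a squared length; an odd power gives the form of
      \<open>X\<close> at an iterate of \<open>v\<close>, nonnegative by \<open>psd\<close>.\<close>
    have nn: "0 \<le> scalar_prod v ((f ^^ k) v)" for k
    proof -
      have split: "scalar_prod v ((f ^^ (m + l)) v) = scalar_prod ((f ^^ m) v) ((f ^^ l) v)" for m l
        using adj[OF v(1) fc[OF v(1), of l], of m] by (simp add: funpow_add)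
      show ?thesis
      proof (cases "even k")
        case True
        then obtain m where "k = m + m" by (metis evenE mult_2)
        then show ?thesis using split[of m m] scalar_prod_self_nonneg by simp
      next
        case False
        then obtain m where "k = m + Suc m" by (metis oddE mult_2 add_Suc_right Suc_eq_plus1)
        then show ?thesis using split[of m "Suc m"] psd[OF fc[OF v(1), of m]] by (simp add: f_def)
      qed
    qed
    \<comment> \<open>All terms being nonnegative, the one of index 0, which is the squared length
      of \<open>v\<close>, already bounds the form from below.\<close>
    have "half_coeff 0 * scalar_prod v ((f ^^ 0) v) \<le> scalar_prod v (B *\<^sub>v v)"
      using sum_le_suminf[OF sums_summable[OF sm], of "{0}"] nn half_coeff_nonneg
      by (simp add: sums_unique[OF sm, symmetric])
    then show "0 < scalar_prod v (B *\<^sub>v v)"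
      using scalar_prod_self_pos[OF v] by (simp add: half_coeff_def)
  qed
  ultimately show ?thesis using that by blast
qed

text \<open>A lower bound for the spectrum without diagonalization: compactness of the sphere and
  homogeneity of degree two.\<close>

lemma pos_def_lower_bound:
  assumes "pos_def_mat n A"
  obtains \<delta> where "\<delta> > 0" "\<And>v. v \<in> carrier_vec n \<Longrightarrow> \<delta> * scalar_prod v v \<le> scalar_prod v (A *\<^sub>v v)"
proof -
  have A: "A \<in> carrier_mat n n" and pos: "\<And>v. v \<in> carrier_vec n \<Longrightarrow> v \<noteq> 0\<^sub>v n \<Longrightarrow> 0 < scalar_prod v (A *\<^sub>v v)"
    using assms by (auto simp: pos_def_mat_def)
  have "continuous_on UNIV (\<lambda>h::nat \<Rightarrow> real. \<Sum>i<n. \<Sum>j<n. h i * A $$ (i, j) * h j)"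
    by (intro continuous_intros continuous_on_product_coordinates)
  moreover have "scalar_prod (Matrix.vec n h) (A *\<^sub>v Matrix.vec n h) =
      (\<Sum>i<n. \<Sum>j<n. h i * A $$ (i, j) * h j)" for h
    unfolding scalar_prod_mult_mat_vec_sum[OF A vec_carrier vec_carrier] by simp
  ultimately have "continuous_on UNIV (\<lambda>h. scalar_prod (Matrix.vec n h) (A *\<^sub>v Matrix.vec n h))"
    by simp
  then obtain \<delta> where d: "\<delta> > 0"
    "\<And>v. v \<in> carrier_vec n \<Longrightarrow> scalar_prod v v = 1 \<Longrightarrow> \<delta> \<le> scalar_prod v (A *\<^sub>v v)"
    using vec_sphere_lower_bound[where g = "\<lambda>v. scalar_prod v (A *\<^sub>v v)" and n = n] pos by blast
  show ?thesis
  proof (rule that[OF d(1)])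
    fix v :: "real vec" assume v: "v \<in> carrier_vec n"
    show "\<delta> * scalar_prod v v \<le> scalar_prod v (A *\<^sub>v v)"
    proof (cases "v = 0\<^sub>v n")
      case True
      then show ?thesis using A by (simp add: scalar_prod_mult_mat_vec_sum)
    next
      case False
      define s where "s = sqrt (scalar_prod v v)"
      have s: "s > 0" "scalar_prod v v = s * s"
        using scalar_prod_self_pos[OF v False] by (auto simp: s_def)
      have "\<delta> \<le> scalar_prod ((1 / s) \<cdot>\<^sub>v v) (A *\<^sub>v ((1 / s) \<cdot>\<^sub>v v))"
        using d(2) normalize_vec[OF v False] v by (simp add: s_def)
      also have "\<dots> = scalar_prod v (A *\<^sub>v v) / (s * s)"
        unfolding scalar_prod_mult_mat_vec_sum[OF A smult_carrier_vec[THEN iffD2, OF v] smult_carrier_vec[THEN iffD2, OF v]]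
          scalar_prod_mult_mat_vec_sum[OF A v v] sum_divide_distrib
        using v by (intro sum.cong) auto
      finally show ?thesis using s by (simp add: field_simps)
    qed
  qed
qed

text \<open>For a large scalar c the matrix X = 1 - A / c is positive semidefinite and strictly
  contracting, so the binomial series provides an inverse square root of A / c, and division by sqrt
  c provides one of A.\<close>

lemma inv_sqrt_exists:
  assumes "pos_def_mat n A"
  obtains B where "pos_def_mat n B" "inverts_mat A (B * B)"
proof -
  have A: "A \<in> carrier_mat n n" "transpose_mat A = A" using assms by (auto simp: pos_def_mat_def)
  obtain \<delta> where d: "\<delta> > 0" "\<And>v. v \<in> carrier_vec n \<Longrightarrow> \<delta> * scalar_prod v v \<le> scalar_prod v (A *\<^sub>v v)"
    using pos_def_lower_bound[OF assms] by blast
  obtain K where K: "K \<ge> 0"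
    "\<And>v. v \<in> carrier_vec n \<Longrightarrow> scalar_prod (A *\<^sub>v v) (A *\<^sub>v v) \<le> K * scalar_prod v v"
    using mult_mat_vec_bound[OF A(1)] by blast
  \<comment> \<open>\<open>K + 1 \<le> c\<close> makes \<open>X\<close> positive semidefinite, and
    \<open>K \<le> \<delta> * c\<close> absorbs the quadratic term of the squared length of
    \<open>X v\<close>, leaving the factor 1 - \<open>\<delta>\<close> / c.\<close>
  define c where "c = K + K / \<delta> + 1"
  have c: "c > 0" "K + 1 \<le> c" "K \<le> \<delta> * c"
    using K(1) d(1) divide_nonneg_pos[OF K(1) d(1)] by (auto simp: c_def distrib_left intro: add_nonneg_pos)
  define X where "X = 1\<^sub>m n - (1 / c) \<cdot>\<^sub>m A"
  have X: "X \<in> carrier_mat n n" using A(1) by (auto simp: X_def intro!: minus_carrier_mat)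
  have "A $$ (i, j) = A $$ (j, i)" if "i < n" "j < n" for i j
    using A that by (metis carrier_matD index_transpose_mat(1))
  then have Xt: "transpose_mat X = X"
    using A(1) by (intro eq_matI) (auto simp: X_def)
  have Xv: "X *\<^sub>v v = v - (1 / c) \<cdot>\<^sub>v (A *\<^sub>v v)" if "v \<in> carrier_vec n" for v
    using A(1) that by (simp add: X_def minus_mult_distrib_mat_vec[of _ n n] smult_mat_mult_vec)
  \<comment> \<open>In dimension 0 the number \<open>\<delta>\<close> is arbitrary, so 1 -
    \<open>\<delta>\<close> / c may be negative.\<close>
  define r where "r = max 0 (1 - \<delta> / c)"
  obtain B where B: "pos_def_mat n B" "(1\<^sub>m n - X) * (B * B) = 1\<^sub>m n"
  proof (rule inverse_sqrt_one_minus[OF X Xt])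
    show "0 \<le> r" "r < 1" using c d by (auto simp: r_def)
    fix v :: "real vec" assume v: "v \<in> carrier_vec n"
    have Av: "A *\<^sub>v v \<in> carrier_vec n" using A(1) v by simp
    have comm: "scalar_prod (A *\<^sub>v v) v = scalar_prod v (A *\<^sub>v v)"
      by (rule comm_scalar_prod[OF Av v])
    have "scalar_prod v (X *\<^sub>v v) = scalar_prod v v - scalar_prod v (A *\<^sub>v v) / c"
      unfolding Xv[OF v] using v Av
      by (simp add: scalar_prod_minus_distrib[of _ n])
    also have "\<dots> \<ge> 0"
    proof -
      \<comment> \<open>Expanding the square bounds the mixed term by the mean of the two squared
        lengths, in place of the Cauchy-Schwarz inequality.\<close>
      have "0 \<le> scalar_prod (v - A *\<^sub>v v) (v - A *\<^sub>v v)" by (rule scalar_prod_self_nonneg)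
      also have "\<dots> = scalar_prod v v - 2 * scalar_prod v (A *\<^sub>v v) + scalar_prod (A *\<^sub>v v) (A *\<^sub>v v)"
        using v Av by (simp add: scalar_prod_minus_distrib[of _ n] minus_scalar_prod_distrib[of _ n] comm)
      finally have "2 * scalar_prod v (A *\<^sub>v v) \<le> (K + 1) * scalar_prod v v"
        using K(2)[OF v] by (simp add: distrib_right)
      then have "scalar_prod v (A *\<^sub>v v) \<le> c * scalar_prod v v"
        using mult_right_mono[OF c(2) scalar_prod_self_nonneg[of v]]
          mult_nonneg_nonneg[of "K + 1", OF _ scalar_prod_self_nonneg[of v]] K(1) by linarith
      then show ?thesis using c(1) by (simp add: field_simps)
    qed
    finally show "0 \<le> scalar_prod v (X *\<^sub>v v)" .
    have "scalar_prod (X *\<^sub>v v) (X *\<^sub>v v) =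
        scalar_prod v v - 2 * scalar_prod v (A *\<^sub>v v) / c + scalar_prod (A *\<^sub>v v) (A *\<^sub>v v) / (c * c)"
      unfolding Xv[OF v] using v Av c(1)
      by (simp add: scalar_prod_minus_distrib[of _ n] minus_scalar_prod_distrib[of _ n] comm field_simps)
    also have "\<dots> \<le> scalar_prod v v - 2 * (\<delta> * scalar_prod v v) / c + (\<delta> * c * scalar_prod v v) / (c * c)"
    proof -
      have "K * scalar_prod v v \<le> \<delta> * c * scalar_prod v v"
        by (rule mult_right_mono[OF c(3) scalar_prod_self_nonneg])
      then have "scalar_prod (A *\<^sub>v v) (A *\<^sub>v v) \<le> \<delta> * c * scalar_prod v v"
        using K(2)[OF v] by linarith
      then show ?thesis using d(2)[OF v] c(1)
        by (intro add_mono diff_mono divide_right_mono) auto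
    qed
    also have "\<dots> = (1 - \<delta> / c) * scalar_prod v v" using c(1) by (simp add: field_simps)
    also have "\<dots> \<le> r * scalar_prod v v" by (intro mult_right_mono scalar_prod_self_nonneg) (simp add: r_def)
    finally show "scalar_prod (X *\<^sub>v v) (X *\<^sub>v v) \<le> r * scalar_prod v v" .
  qed
  have Bc: "B \<in> carrier_mat n n" using B by (simp add: pos_def_mat_def)
  define B' where "B' = (1 / sqrt c) \<cdot>\<^sub>m B"
  have "B' * B' = (1 / c) \<cdot>\<^sub>m (B * B)"
    using Bc c(1) by (intro eq_matI) (auto simp: B'_def scalar_prod_def sum_divide_distrib)
  moreover have "1\<^sub>m n - X = (1 / c) \<cdot>\<^sub>m A"
    using A(1) by (intro eq_matI) (auto simp: X_def)
  ultimately have "A * (B' * B') = 1\<^sub>m n"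
    using B(2) mult_smult_distrib[OF A(1) mult_carrier_mat[OF Bc Bc], of "1 / c"]
      mult_smult_assoc_mat[OF A(1) mult_carrier_mat[OF Bc Bc], of "1 / c"] by simp
  then have "inverts_mat A (B' * B')" using A(1) by (simp add: inverts_mat_def)
  moreover have "pos_def_mat n B'"
  proof -
    have "transpose_mat B = B" using B by (simp add: pos_def_mat_def)
    then have "B $$ (i, j) = B $$ (j, i)" if "i < n" "j < n" for i j
      using Bc that by (metis carrier_matD index_transpose_mat(1))
    then have "transpose_mat B' = B'"
      using Bc by (intro eq_matI) (auto simp: B'_def)
    moreover have "scalar_prod v (B' *\<^sub>v v) = scalar_prod v (B *\<^sub>v v) / sqrt c" if "v \<in> carrier_vec n" for v
      unfolding B'_def using Bc that by (simp add: smult_mat_mult_vec)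
    ultimately show ?thesis using B(1) Bc c(1) by (simp add: pos_def_mat_def B'_def)
  qed
  ultimately show ?thesis using that by blast
qed

text \<open>With D = B - C the equation reads B D + D C = 0. Multiplying by D and taking the trace
  gives a sum of values of the forms of B and C at the columns of D, all nonnegative; since it is
  zero, every column vanishes.\<close>

lemma pos_def_sqrt_unique:
  assumes B: "pos_def_mat n B" and C: "pos_def_mat n C" and eq: "B * B = C * C"
  shows "B = C"
proof -
  have Bc: "B \<in> carrier_mat n n" "transpose_mat B = B" and Cc: "C \<in> carrier_mat n n" "transpose_mat C = C"
    using B C by (auto simp: pos_def_mat_def)
  define b where "b i j = B $$ (i, j)" for i j
  define c where "c i j = C $$ (i, j)" for i j
  define d where "d i j = b i j - c i j" for i j
  have sym: "b i j = b j i" "c i j = c j i" if "i < n" "j < n" for i j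
    using that Bc Cc by (metis b_def c_def carrier_matD index_transpose_mat(1))+
  have "(\<Sum>k<n. b i k * b k j) = (\<Sum>k<n. c i k * c k j)" if "i < n" "j < n" for i j
  proof -
    have "(B * B) $$ (i, j) = (C * C) $$ (i, j)" using eq by simp
    then show ?thesis using Bc Cc that by (simp add: scalar_prod_def b_def c_def lessThan_atLeast0)
  qed
  then have zero: "(\<Sum>k<n. b i k * d k j + d i k * c k j) = 0" if "i < n" "j < n" for i j
    using that by (simp add: d_def left_diff_distrib right_diff_distrib sum.distrib sum_subtractf)
  let ?v = "\<lambda>i. Matrix.vec n (\<lambda>j. d i j)"
  have dsym: "d i j = d j i" if "i < n" "j < n" for i j using sym that by (simp add: d_def)
  \<comment> \<open>The trace of D (B D + D C), with D symmetric.\<close>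
  have "0 = (\<Sum>j<n. \<Sum>i<n. d j i * (\<Sum>k<n. b i k * d k j + d i k * c k j))"
    using zero by simp
  also have "\<dots> = (\<Sum>j<n. \<Sum>i<n. \<Sum>k<n. d j i * b i k * d k j) + (\<Sum>j<n. \<Sum>i<n. \<Sum>k<n. d j i * d i k * c k j)"
    by (simp add: sum.distrib sum_distrib_left algebra_simps)
  also have "(\<Sum>j<n. \<Sum>i<n. \<Sum>k<n. d j i * b i k * d k j) = (\<Sum>j<n. scalar_prod (?v j) (B *\<^sub>v ?v j))"
    using dsym by (simp add: scalar_prod_mult_mat_vec_sum[OF Bc(1)] b_def)
  also have "(\<Sum>j<n. \<Sum>i<n. \<Sum>k<n. d j i * d i k * c k j) = (\<Sum>i<n. \<Sum>j<n. \<Sum>k<n. d j i * d i k * c k j)"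
    by (rule sum.swap)
  also have "\<dots> = (\<Sum>i<n. \<Sum>k<n. \<Sum>j<n. d j i * d i k * c k j)"
    by (intro sum.cong refl sum.swap)
  also have "\<dots> = (\<Sum>i<n. scalar_prod (?v i) (C *\<^sub>v ?v i))"
    by (intro sum.cong refl) (auto simp: scalar_prod_mult_mat_vec_sum[OF Cc(1)] c_def[symmetric] dsym mult_ac)
  finally have sum0: "(\<Sum>i<n. scalar_prod (?v i) (B *\<^sub>v ?v i) + scalar_prod (?v i) (C *\<^sub>v ?v i)) = 0"
    by (simp add: sum.distrib)
  have psd: "0 \<le> scalar_prod v (B *\<^sub>v v)" "0 \<le> scalar_prod v (C *\<^sub>v v)" if "v \<in> carrier_vec n" for v
    using B C that
    by (cases "v = 0\<^sub>v n"; force simp: pos_def_mat_def scalar_prod_mult_mat_vec_sum)+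
  have "?v i = 0\<^sub>v n" if "i < n" for i
  proof (rule ccontr)
    assume "?v i \<noteq> 0\<^sub>v n"
    then have "0 < scalar_prod (?v i) (B *\<^sub>v ?v i)" using B by (simp add: pos_def_mat_def)
    then have "0 < (\<Sum>i<n. scalar_prod (?v i) (B *\<^sub>v ?v i) + scalar_prod (?v i) (C *\<^sub>v ?v i))"
      using psd that by (intro sum_pos2[of _ i]) (auto intro: add_pos_nonneg)
    then show False using sum0 by simp
  qed
  then have "d i j = 0" if "i < n" "j < n" for i j
    using that by (metis index_vec index_zero_vec(1))
  then show ?thesis using Bc Cc by (intro eq_matI) (auto simp: d_def b_def c_def)
qed

text \<open>\<open>inv_sqrt_mat\<close> is a definite description, so its properties are available
  only after both existence and uniqueness. The left inverse comes from the right one because the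
  matrices are square.\<close>

lemma
  assumes "pos_def_mat n A"
  shows inv_sqrt_mat_pos_def: "pos_def_mat n (inv_sqrt_mat n A)"
    and inv_sqrt_mat_right: "A * (inv_sqrt_mat n A * inv_sqrt_mat n A) = 1\<^sub>m n"
    and inv_sqrt_mat_left: "inv_sqrt_mat n A * inv_sqrt_mat n A * A = 1\<^sub>m n"
    and inv_sqrt_mat_unique: "pos_def_mat n B \<Longrightarrow> A * (B * B) = 1\<^sub>m n \<Longrightarrow> inv_sqrt_mat n A = B"
proof -
  have A: "A \<in> carrier_mat n n" using assms by (simp add: pos_def_mat_def)
  let ?P = "\<lambda>B. pos_def_mat n B \<and> inverts_mat A (B * B)"
  have Bc: "B \<in> carrier_mat n n" if "?P B" for B using that by (simp add: pos_def_mat_def)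
  have inv: "A * (B * B) = 1\<^sub>m n" "B * B * A = 1\<^sub>m n" if "?P B" for B
  proof -
    show "A * (B * B) = 1\<^sub>m n" using that A by (simp add: inverts_mat_def)
    then show "B * B * A = 1\<^sub>m n" using A Bc[OF that] by (intro mat_mult_left_right_inverse[of A n]) auto
  qed
  have unique: "B = C" if B: "?P B" and C: "?P C" for B C
  proof (rule pos_def_sqrt_unique)
    have BB: "B * B \<in> carrier_mat n n" "C * C \<in> carrier_mat n n" using Bc[OF B] Bc[OF C] by auto
    have "B * B = B * B * (A * (C * C))" unfolding inv(1)[OF C] by (rule right_mult_one_mat[OF BB(1), symmetric])
    also have "\<dots> = B * B * A * (C * C)" using assoc_mult_mat[OF BB(1) A BB(2)] by simp
    also have "\<dots> = C * C" unfolding inv(2)[OF B] by (rule left_mult_one_mat[OF BB(2)])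
    finally show "B * B = C * C" .
  qed (use B C in auto)
  have "\<exists>!B. ?P B" using inv_sqrt_exists[OF assms] unique by metis
  then have P: "?P (inv_sqrt_mat n A)" unfolding inv_sqrt_mat_def by (rule theI')
  show "pos_def_mat n (inv_sqrt_mat n A)" using P by simp
  show "A * (inv_sqrt_mat n A * inv_sqrt_mat n A) = 1\<^sub>m n" using inv(1)[OF P] .
  show "inv_sqrt_mat n A * inv_sqrt_mat n A * A = 1\<^sub>m n" using inv(2)[OF P] .
  show "inv_sqrt_mat n A = B" if "pos_def_mat n B" "A * (B * B) = 1\<^sub>m n"
    by (rule unique[OF P]) (use that A in \<open>auto simp: inverts_mat_def\<close>)
qed

section \<open>The multinomial family\<close>

text \<open>The homogeneous versions of the constraints of \<open>mn_L\<close>. That a factor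
  component sums to zero follows from the marginal constraint at any of its nodes, as factors are
  nonempty.\<close>

definition mn_T :: "'v set \<Rightarrow> 'v set set \<Rightarrow> ('v \<Rightarrow> nat) \<Rightarrow> ('v mn_coord \<Rightarrow> real) set" where
  "mn_T V F N = {h.
     (\<forall>c. c \<notin> mn_coords V F N \<longrightarrow> h c = 0) \<and>
     (\<forall>i\<in>V. (\<Sum>k\<in>states N i. h (Node i k)) = 0) \<and>
     (\<forall>\<alpha>\<in>F. \<forall>i\<in>\<alpha>. \<forall>k\<in>states N i.
        h (Node i k) = (\<Sum>x\<in>{x\<in>configs N \<alpha>. x i = k}. h (Factor \<alpha> x)))}"

text \<open>The second derivative of t ln t is 1 / t. The potentials enter the free energy linearly
  and therefore leave no trace here.\<close>

definition mn_hess ::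
  "'v set \<Rightarrow> 'v set set \<Rightarrow> ('v \<Rightarrow> nat) \<Rightarrow> ('v mn_coord \<Rightarrow> real) \<Rightarrow>
   ('v mn_coord \<Rightarrow> real) \<Rightarrow> ('v mn_coord \<Rightarrow> real) \<Rightarrow> real" where
  "mn_hess V F N b h k =
     (\<Sum>\<alpha>\<in>F. \<Sum>x\<in>configs N \<alpha>. h (Factor \<alpha> x) * k (Factor \<alpha> x) / b (Factor \<alpha> x)) +
     (\<Sum>i\<in>V. (1 - real (degree_of F i)) *
        (\<Sum>l\<in>states N i. h (Node i l) * k (Node i l) / b (Node i l)))"

locale mn_family =
  fixes V :: "'v set" and F :: "'v set set" and N :: "'v \<Rightarrow> nat"
  assumes hyp: "hypergraph V F" and N_pos: "\<And>i. i \<in> V \<Longrightarrow> 1 \<le> N i"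
begin

abbreviation fibre :: "'v set \<Rightarrow> 'v \<Rightarrow> nat \<Rightarrow> ('v \<Rightarrow> nat) set" where
  "fibre \<alpha> i k \<equiv> {x\<in>configs N \<alpha>. x i = k}"

lemma finite_V: "finite V"
  using hyp by (simp add: hypergraph_def)

lemma factor_sub: "\<alpha> \<in> F \<Longrightarrow> \<alpha> \<subseteq> V" and factor_nonempty: "\<alpha> \<in> F \<Longrightarrow> \<alpha> \<noteq> {}"
  using hyp by (auto simp: hypergraph_def)

lemma finite_F: "finite F"
  using finite_V factor_sub by (meson Pow_iff finite_Pow_iff finite_subset subsetI)

lemma finite_factor: "\<alpha> \<in> F \<Longrightarrow> finite \<alpha>"
  using factor_sub finite_V finite_subset by blast

lemma finite_states [simp]: "finite (states N i)"
  by (simp add: states_def)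

lemma finite_configs [simp]: "\<alpha> \<in> F \<Longrightarrow> finite (configs N \<alpha>)"
  by (auto simp: configs_def finite_factor intro: finite_PiE)

lemma configs_state: "x \<in> configs N \<alpha> \<Longrightarrow> i \<in> \<alpha> \<Longrightarrow> x i \<in> states N i"
  by (auto simp: configs_def)

lemma finite_mn_coords: "finite (mn_coords V F N)"
proof -
  have "mn_coords V F N = (\<lambda>(\<alpha>, x). Factor \<alpha> x) ` (SIGMA \<alpha>:F. configs N \<alpha>) \<union>
      (\<lambda>(i, k). Node i k) ` (SIGMA i:V. states N i)"
    by (auto simp: mn_coords_def image_iff)
  then show ?thesis using finite_F finite_V by auto
qed

lemma sum_configs_fibres:
  assumes "\<alpha> \<in> F" "i \<in> \<alpha>"
  shows "(\<Sum>x\<in>configs N \<alpha>. g (x i) * f x) =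
    (\<Sum>k\<in>states N i. g k * (\<Sum>x\<in>fibre \<alpha> i k. f x) :: real)"
proof -
  have "(\<Sum>x\<in>configs N \<alpha>. g (x i) * f x) =
      (\<Sum>k\<in>states N i. \<Sum>x\<in>fibre \<alpha> i k. g (x i) * f x)"
    using assms configs_state by (intro sum.group[symmetric]) auto
  then show ?thesis by (simp add: sum_distrib_left)
qed

lemma mn_T_sum_factor:
  assumes "h \<in> mn_T V F N" "\<alpha> \<in> F"
  shows "(\<Sum>x\<in>configs N \<alpha>. h (Factor \<alpha> x)) = 0"
proof -
  obtain i where i: "i \<in> \<alpha>" using factor_nonempty[OF assms(2)] by blast
  have "(\<Sum>x\<in>configs N \<alpha>. h (Factor \<alpha> x)) = (\<Sum>k\<in>states N i. h (Node i k))"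
    using sum_configs_fibres[OF assms(2) i, of "\<lambda>_. 1" "\<lambda>x. h (Factor \<alpha> x)"] assms i
    by (simp add: mn_T_def)
  moreover have "i \<in> V" using i factor_sub[OF assms(2)] by blast
  ultimately show ?thesis using assms(1) by (simp add: mn_T_def)
qed

lemma mn_L_pos:
  assumes "b \<in> mn_L V F N"
  shows "\<alpha> \<in> F \<Longrightarrow> x \<in> configs N \<alpha> \<Longrightarrow> 0 < b (Factor \<alpha> x)"
    and "i \<in> V \<Longrightarrow> k \<in> states N i \<Longrightarrow> 0 < b (Node i k)"
  using assms by (auto simp: mn_L_def mn_coords_def)

lemma mn_L_node:
  assumes "b \<in> mn_L V F N" "\<alpha> \<in> F" "i \<in> \<alpha>" "k \<in> states N i"
  shows "(\<Sum>x\<in>fibre \<alpha> i k. b (Factor \<alpha> x)) = b (Node i k)"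
  using assms by (simp add: mn_L_def)

lemma eventually_mn_L:
  assumes b: "b \<in> mn_L V F N" and h: "h \<in> mn_T V F N"
  shows "\<forall>\<^sub>F t in nhds (0::real). (\<lambda>c. b c + t * h c) \<in> mn_L V F N"
proof -
  have "\<forall>\<^sub>F t in nhds (0::real). 0 < b c + t * h c" if "c \<in> mn_coords V F N" for c
  proof -
    have "0 < b c" using b that by (simp add: mn_L_def)
    moreover have "((\<lambda>t. b c + t * h c) \<longlongrightarrow> b c + 0 * h c) (nhds 0)"
      by (intro tendsto_intros filterlim_ident)
    ultimately show ?thesis by (intro order_tendstoD(1)) auto
  qed
  then have "\<forall>\<^sub>F t in nhds (0::real). \<forall>c\<in>mn_coords V F N. 0 < b c + t * h c"
    by (intro eventually_ball_finite finite_mn_coords) auto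
  then show ?thesis
  proof eventually_elim
    case (elim t)
    then show ?case
      using b h mn_T_sum_factor[OF h]
      by (auto simp: mn_L_def mn_T_def sum.distrib simp flip: sum_distrib_left)
  qed
qed

text \<open>One inclusion is the relative openness of \<open>mn_L\<close>. For the other a single
  nonzero step inside \<open>mn_L\<close> suffices, because the equality constraints are affine:
  subtracting their instances at the two points leaves the homogeneous ones.\<close>

lemma tangent_dirs_mn_L:
  assumes b: "b \<in> mn_L V F N"
  shows "tangent_dirs (mn_L V F N) b = mn_T V F N"
proof
  show "mn_T V F N \<subseteq> tangent_dirs (mn_L V F N) b"
    using eventually_mn_L[OF b] by (auto simp: tangent_dirs_def)
  show "tangent_dirs (mn_L V F N) b \<subseteq> mn_T V F N"
  proof
    fix h assume "h \<in> tangent_dirs (mn_L V F N) b"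
    then obtain e where "e > 0" "\<And>t. dist t 0 < e \<Longrightarrow> (\<lambda>c. b c + t * h c) \<in> mn_L V F N"
      by (auto simp: tangent_dirs_def eventually_nhds_metric)
    from this(2)[of "e / 2"] this(1) have L: "(\<lambda>c. b c + (e / 2) * h c) \<in> mn_L V F N" by simp
    have e: "e / 2 \<noteq> 0" using \<open>e > 0\<close> by simp
    have "(e / 2) * h c = 0" if "c \<notin> mn_coords V F N" for c
      using that b L by (simp add: mn_L_def)
    moreover have "(e / 2) * (\<Sum>k\<in>states N i. h (Node i k)) = 0" if "i \<in> V" for i
      using that b L unfolding sum_distrib_left by (simp add: mn_L_def sum.distrib)
    moreover have "(e / 2) * h (Node i k) = (e / 2) * (\<Sum>x\<in>fibre \<alpha> i k. h (Factor \<alpha> x))"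
      if "\<alpha> \<in> F" "i \<in> \<alpha>" "k \<in> states N i" for \<alpha> i k
      using mn_L_node[OF b that] mn_L_node[OF L that] unfolding sum_distrib_left by (simp add: sum.distrib)
    ultimately show "h \<in> mn_T V F N" using e by (simp add: mn_T_def)
  qed
qed

section \<open>The Hessian form of the multinomial Bethe free energy\<close>

lemma DERIV_mult_ln:
  assumes "0 < (a::real)"
  shows "((\<lambda>t. (a + t * k) * ln (a + t * k)) has_real_derivative k * (ln a + 1)) (at 0)"
  using assms by (auto intro!: derivative_eq_intros simp: algebra_simps)

lemma has_hessian_mn_bethe:
  assumes b: "b \<in> mn_L V F N"
  shows "has_hessian (mn_L V F N) (mn_bethe V F N \<Psi>) b (mn_hess V F N b)"
  unfolding has_hessian_def tangent_dirs_mn_L[OF b]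
proof (intro ballI exI conjI)
  fix h k assume h: "h \<in> mn_T V F N" and k: "k \<in> mn_T V F N"
  \<comment> \<open>The directional derivative along \<open>k\<close> at the point moved by
    \<open>s\<close> along \<open>h\<close>. It is needed only for small \<open>s\<close>, where
    this point is still in \<open>mn_L\<close> and all logarithms have positive arguments.\<close>
  define g where "g s =
     - (\<Sum>\<alpha>\<in>F. \<Sum>x\<in>configs N \<alpha>. k (Factor \<alpha> x) * ln (\<Psi> \<alpha> x))
     + (\<Sum>\<alpha>\<in>F. \<Sum>x\<in>configs N \<alpha>. k (Factor \<alpha> x) * (ln (b (Factor \<alpha> x) + s * h (Factor \<alpha> x)) + 1))
     + (\<Sum>i\<in>V. (1 - real (degree_of F i)) *
          (\<Sum>l\<in>states N i. k (Node i l) * (ln (b (Node i l) + s * h (Node i l)) + 1)))" for s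
  show "\<forall>\<^sub>F s in nhds 0. ((\<lambda>t. mn_bethe V F N \<Psi> (\<lambda>c. b c + s * h c + t * k c)) has_real_derivative g s) (at 0)"
    using eventually_mn_L[OF b h]
  proof eventually_elim
    case (elim s)
    have lin: "((\<lambda>t. (a + t * k) * p) has_real_derivative k * p) (at 0)" for a k p :: real
      by (auto intro!: derivative_eq_intros)
    show ?case unfolding mn_bethe_def g_def
      by (intro DERIV_add DERIV_minus DERIV_sum DERIV_cmult lin DERIV_mult_ln)
        (use mn_L_pos[OF elim] in auto)
  qed
  have ln': "((\<lambda>s. k * (ln (a + s * h) + 1)) has_real_derivative h * k / a) (at 0)"
    if "0 < a" for a h k :: real
    using that by (auto intro!: derivative_eq_intros)
  have "(g has_real_derivative 0 + mn_hess V F N b h k) (at 0)"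
    unfolding mn_hess_def add.assoc[symmetric] g_def
    by (intro DERIV_add DERIV_minus DERIV_sum DERIV_cmult DERIV_const ln')
      (use mn_L_pos[OF b] in auto)
  then show "(g has_real_derivative mn_hess V F N b h k) (at 0)" by simp
qed

lemma mn_hess_sym: "mn_hess V F N b h k = mn_hess V F N b k h"
  by (simp add: mn_hess_def mult.commute)

lemma mn_hess_linear:
  "mn_hess V F N b (\<lambda>c. a * h c + a' * h' c) k = a * mn_hess V F N b h k + a' * mn_hess V F N b h' k"
  by (simp add: mn_hess_def algebra_simps add_divide_distrib sum.distrib sum_distrib_left)

lemma mn_T_linear:
  "h \<in> mn_T V F N \<Longrightarrow> k \<in> mn_T V F N \<Longrightarrow> (\<lambda>c. a * h c + a' * k c) \<in> mn_T V F N"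
  by (auto simp: mn_T_def sum.distrib simp flip: sum_distrib_left)

lemma closed_mn_T: "closed (mn_T V F N)"
proof -
  have "mn_T V F N = (\<Inter>c\<in>- mn_coords V F N. {h. h c = 0}) \<inter>
      (\<Inter>i\<in>V. {h. (\<Sum>k\<in>states N i. h (Node i k)) = 0}) \<inter>
      (\<Inter>\<alpha>\<in>F. \<Inter>i\<in>\<alpha>. \<Inter>k\<in>states N i. {h. h (Node i k) = (\<Sum>x\<in>fibre \<alpha> i k. h (Factor \<alpha> x))})"
    by (auto simp: mn_T_def)
  also have "closed \<dots>"
    by (intro closed_Int closed_INT ballI closed_Collect_eq continuous_intros continuous_on_product_coordinates)
  finally show ?thesis .
qed

section \<open>Null vectors of the multinomial Hessian as messages\<close>

definition base :: "'v set \<Rightarrow> 'v \<Rightarrow> nat" where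
  "base \<alpha> = restrict (\<lambda>_. 1) \<alpha>"

lemma one_state: "i \<in> V \<Longrightarrow> 1 \<in> states N i"
  using N_pos by (simp add: states_def)

lemma base_configs: "\<alpha> \<in> F \<Longrightarrow> base \<alpha> \<in> configs N \<alpha>"
  using one_state factor_sub by (fastforce simp: base_def configs_def)

lemma base_upd_configs:
  "\<alpha> \<in> F \<Longrightarrow> i \<in> \<alpha> \<Longrightarrow> l \<in> states N i \<Longrightarrow> (base \<alpha>)(i := l) \<in> configs N \<alpha>"
  using base_configs[of \<alpha>] by (fastforce simp: configs_def PiE_def extensional_def)

lemma base_upd_one: "i \<in> \<alpha> \<Longrightarrow> (base \<alpha>)(i := 1) = base \<alpha>"
  by (auto simp: base_def)

lemma sum_delta_fibre:
  assumes "\<alpha> \<in> F" "a \<in> configs N \<alpha>"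
  shows "(\<Sum>y\<in>fibre \<alpha> i l. if y = a then 1 else 0 :: real) = (if a i = l then 1 else 0)"
  using assms by (simp add: sum.delta)

lemma sum_mult_delta:
  assumes "\<alpha> \<in> F" "a \<in> configs N \<alpha>"
  shows "(\<Sum>y\<in>configs N \<alpha>. f y * (if y = a then 1 else 0 :: real)) = f a"
  using assms by (simp add: if_distrib[of "\<lambda>t. _ * t"] sum.delta cong: if_cong)

text \<open>The conditional expectation of f(x_j) given x_i = k under the belief of
  \<open>\<alpha>\<close>; the denominator is the probability of the condition because the beliefs
  are consistent.\<close>

definition cond :: "('v mn_coord \<Rightarrow> real) \<Rightarrow> 'v set \<Rightarrow> 'v \<Rightarrow> 'v \<Rightarrow> (nat \<Rightarrow> real) \<Rightarrow> nat \<Rightarrow> real" where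
  "cond b \<alpha> i j f k =
     (\<Sum>x\<in>fibre \<alpha> i k. b (Factor \<alpha> x) * f (x j)) / b (Node i k)"

text \<open>Mean zero under the node belief. A function on the states of a node is determined by its
  covariances with the statistic only up to a constant; this condition fixes the constant.\<close>

definition centered :: "('v mn_coord \<Rightarrow> real) \<Rightarrow> 'v \<Rightarrow> (nat \<Rightarrow> real) \<Rightarrow> bool" where
  "centered b i f \<longleftrightarrow> (\<Sum>k\<in>states N i. b (Node i k) * f k) = 0"

text \<open>Testing against \<open>\<delta>\<^sub>x - (\<Sum>i. \<delta>\<^bsub>base(i := x i)\<^esub>) + (card \<alpha> - 1) \<delta>\<^bsub>base\<^esub>\<close>, whose marginals vanish,
  shows that \<open>h\<^sub>\<alpha> / b\<^sub>\<alpha>\<close> is a sum of functions of one variable.\<close>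

lemma null_vector_additive:
  assumes b: "b \<in> mn_L V F N" and h: "h \<in> mn_T V F N"
    and null: "\<And>k. k \<in> mn_T V F N \<Longrightarrow> mn_hess V F N b h k = 0"
    and \<alpha>: "\<alpha> \<in> F" and x: "x \<in> configs N \<alpha>"
  defines "g \<equiv> \<lambda>x. h (Factor \<alpha> x) / b (Factor \<alpha> x)"
  shows "g x = (\<Sum>i\<in>\<alpha>. g ((base \<alpha>)(i := x i))) - (real (card \<alpha>) - 1) * g (base \<alpha>)"
proof -
  define u where "u y = (if y = x then 1 else 0)
      - (\<Sum>i\<in>\<alpha>. if y = (base \<alpha>)(i := x i) then 1 else 0)
      + (real (card \<alpha>) - 1) * (if y = base \<alpha> then 1 else 0)" for y
  define k where "k c = (case c of Factor \<beta> y \<Rightarrow> if \<beta> = \<alpha> then u y else 0 | Node i l \<Rightarrow> 0)" for c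
  have upd: "(base \<alpha>)(i := x i) \<in> configs N \<alpha>" if "i \<in> \<alpha>" for i
    using base_upd_configs[OF \<alpha> that configs_state[OF x that]] .
  \<comment> \<open>At coordinate \<open>i\<close> the point \<open>x\<close> and its modification
    of \<open>base\<close> at \<open>i\<close> agree and cancel, while the other card - 1
    modifications keep the state of \<open>base\<close> and cancel the last term.\<close>
  have marg: "(\<Sum>y\<in>fibre \<alpha> i l. u y) = 0" if "i \<in> \<alpha>" for i l
  proof -
    have "(\<Sum>y\<in>fibre \<alpha> i l. u y) = (if x i = l then 1 else 0)
        - (\<Sum>j\<in>\<alpha>. \<Sum>y\<in>fibre \<alpha> i l. if y = (base \<alpha>)(j := x j) then 1 else 0)
        + (real (card \<alpha>) - 1) * (if base \<alpha> i = l then 1 else 0)"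
      unfolding u_def sum.distrib sum_subtractf sum_distrib_left[symmetric]
        sum_delta_fibre[OF \<alpha> x] sum_delta_fibre[OF \<alpha> base_configs[OF \<alpha>]]
      by (subst sum.swap) simp
    also have "(\<Sum>j\<in>\<alpha>. \<Sum>y\<in>fibre \<alpha> i l. if y = (base \<alpha>)(j := x j) then 1 else 0) =
        (\<Sum>j\<in>\<alpha>. if ((base \<alpha>)(j := x j)) i = l then 1 else 0 :: real)"
      using upd by (intro sum.cong refl sum_delta_fibre[OF \<alpha>]) auto
    also have "\<dots> = (if x i = l then 1 else 0) + (\<Sum>j\<in>\<alpha> - {i}. if base \<alpha> i = l then 1 else 0)"
      unfolding sum.remove[OF finite_factor[OF \<alpha>] that]
      by (intro arg_cong2[where f = "(+)"] sum.cong) auto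
    also have "(\<Sum>j\<in>\<alpha> - {i}. if base \<alpha> i = l then 1 else 0 :: real) =
        (real (card \<alpha>) - 1) * (if base \<alpha> i = l then 1 else 0)"
      using that finite_factor[OF \<alpha>] card_gt_0_iff[of \<alpha>] by (auto simp: of_nat_diff)
    finally show ?thesis by simp
  qed
  have "u y = 0" if "y \<notin> configs N \<alpha>" for y
  proof -
    have "y \<noteq> x" "y \<noteq> base \<alpha>" "\<And>i. i \<in> \<alpha> \<Longrightarrow> y \<noteq> (base \<alpha>)(i := x i)"
      using that x base_configs[OF \<alpha>] upd by auto
    then show ?thesis by (simp add: u_def)
  qed
  moreover have "(\<Sum>y\<in>fibre \<beta> i l. if \<beta> = \<alpha> then u y else 0) = 0" if "i \<in> \<beta>" for \<beta> i l
    using marg that by (cases "\<beta> = \<alpha>") auto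
  ultimately have "k \<in> mn_T V F N"
    using \<alpha> by (auto simp: mn_T_def k_def mn_coords_def split: mn_coord.splits)
  then have "0 = mn_hess V F N b h k" using null by simp
  also have "\<dots> = (\<Sum>\<beta>\<in>F. if \<beta> = \<alpha> then \<Sum>y\<in>configs N \<alpha>. g y * u y else 0)"
    unfolding mn_hess_def k_def g_def by (auto intro!: sum.cong)
  also have "\<dots> = (\<Sum>y\<in>configs N \<alpha>. g y * u y)"
    using \<alpha> finite_F by (simp add: sum.delta)
  also have "\<dots> = g x - (\<Sum>i\<in>\<alpha>. \<Sum>y\<in>configs N \<alpha>. g y * (if y = (base \<alpha>)(i := x i) then 1 else 0))
      + (real (card \<alpha>) - 1) * g (base \<alpha>)"
  proof -
    have "(\<Sum>y\<in>configs N \<alpha>. g y * u y) = (\<Sum>y\<in>configs N \<alpha>. g y * (if y = x then 1 else 0))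
        - (\<Sum>y\<in>configs N \<alpha>. \<Sum>i\<in>\<alpha>. g y * (if y = (base \<alpha>)(i := x i) then 1 else 0))
        + (real (card \<alpha>) - 1) * (\<Sum>y\<in>configs N \<alpha>. g y * (if y = base \<alpha> then 1 else 0))"
      unfolding sum_distrib_left sum.distrib[symmetric] sum_subtractf[symmetric]
      by (intro sum.cong refl) (simp add: u_def algebra_simps sum_distrib_left)
    then show ?thesis
      unfolding sum_mult_delta[OF \<alpha> x] sum_mult_delta[OF \<alpha> base_configs[OF \<alpha>]]
      by (subst (asm) sum.swap) simp
  qed
  also have "(\<Sum>i\<in>\<alpha>. \<Sum>y\<in>configs N \<alpha>. g y * (if y = (base \<alpha>)(i := x i) then 1 else 0)) =
      (\<Sum>i\<in>\<alpha>. g ((base \<alpha>)(i := x i)))"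
    using upd by (intro sum.cong refl sum_mult_delta[OF \<alpha>])
  finally show ?thesis by simp
qed

text \<open>The test direction moves mass from state 1 to state \<open>l\<close> at node
  \<open>i\<close>, simultaneously in all factors through \<open>i\<close>; the marginals at all
  other nodes stay unchanged. Since total mass is preserved, stationarity is seen only in
  differences of values.\<close>

lemma null_vector_node:
  assumes b: "b \<in> mn_L V F N" and h: "h \<in> mn_T V F N"
    and null: "\<And>k. k \<in> mn_T V F N \<Longrightarrow> mn_hess V F N b h k = 0"
    and i: "i \<in> V" and l: "l \<in> states N i"
  defines "g \<equiv> \<lambda>\<alpha> x. h (Factor \<alpha> x) / b (Factor \<alpha> x)" and "w \<equiv> \<lambda>l. h (Node i l) / b (Node i l)"
  shows "(\<Sum>\<alpha>\<in>{\<alpha>\<in>F. i \<in> \<alpha>}. g \<alpha> ((base \<alpha>)(i := l)) - g \<alpha> (base \<alpha>)) +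
    (1 - real (degree_of F i)) * (w l - w 1) = 0"
proof -
  define u where "u \<alpha> y = (if y = (base \<alpha>)(i := l) then 1 else 0) - (if y = base \<alpha> then 1 else 0 :: real)" for \<alpha> y
  define v where "v l' = (if l' = l then 1 else 0) - (if l' = 1 then 1 else 0 :: real)" for l'
  define k where "k c = (case c of Factor \<beta> y \<Rightarrow> if \<beta> \<in> F \<and> i \<in> \<beta> then u \<beta> y else 0
    | Node i' l' \<Rightarrow> if i' = i then v l' else 0)" for c
  have upd: "(base \<alpha>)(i := l) \<in> configs N \<alpha>" if "\<alpha> \<in> F" "i \<in> \<alpha>" for \<alpha>
    using base_upd_configs[OF that l] .
  have marg: "(\<Sum>y\<in>fibre \<alpha> j l'. u \<alpha> y) = (if j = i then v l' else 0)"
    if \<alpha>: "\<alpha> \<in> F" "i \<in> \<alpha>" "j \<in> \<alpha>" for \<alpha> j l'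
    unfolding u_def sum_subtractf sum_delta_fibre[OF \<alpha>(1) upd[OF \<alpha>(1,2)]]
      sum_delta_fibre[OF \<alpha>(1) base_configs[OF \<alpha>(1)]]
    using \<alpha> by (auto simp: v_def base_def)
  have "u \<alpha> y = 0" if "\<alpha> \<in> F" "i \<in> \<alpha>" "y \<notin> configs N \<alpha>" for \<alpha> y
    using that upd base_configs by (auto simp: u_def)
  moreover have "v l' = 0" if "l' \<notin> states N i" for l'
    using that l one_state[OF i] by (auto simp: v_def)
  moreover have "(\<Sum>l'\<in>states N i. v l') = 0"
    using l one_state[OF i] by (simp add: v_def sum_subtractf sum.delta)
  moreover from calculation have "(\<Sum>l'\<in>states N i'. if i' = i then v l' else 0) = 0" for i'
    by (cases "i' = i") auto
  moreover have "(if j = i then v l' else 0) =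
      (\<Sum>y\<in>fibre \<alpha> j l'. if \<alpha> \<in> F \<and> i \<in> \<alpha> then u \<alpha> y else 0)"
    if "\<alpha> \<in> F" "j \<in> \<alpha>" for \<alpha> j l'
    using marg[OF that(1) _ that(2), of l'] that by (cases "i \<in> \<alpha>") auto
  ultimately have "k \<in> mn_T V F N"
    using i by (auto simp: mn_T_def k_def mn_coords_def split: mn_coord.splits)
  then have "0 = mn_hess V F N b h k" using null by simp
  also have "\<dots> = (\<Sum>\<alpha>\<in>F. if i \<in> \<alpha> then \<Sum>y\<in>configs N \<alpha>. g \<alpha> y * u \<alpha> y else 0) +
      (\<Sum>i'\<in>V. if i' = i then (1 - real (degree_of F i)) * (\<Sum>l'\<in>states N i. w l' * v l') else 0)"
    unfolding mn_hess_def k_def g_def w_def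
    by (intro arg_cong2[where f = "(+)"] sum.cong) auto
  also have "(\<Sum>i'\<in>V. if i' = i then (1 - real (degree_of F i)) * (\<Sum>l'\<in>states N i. w l' * v l') else 0) =
      (1 - real (degree_of F i)) * (w l - w 1)"
  proof -
    have "(\<Sum>l'\<in>states N i. w l' * v l') =
        (\<Sum>l'\<in>states N i. if l' = l then w l' else 0) - (\<Sum>l'\<in>states N i. if l' = 1 then w l' else 0)"
      unfolding sum_subtractf[symmetric] by (intro sum.cong) (auto simp: v_def)
    then show ?thesis using finite_V i l one_state[OF i] by (simp add: sum.delta)
  qed
  also have "(\<Sum>\<alpha>\<in>F. if i \<in> \<alpha> then \<Sum>y\<in>configs N \<alpha>. g \<alpha> y * u \<alpha> y else 0) =
      (\<Sum>\<alpha>\<in>{\<alpha>\<in>F. i \<in> \<alpha>}. \<Sum>y\<in>configs N \<alpha>. g \<alpha> y * u \<alpha> y)"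
    by (rule sum.inter_filter[OF finite_F, symmetric])
  also have "\<dots> = (\<Sum>\<alpha>\<in>{\<alpha>\<in>F. i \<in> \<alpha>}. g \<alpha> ((base \<alpha>)(i := l)) - g \<alpha> (base \<alpha>))"
  proof (intro sum.cong refl)
    fix \<alpha> assume "\<alpha> \<in> {\<alpha>\<in>F. i \<in> \<alpha>}"
    then have \<alpha>: "\<alpha> \<in> F" "i \<in> \<alpha>" by auto
    show "(\<Sum>y\<in>configs N \<alpha>. g \<alpha> y * u \<alpha> y) = g \<alpha> ((base \<alpha>)(i := l)) - g \<alpha> (base \<alpha>)"
      unfolding u_def right_diff_distrib sum_subtractf
        sum_mult_delta[OF \<alpha>(1) upd[OF \<alpha>]] sum_mult_delta[OF \<alpha>(1) base_configs[OF \<alpha>(1)]] ..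
  qed
  finally show ?thesis by simp
qed

text \<open>The seminorm \<open>n\<close> is kept abstract so that one choice, made at the given
  beliefs, can be used at every point of the path. It needs to be definite only on centered
  functions, and \<open>y\<close>, \<open>w\<close> and the messages are all centered.\<close>

lemma mn_hess_nondegenerate:
  fixes n :: "'v \<Rightarrow> (nat \<Rightarrow> real) \<Rightarrow> real"
  assumes b: "b \<in> mn_L V F N" and h: "h \<in> mn_T V F N"
    and null: "\<And>k. k \<in> mn_T V F N \<Longrightarrow> mn_hess V F N b h k = 0"
    and n_nonneg: "\<And>i f. i \<in> V \<Longrightarrow> 0 \<le> n i f"
    and n_add: "\<And>i f g. i \<in> V \<Longrightarrow> n i (\<lambda>k. f k + g k) \<le> n i f + n i g"
    and n_zero: "\<And>i. i \<in> V \<Longrightarrow> n i (\<lambda>k. 0) = 0"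
    and n_cong: "\<And>i f g. i \<in> V \<Longrightarrow> (\<And>k. k \<in> states N i \<Longrightarrow> f k = g k) \<Longrightarrow> n i f = n i g"
    and n_definite: "\<And>i f k. i \<in> V \<Longrightarrow> centered b i f \<Longrightarrow> n i f = 0 \<Longrightarrow> k \<in> states N i \<Longrightarrow> f k = 0"
    and n_contr: "\<And>\<alpha> i j f. \<alpha> \<in> F \<Longrightarrow> i \<in> \<alpha> \<Longrightarrow> j \<in> \<alpha> \<Longrightarrow> i \<noteq> j \<Longrightarrow> centered b j f \<Longrightarrow>
      n i (cond b \<alpha> i j f) \<le> c * n j f"
    and c: "0 \<le> c" "c * rho F < 1"
  shows "h = (\<lambda>c. 0)"
proof -
  define g where "g \<alpha> x = h (Factor \<alpha> x) / b (Factor \<alpha> x)" for \<alpha> x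
  define w where "w i k = h (Node i k) / b (Node i k)" for i k
  define m where "m \<alpha> i = (\<Sum>l\<in>states N i. b (Node i l) * g \<alpha> ((base \<alpha>)(i := l)))" for \<alpha> i
  define y where "y \<alpha> i l = g \<alpha> ((base \<alpha>)(i := l)) - m \<alpha> i" for \<alpha> i l
  define msg where "msg \<alpha> i l = w i l - y \<alpha> i l" for \<alpha> i l
  have inV: "i \<in> V" if "\<alpha> \<in> F" "i \<in> \<alpha>" for \<alpha> i using that factor_sub by blast
  have b1: "(\<Sum>k\<in>states N i. b (Node i k)) = 1" if "i \<in> V" for i
    using that b by (simp add: mn_L_def)
  have bg: "b (Factor \<alpha> x) * g \<alpha> x = h (Factor \<alpha> x)" if "\<alpha> \<in> F" "x \<in> configs N \<alpha>" for \<alpha> x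
    using mn_L_pos(1)[OF b that] by (simp add: g_def)
  have bw: "b (Node i k) * w i k = h (Node i k)" if "i \<in> V" "k \<in> states N i" for i k
    using mn_L_pos(2)[OF b that] by (simp add: w_def)
  have y_centered: "centered b i (y \<alpha> i)" if "i \<in> V" for i \<alpha>
    using b1[OF that]
    by (simp add: centered_def y_def right_diff_distrib sum_subtractf m_def flip: sum_distrib_right)
  have w_centered: "centered b i (w i)" if "i \<in> V" for i
    using h that by (simp add: centered_def bw mn_T_def)
  have expect: "(\<Sum>x\<in>configs N \<alpha>. b (Factor \<alpha> x) * f (x i)) = (\<Sum>k\<in>states N i. b (Node i k) * f k)"
    if "\<alpha> \<in> F" "i \<in> \<alpha>" for \<alpha> i f
    using sum_configs_fibres[OF that, of f "\<lambda>x. b (Factor \<alpha> x)"] mn_L_node[OF b that]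
    by (simp add: mult.commute)
  \<comment> \<open>Subtracting the means \<open>m\<close> from the one-variable functions leaves a
    constant. It is the mean of \<open>g\<close> under the belief, that is the sum of
    \<open>h\<close> over the factor, hence 0.\<close>
  have g_add: "g \<alpha> x = (\<Sum>i\<in>\<alpha>. y \<alpha> i (x i))" if \<alpha>: "\<alpha> \<in> F" and x: "x \<in> configs N \<alpha>" for \<alpha> x
  proof -
    define C where "C = (\<Sum>i\<in>\<alpha>. m \<alpha> i) - (real (card \<alpha>) - 1) * g \<alpha> (base \<alpha>)"
    have dec: "g \<alpha> x = (\<Sum>i\<in>\<alpha>. y \<alpha> i (x i)) + C" if "x \<in> configs N \<alpha>" for x
      using null_vector_additive[OF b h null \<alpha> that]
      by (simp add: g_def[symmetric] y_def C_def sum_subtractf)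
    have "0 = (\<Sum>x\<in>configs N \<alpha>. b (Factor \<alpha> x) * g \<alpha> x)"
      using mn_T_sum_factor[OF h \<alpha>] by (simp add: bg[OF \<alpha>])
    also have "\<dots> = (\<Sum>x\<in>configs N \<alpha>. b (Factor \<alpha> x) * (\<Sum>i\<in>\<alpha>. y \<alpha> i (x i)) + b (Factor \<alpha> x) * C)"
      by (intro sum.cong refl) (simp add: dec distrib_left)
    also have "\<dots> = (\<Sum>i\<in>\<alpha>. \<Sum>x\<in>configs N \<alpha>. b (Factor \<alpha> x) * y \<alpha> i (x i)) + (\<Sum>x\<in>configs N \<alpha>. b (Factor \<alpha> x)) * C"
      unfolding sum.distrib sum_distrib_left sum_distrib_right by (subst sum.swap) simp
    also have "(\<Sum>i\<in>\<alpha>. \<Sum>x\<in>configs N \<alpha>. b (Factor \<alpha> x) * y \<alpha> i (x i)) = 0"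
      using y_centered inV[OF \<alpha>] by (intro sum.neutral) (simp add: expect[OF \<alpha>] centered_def)
    also have "(\<Sum>x\<in>configs N \<alpha>. b (Factor \<alpha> x)) = 1" using b \<alpha> by (simp add: mn_L_def)
    finally show ?thesis using dec[OF x] by simp
  qed
  \<comment> \<open>On a fibre the term \<open>j = i\<close> is the constant
    \<open>y \<alpha> i k\<close>; the remaining terms, divided by the node belief, are conditional
    expectations.\<close>
  have msg_cond: "msg \<alpha> i k = (\<Sum>j\<in>\<alpha> - {i}. cond b \<alpha> i j (y \<alpha> j) k)"
    if \<alpha>: "\<alpha> \<in> F" and i: "i \<in> \<alpha>" and k: "k \<in> states N i" for \<alpha> i k
  proof -
    let ?X = "(fibre \<alpha> i k)"
    have "h (Node i k) = (\<Sum>x\<in>?X. b (Factor \<alpha> x) * g \<alpha> x)"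
      using h \<alpha> i k by (simp add: mn_T_def bg)
    also have "\<dots> = (\<Sum>x\<in>?X. b (Factor \<alpha> x) * y \<alpha> i k + (\<Sum>j\<in>\<alpha> - {i}. b (Factor \<alpha> x) * y \<alpha> j (x j)))"
      using \<alpha> i finite_factor[OF \<alpha>]
      by (intro sum.cong refl) (simp add: g_add sum.remove[of \<alpha> i] distrib_left sum_distrib_left)
    also have "\<dots> = b (Node i k) * y \<alpha> i k + (\<Sum>j\<in>\<alpha> - {i}. \<Sum>x\<in>?X. b (Factor \<alpha> x) * y \<alpha> j (x j))"
      unfolding sum.distrib mn_L_node[OF b \<alpha> i k, symmetric] sum_distrib_right
      by (subst sum.swap) simp
    finally show ?thesis
      using mn_L_pos(2)[OF b inV[OF \<alpha> i] k]
      by (simp add: msg_def w_def cond_def add_divide_distrib sum_divide_distrib)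
  qed
  have w_sum: "w i l = (\<Sum>\<alpha>\<in>{\<alpha>\<in>F. i \<in> \<alpha>}. msg \<alpha> i l)" if i: "i \<in> V" and l: "l \<in> states N i" for i l
  proof -
    \<comment> \<open>The node stationarity expression. It is known only to be constant in the
      state, but it also has mean zero. Writing \<open>y\<close> as \<open>w - msg\<close> then
      makes the degree cancel.\<close>
    define \<phi> where "\<phi> l = (\<Sum>\<alpha>\<in>{\<alpha>\<in>F. i \<in> \<alpha>}. y \<alpha> i l) + (1 - real (degree_of F i)) * w i l" for l
    have const: "\<phi> l = \<phi> 1" if "l \<in> states N i" for l
    proof -
      have "(\<Sum>\<alpha>\<in>{\<alpha>\<in>F. i \<in> \<alpha>}. g \<alpha> ((base \<alpha>)(i := l)) - g \<alpha> (base \<alpha>)) =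
          (\<Sum>\<alpha>\<in>{\<alpha>\<in>F. i \<in> \<alpha>}. y \<alpha> i l) - (\<Sum>\<alpha>\<in>{\<alpha>\<in>F. i \<in> \<alpha>}. y \<alpha> i 1)"
        unfolding sum_subtractf[symmetric] by (intro sum.cong refl) (simp add: y_def base_upd_one[unfolded One_nat_def])
      then show ?thesis using null_vector_node[OF b h null i that]
        by (simp add: g_def[symmetric] w_def[symmetric] \<phi>_def algebra_simps)
    qed
    have "(\<Sum>l\<in>states N i. b (Node i l) * \<phi> l) =
        (\<Sum>l\<in>states N i. \<Sum>\<alpha>\<in>{\<alpha>\<in>F. i \<in> \<alpha>}. b (Node i l) * y \<alpha> i l) +
        (1 - real (degree_of F i)) * (\<Sum>l\<in>states N i. b (Node i l) * w i l)"
      unfolding \<phi>_def distrib_left sum.distrib sum_distrib_left by (simp add: mult_ac)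
    also have "\<dots> = 0"
      using y_centered[OF i] w_centered[OF i] by (subst sum.swap) (simp add: centered_def)
    finally have "(\<Sum>l\<in>states N i. b (Node i l) * \<phi> 1) = 0" using const by simp
    then have "\<phi> 1 = 0" using b1[OF i] by (simp flip: sum_distrib_right)
    then have "\<phi> l = 0" using const[OF l] by simp
    moreover have "(\<Sum>\<alpha>\<in>{\<alpha>\<in>F. i \<in> \<alpha>}. y \<alpha> i l) =
        real (degree_of F i) * w i l - (\<Sum>\<alpha>\<in>{\<alpha>\<in>F. i \<in> \<alpha>}. msg \<alpha> i l)"
      by (simp add: msg_def sum_subtractf degree_of_def)
    ultimately show ?thesis by (simp add: \<phi>_def algebra_simps)
  qed
  \<comment> \<open>The message of \<open>\<alpha>\<close> itself is removed from the sum for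
    \<open>w\<close>; this is the source of the condition on distinct factors in
    \<open>edge_succ\<close>.\<close>
  have y_sum: "y \<alpha> j l = (\<Sum>\<beta>\<in>{\<beta>\<in>F. j \<in> \<beta>} - {\<alpha>}. msg \<beta> j l)"
    if \<alpha>: "\<alpha> \<in> F" "j \<in> \<alpha>" and l: "l \<in> states N j" for \<alpha> j l
    using w_sum[OF inV[OF \<alpha>] l] \<alpha> finite_F
    by (subst (asm) sum.remove[of _ \<alpha>]) (auto simp: msg_def)
  have n_sum: "n i (\<lambda>k. \<Sum>j\<in>J. f j k) \<le> (\<Sum>j\<in>J. n i (f j))" if "finite J" "i \<in> V" for i J and f :: "'z \<Rightarrow> nat \<Rightarrow> real"
    using that
  proof (induction J rule: finite_induct)
    case (insert j J)
    then show ?case using n_add[of i "f j" "\<lambda>k. \<Sum>j\<in>J. f j k"] by simp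
  qed (simp add: n_zero)
  have msg_zero: "n i (msg \<alpha> i) = 0" if \<alpha>: "\<alpha> \<in> F" "i \<in> \<alpha>" for \<alpha> i
  proof (rule messages_zero[OF hyp _ c _ \<alpha>])
    show "0 \<le> n i (msg \<alpha> i)" if "\<alpha> \<in> F" "i \<in> \<alpha>" for \<alpha> i by (rule n_nonneg[OF inV[OF that]])
    fix \<alpha> i assume \<alpha>: "\<alpha> \<in> F" "i \<in> \<alpha>"
    have "n i (msg \<alpha> i) = n i (\<lambda>k. \<Sum>j\<in>\<alpha> - {i}. cond b \<alpha> i j (y \<alpha> j) k)"
      by (intro n_cong inV[OF \<alpha>] msg_cond[OF \<alpha>])
    also have "\<dots> \<le> (\<Sum>j\<in>\<alpha> - {i}. n i (cond b \<alpha> i j (y \<alpha> j)))"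
      using finite_factor[OF \<alpha>(1)] by (intro n_sum inV[OF \<alpha>]) auto
    also have "\<dots> \<le> (\<Sum>j\<in>\<alpha> - {i}. c * n j (y \<alpha> j))"
      using \<alpha> inV[OF \<alpha>(1)] by (intro sum_mono n_contr y_centered) auto
    also have "\<dots> \<le> (\<Sum>j\<in>\<alpha> - {i}. c * (\<Sum>\<beta>\<in>{\<beta>\<in>F. j \<in> \<beta>} - {\<alpha>}. n j (msg \<beta> j)))"
    proof (intro sum_mono mult_left_mono c(1))
      fix j assume "j \<in> \<alpha> - {i}"
      then have j: "j \<in> \<alpha>" by simp
      have "n j (y \<alpha> j) = n j (\<lambda>l. \<Sum>\<beta>\<in>{\<beta>\<in>F. j \<in> \<beta>} - {\<alpha>}. msg \<beta> j l)"
        by (intro n_cong inV[OF \<alpha>(1) j] y_sum[OF \<alpha>(1) j])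
      also have "\<dots> \<le> (\<Sum>\<beta>\<in>{\<beta>\<in>F. j \<in> \<beta>} - {\<alpha>}. n j (msg \<beta> j))"
        using finite_F by (intro n_sum inV[OF \<alpha>(1) j]) auto
      finally show "n j (y \<alpha> j) \<le> (\<Sum>\<beta>\<in>{\<beta>\<in>F. j \<in> \<beta>} - {\<alpha>}. n j (msg \<beta> j))" .
    qed
    finally show "n i (msg \<alpha> i) \<le> c * (\<Sum>j\<in>\<alpha> - {i}. \<Sum>\<beta>\<in>{\<beta>\<in>F. j \<in> \<beta>} - {\<alpha>}. n j (msg \<beta> j))"
      by (simp add: sum_distrib_left)
  qed
  have msg0: "msg \<alpha> i l = 0" if \<alpha>: "\<alpha> \<in> F" "i \<in> \<alpha>" and l: "l \<in> states N i" for \<alpha> i l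
  proof (rule n_definite[OF inV[OF \<alpha>] _ msg_zero[OF \<alpha>] l])
    show "centered b i (msg \<alpha> i)"
      using y_centered[OF inV[OF \<alpha>], of \<alpha>] w_centered[OF inV[OF \<alpha>]]
      by (simp add: centered_def msg_def right_diff_distrib sum_subtractf)
  qed
  have node: "h (Node i l) = 0" if "i \<in> V" "l \<in> states N i" for i l
    using bw[OF that] w_sum[OF that] msg0 that(2) by simp
  have factor: "h (Factor \<alpha> x) = 0" if \<alpha>: "\<alpha> \<in> F" and x: "x \<in> configs N \<alpha>" for \<alpha> x
  proof -
    have "y \<alpha> i (x i) = 0" if "i \<in> \<alpha>" for i
      using y_sum[OF \<alpha> that configs_state[OF x that]] msg0 configs_state[OF x that] by simp
    then show ?thesis using bg[OF \<alpha> x] g_add[OF \<alpha> x] by simp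
  qed
  have "h c = 0" for c
    using node factor h by (cases "c \<in> mn_coords V F N") (auto simp: mn_coords_def mn_T_def)
  then show ?thesis by auto
qed

end

section \<open>The path from independent beliefs to the given ones\<close>

lemma sum_over_factors_eq_degree_sum:
  assumes "hypergraph V F"
  shows "(\<Sum>\<alpha>\<in>F. \<Sum>i\<in>\<alpha>. f i) = (\<Sum>i\<in>V. real (degree_of F i) * f i)"
proof -
  have V: "finite V" and sub: "\<And>\<alpha>. \<alpha> \<in> F \<Longrightarrow> \<alpha> \<subseteq> V" using assms by (auto simp: hypergraph_def)
  then have F: "finite F" by (meson Pow_iff finite_Pow_iff finite_subset subsetI)
  have "(\<Sum>\<alpha>\<in>F. \<Sum>i\<in>\<alpha>. f i) = (\<Sum>\<alpha>\<in>F. \<Sum>i | i \<in> V \<and> i \<in> \<alpha>. f i)"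
    using sub by (intro sum.cong) auto
  also have "\<dots> = (\<Sum>i\<in>V. \<Sum>\<alpha> | \<alpha> \<in> F \<and> i \<in> \<alpha>. f i)"
    by (rule sum.swap_restrict[OF F V])
  finally show ?thesis by (simp add: degree_of_def)
qed

context mn_family
begin

text \<open>Each factor belief moves on the segment from the product of its marginals, while node
  beliefs stay put. The explicit 0 keeps the family inside \<open>mn_L\<close>, where coordinates
  that name no belief must vanish.\<close>

definition mn_path :: "('v mn_coord \<Rightarrow> real) \<Rightarrow> real \<Rightarrow> 'v mn_coord \<Rightarrow> real" where
  "mn_path b t c = (case c of
     Factor \<alpha> x \<Rightarrow> if \<alpha> \<in> F \<and> x \<in> configs N \<alpha> then (1 - t) * (\<Prod>i\<in>\<alpha>. b (Node i (x i))) + t * b c else 0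
   | Node i k \<Rightarrow> b c)"

lemma mn_path_Node [simp]: "mn_path b t (Node i k) = b (Node i k)"
  by (simp add: mn_path_def)

lemma mn_path_Factor:
  "\<alpha> \<in> F \<Longrightarrow> x \<in> configs N \<alpha> \<Longrightarrow>
    mn_path b t (Factor \<alpha> x) = (1 - t) * (\<Prod>i\<in>\<alpha>. b (Node i (x i))) + t * b (Factor \<alpha> x)"
  by (simp add: mn_path_def)

lemma mn_path_1: "b \<in> mn_L V F N \<Longrightarrow> mn_path b 1 = b"
  by (rule ext) (auto simp: mn_path_def mn_L_def mn_coords_def split: mn_coord.splits)

lemma sum_prod_configs:
  "\<alpha> \<in> F \<Longrightarrow> (\<Sum>x\<in>configs N \<alpha>. \<Prod>i\<in>\<alpha>. u i (x i)) = (\<Prod>i\<in>\<alpha>. \<Sum>k\<in>states N i. u i k :: real)"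
  unfolding configs_def by (rule prod_sum_PiE[symmetric]) (auto simp: finite_factor)

text \<open>Fixing the state at \<open>i\<close> amounts to replacing the factor at \<open>i\<close>
  by one concentrated on \<open>k\<close>; then the sum over all configurations factorizes.\<close>

lemma sum_prod_fibre:
  assumes "\<alpha> \<in> F" "i \<in> \<alpha>" "k \<in> states N i"
  shows "(\<Sum>x\<in>fibre \<alpha> i k. \<Prod>j\<in>\<alpha>. u j (x j)) =
    u i k * (\<Prod>j\<in>\<alpha> - {i}. \<Sum>l\<in>states N j. u j l :: real)"
proof -
  have fin: "finite \<alpha>" by (rule finite_factor[OF assms(1)])
  let ?u = "\<lambda>j l. if j = i then (if l = k then u i k else 0) else u j l"
  have "(\<Sum>x\<in>fibre \<alpha> i k. \<Prod>j\<in>\<alpha>. u j (x j)) =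
      (\<Sum>x\<in>configs N \<alpha>. if x i = k then \<Prod>j\<in>\<alpha>. u j (x j) else 0)"
    by (rule sum.inter_filter[OF finite_configs[OF assms(1)]])
  also have "\<dots> = (\<Sum>x\<in>configs N \<alpha>. \<Prod>j\<in>\<alpha>. ?u j (x j))"
  proof (intro sum.cong refl)
    fix x
    show "(if x i = k then \<Prod>j\<in>\<alpha>. u j (x j) else 0) = (\<Prod>j\<in>\<alpha>. ?u j (x j))"
      using fin assms(2) by (cases "x i = k") (auto intro!: prod.cong prod_zero[symmetric] bexI[of _ i])
  qed
  also have "\<dots> = (\<Prod>j\<in>\<alpha>. \<Sum>l\<in>states N j. ?u j l)"
    by (rule sum_prod_configs[OF assms(1)])
  also have "\<dots> = (\<Sum>l\<in>states N i. ?u i l) * (\<Prod>j\<in>\<alpha> - {i}. \<Sum>l\<in>states N j. ?u j l)"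
    by (rule prod.remove[OF fin assms(2)])
  also have "(\<Sum>l\<in>states N i. ?u i l) = u i k" using assms(3) by (simp add: sum.delta)
  also have "(\<Prod>j\<in>\<alpha> - {i}. \<Sum>l\<in>states N j. ?u j l) = (\<Prod>j\<in>\<alpha> - {i}. \<Sum>l\<in>states N j. u j l)"
    by (intro prod.cong) auto
  finally show ?thesis .
qed

context
  fixes b :: "'v mn_coord \<Rightarrow> real"
  assumes b: "b \<in> mn_L V F N"
begin

abbreviation bprod :: "'v set \<Rightarrow> ('v \<Rightarrow> nat) \<Rightarrow> real" where
  "bprod \<alpha> x \<equiv> (\<Prod>i\<in>\<alpha>. b (Node i (x i)))"

lemma node_sum_1: "i \<in> V \<Longrightarrow> (\<Sum>k\<in>states N i. b (Node i k)) = 1"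
  using b by (simp add: mn_L_def)

lemma bprod_pos: "\<alpha> \<in> F \<Longrightarrow> x \<in> configs N \<alpha> \<Longrightarrow> 0 < bprod \<alpha> x"
  using mn_L_pos(2)[OF b] configs_state factor_sub by (intro prod_pos) blast

lemma bprod_node:
  assumes "\<alpha> \<in> F" "i \<in> \<alpha>" "k \<in> states N i"
  shows "(\<Sum>x\<in>fibre \<alpha> i k. bprod \<alpha> x) = b (Node i k)"
proof -
  have "(\<Prod>j\<in>\<alpha> - {i}. \<Sum>l\<in>states N j. b (Node j l)) = 1"
    using node_sum_1 factor_sub[OF assms(1)] by (intro prod.neutral) auto
  then show ?thesis using sum_prod_fibre[OF assms, of "\<lambda>j l. b (Node j l)"] by simp
qed

text \<open>Independence: the sum factorizes, and the factor at \<open>j\<close> is the mean of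
  \<open>f\<close>, which is zero.\<close>

lemma bprod_cond:
  assumes "\<alpha> \<in> F" "i \<in> \<alpha>" "k \<in> states N i" "j \<in> \<alpha>" "j \<noteq> i" "centered b j f"
  shows "(\<Sum>x\<in>fibre \<alpha> i k. bprod \<alpha> x * f (x j)) = 0"
proof -
  have fin: "finite \<alpha>" by (rule finite_factor[OF assms(1)])
  let ?u = "\<lambda>j' l. b (Node j' l) * (if j' = j then f l else 1)"
  have prod_u: "(\<Prod>j'\<in>\<alpha>. ?u j' (x j')) = bprod \<alpha> x * f (x j)" for x
    using fin assms(4) by (simp add: prod.distrib prod.delta)
  have "(\<Prod>j'\<in>\<alpha> - {i}. \<Sum>l\<in>states N j'. ?u j' l) = 0"
    using fin assms(4-6) by (intro prod_zero bexI[of _ j]) (auto simp: centered_def)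
  then show ?thesis using sum_prod_fibre[OF assms(1-3), of ?u] unfolding prod_u by simp
qed

lemma mn_path_in_L:
  assumes t: "t \<in> {0..1}"
  shows "mn_path b t \<in> mn_L V F N"
proof -
  have pos: "0 < mn_path b t c" if "c \<in> mn_coords V F N" for c
  proof (cases c)
    case (Factor \<alpha> x)
    then have \<alpha>: "\<alpha> \<in> F" "x \<in> configs N \<alpha>" using that by (auto simp: mn_coords_def)
    show ?thesis
    proof (cases "t = 0")
      case True
      then show ?thesis using bprod_pos[OF \<alpha>] \<alpha> by (simp add: Factor mn_path_Factor)
    next
      case False
      then show ?thesis using bprod_pos[OF \<alpha>] mn_L_pos(1)[OF b \<alpha>] \<alpha> t
        by (auto simp: Factor mn_path_Factor intro!: add_nonneg_pos)
    qed
  next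
    case (Node i k)
    then show ?thesis using that b by (simp add: mn_L_def)
  qed
  have zero: "mn_path b t c = 0" if "c \<notin> mn_coords V F N" for c
    using that b by (cases c) (auto simp: mn_path_def mn_L_def mn_coords_def)
  have one: "(\<Sum>x\<in>configs N \<alpha>. mn_path b t (Factor \<alpha> x)) = 1" if \<alpha>: "\<alpha> \<in> F" for \<alpha>
  proof -
    have "(\<Sum>x\<in>configs N \<alpha>. mn_path b t (Factor \<alpha> x)) =
        (1 - t) * (\<Sum>x\<in>configs N \<alpha>. bprod \<alpha> x) + t * (\<Sum>x\<in>configs N \<alpha>. b (Factor \<alpha> x))"
      using \<alpha> by (simp add: mn_path_Factor sum.distrib sum_distrib_left)
    moreover have "(\<Sum>x\<in>configs N \<alpha>. bprod \<alpha> x) = 1"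
      using sum_prod_configs[OF \<alpha>, of "\<lambda>j l. b (Node j l)"] node_sum_1 factor_sub[OF \<alpha>]
      by (simp add: prod.neutral subset_iff)
    moreover have "(\<Sum>x\<in>configs N \<alpha>. b (Factor \<alpha> x)) = 1" using b \<alpha> by (simp add: mn_L_def)
    ultimately show ?thesis by simp
  qed
  have marg: "(\<Sum>x\<in>fibre \<alpha> i k. mn_path b t (Factor \<alpha> x)) = b (Node i k)"
    if \<alpha>: "\<alpha> \<in> F" "i \<in> \<alpha>" "k \<in> states N i" for \<alpha> i k
  proof -
    have "(\<Sum>x\<in>fibre \<alpha> i k. mn_path b t (Factor \<alpha> x)) =
        (1 - t) * (\<Sum>x\<in>fibre \<alpha> i k. bprod \<alpha> x) +
        t * (\<Sum>x\<in>fibre \<alpha> i k. b (Factor \<alpha> x))"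
      using \<alpha>(1) by (simp add: mn_path_Factor sum.distrib sum_distrib_left)
    then show ?thesis using bprod_node[OF \<alpha>] mn_L_node[OF b \<alpha>] by (simp add: algebra_simps)
  qed
  show ?thesis using pos zero one marg node_sum_1 by (auto simp: mn_L_def)
qed

text \<open>With fixed node beliefs the conditional expectation is affine in the factor belief, and
  the product contributes nothing. So the contraction estimate at the end of the path holds all
  along it.\<close>

lemma cond_mn_path:
  assumes "\<alpha> \<in> F" "i \<in> \<alpha>" "k \<in> states N i" "j \<in> \<alpha>" "j \<noteq> i" "centered b j f"
  shows "cond (mn_path b t) \<alpha> i j f k = t * cond b \<alpha> i j f k"
proof -
  have "(\<Sum>x\<in>fibre \<alpha> i k. mn_path b t (Factor \<alpha> x) * f (x j)) =
      (1 - t) * (\<Sum>x\<in>fibre \<alpha> i k. bprod \<alpha> x * f (x j)) +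
      t * (\<Sum>x\<in>fibre \<alpha> i k. b (Factor \<alpha> x) * f (x j))"
    unfolding sum_distrib_left sum.distrib[symmetric] using assms(1)
    by (intro sum.cong refl) (simp add: mn_path_Factor algebra_simps)
  then show ?thesis using bprod_cond[OF assms] by (simp add: cond_def)
qed

text \<open>Bessel's inequality in the space of square-integrable functions for the product law.
  Centered functions of different variables are orthogonal there, and \<open>G\<close> is the
  projection of h_\<open>\<alpha>\<close> / \<open>bprod\<close> to their sums; the left side is its
  squared length.\<close>

lemma bessel_factor:
  assumes h: "h \<in> mn_T V F N" and \<alpha>: "\<alpha> \<in> F"
  shows "(\<Sum>i\<in>\<alpha>. \<Sum>k\<in>states N i. h (Node i k) * h (Node i k) / b (Node i k)) \<le>
    (\<Sum>x\<in>configs N \<alpha>. h (Factor \<alpha> x) * h (Factor \<alpha> x) / bprod \<alpha> x)"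
proof -
  define w where "w i k = h (Node i k) / b (Node i k)" for i k
  define G where "G x = (\<Sum>i\<in>\<alpha>. w i (x i))" for x
  define S where "S = (\<Sum>i\<in>\<alpha>. \<Sum>k\<in>states N i. w i k * h (Node i k))"
  have inV: "i \<in> V" if "i \<in> \<alpha>" for i using that factor_sub[OF \<alpha>] by blast
  \<comment> \<open>The pairing with \<open>G\<close> depends on \<open>a\<close> only through its
    one-node marginals. Both \<open>h\<close> and \<open>bprod\<close> times \<open>G\<close> have
    the marginals of \<open>h\<close>, so both pair to \<open>S\<close>.\<close>
  have pair: "(\<Sum>x\<in>configs N \<alpha>. G x * a x) = S"
    if a: "\<And>i k. i \<in> \<alpha> \<Longrightarrow> k \<in> states N i \<Longrightarrow> (\<Sum>x\<in>fibre \<alpha> i k. a x) = h (Node i k)" for a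
  proof -
    have "(\<Sum>x\<in>configs N \<alpha>. G x * a x) = (\<Sum>i\<in>\<alpha>. \<Sum>x\<in>configs N \<alpha>. w i (x i) * a x)"
      unfolding G_def sum_distrib_right by (rule sum.swap)
    also have "\<dots> = S"
      unfolding S_def using a by (intro sum.cong refl) (simp add: sum_configs_fibres[OF \<alpha>])
    finally show ?thesis .
  qed
  have w_centered: "centered b i (w i)" if "i \<in> V" for i
  proof -
    have "b (Node i k) * w i k = h (Node i k)" if "k \<in> states N i" for k
      using mn_L_pos(2)[OF b \<open>i \<in> V\<close> that] by (simp add: w_def)
    then show ?thesis using h that by (simp add: centered_def mn_T_def)
  qed
  have hG: "(\<Sum>x\<in>configs N \<alpha>. G x * h (Factor \<alpha> x)) = S"
    using h \<alpha> by (intro pair) (simp add: mn_T_def)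
  have PG: "(\<Sum>x\<in>configs N \<alpha>. G x * (bprod \<alpha> x * G x)) = S"
  proof (rule pair)
    fix i k assume i: "i \<in> \<alpha>" and k: "k \<in> states N i"
    have "(\<Sum>x\<in>fibre \<alpha> i k. bprod \<alpha> x * G x) =
        (\<Sum>j\<in>\<alpha>. \<Sum>x\<in>fibre \<alpha> i k. bprod \<alpha> x * w j (x j))"
      unfolding G_def sum_distrib_left by (rule sum.swap)
    also have "\<dots> = (\<Sum>x\<in>fibre \<alpha> i k. bprod \<alpha> x * w i (x i)) +
        (\<Sum>j\<in>\<alpha> - {i}. \<Sum>x\<in>fibre \<alpha> i k. bprod \<alpha> x * w j (x j))"
      by (rule sum.remove[OF finite_factor[OF \<alpha>] i])
    also have "(\<Sum>j\<in>\<alpha> - {i}. \<Sum>x\<in>fibre \<alpha> i k. bprod \<alpha> x * w j (x j)) = 0"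
      using w_centered inV by (intro sum.neutral) (simp add: bprod_cond[OF \<alpha> i k])
    also have "(\<Sum>x\<in>fibre \<alpha> i k. bprod \<alpha> x * w i (x i)) = b (Node i k) * w i k"
      unfolding bprod_node[OF \<alpha> i k, symmetric] sum_distrib_right by (intro sum.cong) auto
    also have "b (Node i k) * w i k = h (Node i k)"
      using mn_L_pos(2)[OF b inV[OF i] k] by (simp add: w_def)
    finally show "(\<Sum>x\<in>fibre \<alpha> i k. bprod \<alpha> x * G x) = h (Node i k)" by simp
  qed
  have "0 \<le> (\<Sum>x\<in>configs N \<alpha>. bprod \<alpha> x * (h (Factor \<alpha> x) / bprod \<alpha> x - G x)\<^sup>2)"
    using bprod_pos[OF \<alpha>] by (intro sum_nonneg) (simp add: less_imp_le)
  also have "\<dots> = (\<Sum>x\<in>configs N \<alpha>. h (Factor \<alpha> x) * h (Factor \<alpha> x) / bprod \<alpha> x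
      - 2 * (G x * h (Factor \<alpha> x)) + G x * (bprod \<alpha> x * G x))"
  proof (intro sum.cong refl)
    fix x assume "x \<in> configs N \<alpha>"
    then have "bprod \<alpha> x > 0" using bprod_pos[OF \<alpha>] by simp
    then show "bprod \<alpha> x * (h (Factor \<alpha> x) / bprod \<alpha> x - G x)\<^sup>2 =
        h (Factor \<alpha> x) * h (Factor \<alpha> x) / bprod \<alpha> x - 2 * (G x * h (Factor \<alpha> x)) + G x * (bprod \<alpha> x * G x)"
      by (simp add: power2_eq_square field_simps del: prod_pos)
  qed
  also have "\<dots> = (\<Sum>x\<in>configs N \<alpha>. h (Factor \<alpha> x) * h (Factor \<alpha> x) / bprod \<alpha> x) - 2 * S + S"
    unfolding sum.distrib sum_subtractf sum_distrib_left[symmetric] hG PG ..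
  finally have "S \<le> (\<Sum>x\<in>configs N \<alpha>. h (Factor \<alpha> x) * h (Factor \<alpha> x) / bprod \<alpha> x)" by simp
  then show ?thesis by (simp add: S_def w_def)
qed

text \<open>The negative part, d_i copies of \<open>S i\<close>, is distributed over the factors
  through \<open>i\<close>, where Bessel's inequality absorbs it; one copy of each
  \<open>S i\<close> remains. If the node components of \<open>h\<close> vanish, strictness comes
  from a factor instead.\<close>

lemma mn_hess_product_pos:
  assumes h: "h \<in> mn_T V F N" "h \<noteq> (\<lambda>c. 0)"
  shows "0 < mn_hess V F N (mn_path b 0) h h"
proof -
  define S where "S i = (\<Sum>k\<in>states N i. h (Node i k) * h (Node i k) / b (Node i k))" for i
  define R where "R \<alpha> = (\<Sum>x\<in>configs N \<alpha>. h (Factor \<alpha> x) * h (Factor \<alpha> x) / bprod \<alpha> x)" for \<alpha>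
  have S0: "0 \<le> S i" if "i \<in> V" for i
    unfolding S_def using mn_L_pos(2)[OF b that] by (intro sum_nonneg) (simp add: less_imp_le)
  have eq: "mn_hess V F N (mn_path b 0) h h = (\<Sum>\<alpha>\<in>F. R \<alpha>) + (\<Sum>i\<in>V. (1 - real (degree_of F i)) * S i)"
    by (simp add: mn_hess_def R_def S_def mn_path_Factor)
  also have "\<dots> = (\<Sum>\<alpha>\<in>F. R \<alpha> - (\<Sum>i\<in>\<alpha>. S i)) + (\<Sum>i\<in>V. S i)"
    by (simp add: sum_subtractf sum_over_factors_eq_degree_sum[OF hyp] left_diff_distrib)
  finally have eq: "mn_hess V F N (mn_path b 0) h h = (\<Sum>\<alpha>\<in>F. R \<alpha> - (\<Sum>i\<in>\<alpha>. S i)) + (\<Sum>i\<in>V. S i)" .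
  have diff0: "0 \<le> R \<alpha> - (\<Sum>i\<in>\<alpha>. S i)" if "\<alpha> \<in> F" for \<alpha>
    using bessel_factor[OF h(1) that] by (simp add: R_def S_def)
  show ?thesis
  proof (cases "\<exists>i k. i \<in> V \<and> k \<in> states N i \<and> h (Node i k) \<noteq> 0")
    case True
    then obtain i k where ik: "i \<in> V" "k \<in> states N i" "h (Node i k) \<noteq> 0" by blast
    have "0 < S i" unfolding S_def
      using mn_L_pos(2)[OF b ik(1)] ik by (intro sum_pos2[of _ k]) (auto simp: less_imp_le zero_less_mult_iff linorder_neq_iff)
    then have "0 < (\<Sum>i\<in>V. S i)" using ik(1) finite_V S0 by (intro sum_pos2[of _ i]) auto
    then show ?thesis unfolding eq using diff0 by (intro add_nonneg_pos sum_nonneg) auto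
  next
    case False
    then have S: "S i = 0" if "i \<in> V" for i using that by (simp add: S_def)
    obtain c where c: "h c \<noteq> 0" using h(2) by auto
    then have "c \<in> mn_coords V F N" using h(1) by (auto simp: mn_T_def)
    then obtain \<alpha> x where \<alpha>: "\<alpha> \<in> F" "x \<in> configs N \<alpha>" "h (Factor \<alpha> x) \<noteq> 0"
      using c False by (auto simp: mn_coords_def)
    have "0 < R \<alpha>" unfolding R_def
      using bprod_pos[OF \<alpha>(1)] \<alpha>
      by (intro sum_pos2[of _ x]) (auto simp: less_imp_le zero_less_mult_iff linorder_neq_iff)
    moreover have "(\<Sum>i\<in>\<alpha>. S i) = 0"
      using S factor_sub[OF \<alpha>(1)] by (intro sum.neutral) auto
    ultimately have "0 < (\<Sum>\<alpha>\<in>F. R \<alpha> - (\<Sum>i\<in>\<alpha>. S i))"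
      using \<alpha>(1) finite_F diff0 by (intro sum_pos2[of _ \<alpha>]) auto
    then show ?thesis unfolding eq using S0 by (intro add_pos_nonneg sum_nonneg) auto
  qed
qed

lemma continuous_mn_hess_path:
  "continuous_on ({0..1} \<times> UNIV) (\<lambda>(t, h). mn_hess V F N (mn_path b t) h h)"
proof -
  have nz: "(1 - fst p) * bprod \<alpha> x + fst p * b (Factor \<alpha> x) \<noteq> 0"
    if "\<alpha> \<in> F" "x \<in> configs N \<alpha>" "p \<in> {0..1} \<times> UNIV" for \<alpha> x and p :: "real \<times> ('v mn_coord \<Rightarrow> real)"
    using mn_L_pos(1)[OF mn_path_in_L, of "fst p" \<alpha> x] that by (auto simp: mn_path_Factor)
  have nz': "b (Node i k) \<noteq> 0" if "i \<in> V" "k \<in> states N i" for i k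
    using mn_L_pos(2)[OF b that] by simp
  have "continuous_on ({0..1} \<times> UNIV) (\<lambda>p.
     (\<Sum>\<alpha>\<in>F. \<Sum>x\<in>configs N \<alpha>. snd p (Factor \<alpha> x) * snd p (Factor \<alpha> x) /
        ((1 - fst p) * bprod \<alpha> x + fst p * b (Factor \<alpha> x))) +
     (\<Sum>i\<in>V. (1 - real (degree_of F i)) *
        (\<Sum>l\<in>states N i. snd p (Node i l) * snd p (Node i l) / b (Node i l))))"
    by (intro continuous_intros continuous_on_product_then_coordinatewise[OF continuous_on_snd] nz nz' ballI)
  then show ?thesis
    by (simp add: mn_hess_def mn_path_Factor case_prod_beta)
qed

lemma mn_hess_pos:
  fixes n :: "'v \<Rightarrow> (nat \<Rightarrow> real) \<Rightarrow> real"
  assumes n_nonneg: "\<And>i f. i \<in> V \<Longrightarrow> 0 \<le> n i f"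
    and n_add: "\<And>i f g. i \<in> V \<Longrightarrow> n i (\<lambda>k. f k + g k) \<le> n i f + n i g"
    and n_scale: "\<And>i f a. i \<in> V \<Longrightarrow> n i (\<lambda>k. a * f k) = \<bar>a\<bar> * n i f"
    and n_cong: "\<And>i f g. i \<in> V \<Longrightarrow> (\<And>k. k \<in> states N i \<Longrightarrow> f k = g k) \<Longrightarrow> n i f = n i g"
    and n_definite: "\<And>i f k. i \<in> V \<Longrightarrow> centered b i f \<Longrightarrow> n i f = 0 \<Longrightarrow> k \<in> states N i \<Longrightarrow> f k = 0"
    and n_contr: "\<And>\<alpha> i j f. \<alpha> \<in> F \<Longrightarrow> i \<in> \<alpha> \<Longrightarrow> j \<in> \<alpha> \<Longrightarrow> i \<noteq> j \<Longrightarrow> centered b j f \<Longrightarrow>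
      n i (cond b \<alpha> i j f) \<le> c * n j f"
    and c: "0 \<le> c" "c * rho F < 1"
    and h: "h \<in> mn_T V F N" "h \<noteq> (\<lambda>c. 0)"
  shows "0 < mn_hess V F N b h h"
proof -
  have "0 < mn_hess V F N (mn_path b 1) h h"
  proof (rule pos_def_homotopy[where Q = "\<lambda>t. mn_hess V F N (mn_path b t)", OF finite_mn_coords closed_mn_T])
    show "h c = 0" if "h \<in> mn_T V F N" "c \<notin> mn_coords V F N" for h c
      using that by (simp add: mn_T_def)
    fix t :: real and h assume t: "t \<in> {0..1}" and h: "h \<in> mn_T V F N"
      and null: "\<And>k. k \<in> mn_T V F N \<Longrightarrow> mn_hess V F N (mn_path b t) h k = 0"
    \<comment> \<open>The path does not move node beliefs, so being centered means the same at every
      parameter.\<close>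
    have cent: "centered (mn_path b t) i f = centered b i f" for i f by (simp add: centered_def)
    show "h = (\<lambda>c. 0)"
    proof (rule mn_hess_nondegenerate[where n = n and c = c, OF mn_path_in_L[OF t] h])
      show "mn_hess V F N (mn_path b t) h k = 0" if "k \<in> mn_T V F N" for k
        by (rule null[OF that])
      show "0 \<le> n i f" if "i \<in> V" for i f by (rule n_nonneg[OF that])
      show "n i (\<lambda>k. f k + g k) \<le> n i f + n i g" if "i \<in> V" for i f g by (rule n_add[OF that])
      show "n i f = n i g" if "i \<in> V" "\<And>k. k \<in> states N i \<Longrightarrow> f k = g k" for i f g
        by (rule n_cong[OF that])
      show "n i (\<lambda>k. 0) = 0" if "i \<in> V" for i
        using n_scale[OF that, of 0 "\<lambda>_. 0"] by simp
      show "f k = 0" if "i \<in> V" "centered (mn_path b t) i f" "n i f = 0" "k \<in> states N i" for i f k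
        using n_definite that cent by blast
      fix \<alpha> i j f
      assume \<alpha>: "\<alpha> \<in> F" "i \<in> \<alpha>" "j \<in> \<alpha>" "i \<noteq> j" "centered (mn_path b t) j f"
      then have i: "i \<in> V" and j: "j \<in> V" using factor_sub by blast+
      have "n i (cond (mn_path b t) \<alpha> i j f) = n i (\<lambda>k. t * cond b \<alpha> i j f k)"
        using \<alpha> cent by (intro n_cong[OF i] cond_mn_path) auto
      also have "\<dots> = t * n i (cond b \<alpha> i j f)" using t by (simp add: n_scale[OF i])
      also have "\<dots> \<le> 1 * (c * n j f)"
        using t \<alpha> cent n_nonneg[OF i] by (intro mult_mono n_contr) auto
      finally show "n i (cond (mn_path b t) \<alpha> i j f) \<le> c * n j f" by simp
    qed (rule c)+
  qed (rule h mn_T_linear mn_hess_sym mn_hess_linear continuous_mn_hess_path mn_hess_product_pos; assumption)+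
  then show ?thesis by (simp add: mn_path_1[OF b])
qed

end

end

text \<open>The maximum of a finite set turns strict pointwise bounds into one constant. Inserting 0
  covers the empty set; for \<open>r = 0\<close> the bound is infinite and the product is 0; a
  negative \<open>r\<close> would force a negative maximum.\<close>

lemma exists_common_rate:
  fixes r :: real
  assumes "finite S" "\<And>x. x \<in> S \<Longrightarrow> 0 \<le> x \<and> ereal x < inverse (ereal r)"
  obtains c where "0 \<le> c" "c * r < 1" "\<And>x. x \<in> S \<Longrightarrow> x \<le> c"
proof -
  let ?c = "Max (insert 0 S)"
  have mem: "?c \<in> insert 0 S" using assms(1) by (intro Max_in) auto
  have "?c * r < 1"
  proof (cases "?c \<in> S \<and> r \<noteq> 0")
    case True
    then have "0 \<le> ?c" "ereal ?c < inverse (ereal r)" using assms(2)[of ?c] by auto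
    then have "?c < 1 / r" using True by (simp add: inverse_eq_divide)
    moreover have "0 < r"
    proof (rule ccontr)
      assume "\<not> 0 < r"
      then have "1 / r \<le> 0" by (simp add: divide_nonneg_nonpos)
      then show False using \<open>0 \<le> ?c\<close> \<open>?c < 1 / r\<close> by linarith
    qed
    ultimately show ?thesis by (simp add: field_simps)
  next
    case False
    then show ?thesis using mem by auto
  qed
  moreover have "0 \<le> ?c" "x \<le> ?c" if "x \<in> S" for x
    using assms(1) that by (auto intro: Max_ge)
  moreover have "0 \<le> ?c" using assms(1) by (auto intro: Max_ge)
  ultimately show ?thesis using that by blast
qed

text \<open>The statistic has one indicator fewer than there are states, and the last state
  \<open>n\<close> is sent to the zero vector. Hence a function is linear in the statistic after
  subtraction of its value at \<open>n\<close>.\<close>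

lemma sum_indicator_diff:
  fixes f :: "nat \<Rightarrow> real"
  assumes "m \<in> {1..n}"
  shows "(\<Sum>l<n - 1. (if m = Suc l then 1 else 0) * (f (Suc l) - f n)) = f m - f n"
proof -
  obtain m' where m': "m = Suc m'" using assms by (cases m) auto
  have "(\<Sum>l<n - 1. (if m = Suc l then 1 else 0) * (f (Suc l) - f n)) =
      (\<Sum>l<n - 1. if l = m' then f (Suc l) - f n else 0)"
    by (intro sum.cong) (auto simp: m')
  also have "\<dots> = (if m' < n - 1 then f (Suc m') - f n else 0)"
    by (simp add: sum.delta)
  also have "\<dots> = f m - f n"
  proof (cases "m' < n - 1")
    case False
    then have "m = n" using assms m' by auto
    then show ?thesis using False by simp
  qed (simp add: m')
  finally show ?thesis .
qed

lemma mult_mat_zero_vec: "A \<in> carrier_mat m n \<Longrightarrow> A *\<^sub>v 0\<^sub>v n = (0\<^sub>v m :: real vec)"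
  by (intro eq_vecI) auto

section \<open>Correlation matrices and conditional expectations in whitened coordinates\<close>

context mn_family
begin

context
  fixes b :: "'v mn_coord \<Rightarrow> real"
  assumes b: "b \<in> mn_L V F N"
begin

lemma integral_mn_law:
  fixes f :: "('v \<Rightarrow> nat) \<Rightarrow> real"
  assumes "\<alpha> \<in> F"
  shows "(LINT x|mn_law N b \<alpha>. f x) = (\<Sum>x\<in>configs N \<alpha>. b (Factor \<alpha> x) * f x)"
  unfolding mn_law_def using mn_L_pos(1)[OF b assms] assms
  by (subst lebesgue_integral_point_measure_finite) (auto simp: less_imp_le)

definition mn_cov :: "'v set \<Rightarrow> 'v \<Rightarrow> 'v \<Rightarrow> real mat" where
  "mn_cov \<alpha> i j = Cov (mn_law N b \<alpha>) (mn_dim N i) (\<lambda>x. mn_stat N i (x i)) (mn_dim N j) (\<lambda>x. mn_stat N j (x j))"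

text \<open>The covariance matrix diag(p) - p p^T of the indicators. It involves the node belief
  only, so the whitening at a node is the same in all factors that contain it.\<close>

definition mn_var :: "'v \<Rightarrow> real mat" where
  "mn_var i = mat (mn_dim N i) (mn_dim N i) (\<lambda>(k, l).
     (if k = l then b (Node i (Suc k)) else 0) - b (Node i (Suc k)) * b (Node i (Suc l)))"

text \<open>For centered \<open>f\<close> the vector with entries p_k f(k) is the covariance of the
  statistic with \<open>f\<close>, that is Var theta if f is theta applied to the statistic plus a
  constant. The result is Var^(1/2) theta, the coordinates in which the variance of \<open>f\<close>
  is a squared length.\<close>

definition whiten :: "'v \<Rightarrow> (nat \<Rightarrow> real) \<Rightarrow> real vec" where
  "whiten i f = inv_sqrt_mat (mn_dim N i) (mn_var i) *\<^sub>v
     Matrix.vec (mn_dim N i) (\<lambda>k. b (Node i (Suc k)) * f (Suc k))"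

lemma mn_cov_carrier: "mn_cov \<alpha> i j \<in> carrier_mat (mn_dim N i) (mn_dim N j)"
  by (simp add: mn_cov_def Cov_def)

lemma sum_indicator_fibre:
  assumes "\<alpha> \<in> F"
  shows "(\<Sum>x\<in>configs N \<alpha>. b (Factor \<alpha> x) * ((if x i = k then 1 else 0) * f x)) =
    (\<Sum>x\<in>fibre \<alpha> i k. b (Factor \<alpha> x) * f x)"
  unfolding sum.inter_filter[OF finite_configs[OF assms]] by (intro sum.cong) auto

lemma mn_cov_entry:
  assumes "\<alpha> \<in> F" "k < mn_dim N i" "l < mn_dim N j"
  shows "mn_cov \<alpha> i j $$ (k, l) =
    (\<Sum>x\<in>configs N \<alpha>. b (Factor \<alpha> x) * ((if x i = Suc k then 1 else 0) * (if x j = Suc l then 1 else 0))) -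
    (\<Sum>x\<in>configs N \<alpha>. b (Factor \<alpha> x) * (if x i = Suc k then 1 else 0)) *
    (\<Sum>x\<in>configs N \<alpha>. b (Factor \<alpha> x) * (if x j = Suc l then 1 else 0))"
  using assms(2,3) by (simp add: mn_cov_def Cov_def mn_stat_def integral_mn_law[OF assms(1)] del: if_split)

lemma Suc_state: "k < mn_dim N i \<Longrightarrow> Suc k \<in> states N i"
  by (auto simp: mn_dim_def states_def)

lemma mn_cov_self:
  assumes "\<alpha> \<in> F" "i \<in> \<alpha>"
  shows "mn_cov \<alpha> i i = mn_var i"
proof (rule eq_matI)
  fix k l assume "k < dim_row (mn_var i)" "l < dim_col (mn_var i)"
  then have kl: "k < mn_dim N i" "l < mn_dim N i" by (auto simp: mn_var_def)
  have one: "(\<Sum>x\<in>configs N \<alpha>. b (Factor \<alpha> x) * (if x i = Suc k then 1 else 0)) = b (Node i (Suc k))"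
    if "k < mn_dim N i" for k
    using sum_indicator_fibre[OF assms(1), of i "Suc k" "\<lambda>_. 1"] mn_L_node[OF b assms Suc_state[OF that]] by simp
  have "(\<Sum>x\<in>configs N \<alpha>. b (Factor \<alpha> x) * ((if x i = Suc k then 1 else 0) * (if x i = Suc l then 1 else 0))) =
      (if k = l then b (Node i (Suc k)) else 0)"
  proof (cases "k = l")
    case True
    then show ?thesis using one[OF kl(1)] by (simp add: if_distrib cong: if_cong)
  next
    case False
    then show ?thesis by (auto intro!: sum.neutral)
  qed
  then show "mn_cov \<alpha> i i $$ (k, l) = mn_var i $$ (k, l)"
    using kl by (simp only: mn_cov_entry[OF assms(1) kl] one) (simp add: mn_var_def)
qed (auto simp: mn_var_def mn_cov_def Cov_def)

text \<open>Up to a constant, f(x_j) is the given vector applied to the statistic of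
  \<open>j\<close>, so the product is the covariance of the statistic of \<open>i\<close> with
  f(x_j). As \<open>f\<close> has mean zero, no product of means remains.\<close>

lemma mn_cov_mult:
  assumes \<alpha>: "\<alpha> \<in> F" and i: "i \<in> \<alpha>" and j: "j \<in> \<alpha>" and f: "centered b j f"
  shows "mn_cov \<alpha> i j *\<^sub>v Matrix.vec (mn_dim N j) (\<lambda>l. f (Suc l) - f (N j)) =
    Matrix.vec (mn_dim N i) (\<lambda>k. \<Sum>x\<in>fibre \<alpha> i (Suc k). b (Factor \<alpha> x) * f (x j))"
proof (rule eq_vecI)
  fix k assume "k < dim_vec (Matrix.vec (mn_dim N i) (\<lambda>k. \<Sum>x\<in>fibre \<alpha> i (Suc k). b (Factor \<alpha> x) * f (x j)))"
  then have k: "k < mn_dim N i" by simp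
  define E where "E g = (\<Sum>x\<in>configs N \<alpha>. b (Factor \<alpha> x) * g x)" for g
  define I where "I l = (\<lambda>x :: 'v \<Rightarrow> nat. if x j = Suc l then 1 else 0 :: real)" for l
  define J where "J = (\<lambda>x :: 'v \<Rightarrow> nat. if x i = Suc k then 1 else 0 :: real)"
  define \<theta> where "\<theta> l = f (Suc l) - f (N j)" for l
  have E_sum: "(\<Sum>l<mn_dim N j. E (\<lambda>x. u x * I l x) * \<theta> l) = E (\<lambda>x. u x * (f (x j) - f (N j)))" for u
  proof -
    have "(\<Sum>l<mn_dim N j. E (\<lambda>x. u x * I l x) * \<theta> l) =
        E (\<lambda>x. u x * (\<Sum>l<mn_dim N j. I l x * \<theta> l))"
      unfolding E_def sum_distrib_left sum_distrib_right by (subst sum.swap) (simp add: mult_ac)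
    also have "\<dots> = E (\<lambda>x. u x * (f (x j) - f (N j)))"
      unfolding E_def
    proof (intro sum.cong refl)
      fix x assume "x \<in> configs N \<alpha>"
      then have "x j \<in> {1..N j}" using configs_state[OF _ j] by (auto simp: states_def)
      from sum_indicator_diff[OF this, of f]
      show "b (Factor \<alpha> x) * (u x * (\<Sum>l<mn_dim N j. I l x * \<theta> l)) = b (Factor \<alpha> x) * (u x * (f (x j) - f (N j)))"
        by (simp add: I_def \<theta>_def mn_dim_def)
    qed
    finally show ?thesis .
  qed
  have E1: "E (\<lambda>x. f (N j)) = f (N j)"
    using b \<alpha> by (simp add: E_def mn_L_def flip: sum_distrib_right)
  have Ef: "E (\<lambda>x. f (x j)) = 0"
    using sum_configs_fibres[OF \<alpha> j, of f "\<lambda>x. b (Factor \<alpha> x)"] mn_L_node[OF b \<alpha> j] f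
    by (simp add: E_def centered_def mult.commute)
  have "vec_index (mn_cov \<alpha> i j *\<^sub>v Matrix.vec (mn_dim N j) (\<lambda>l. f (Suc l) - f (N j))) k =
      (\<Sum>l<mn_dim N j. mn_cov \<alpha> i j $$ (k, l) * \<theta> l)"
    using k mn_cov_carrier[of \<alpha> i j] by (simp add: scalar_prod_def lessThan_atLeast0 \<theta>_def)
  also have "\<dots> = (\<Sum>l<mn_dim N j. (E (\<lambda>x. J x * I l x) - E J * E (\<lambda>x. 1 * I l x)) * \<theta> l)"
    by (intro sum.cong refl) (simp only: lessThan_iff mn_cov_entry[OF \<alpha> k] E_def I_def J_def mult_1)
  also have "\<dots> = E (\<lambda>x. J x * (f (x j) - f (N j))) - E J * E (\<lambda>x. 1 * (f (x j) - f (N j)))"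
    unfolding left_diff_distrib sum_subtractf mult.assoc sum_distrib_left[symmetric] E_sum ..
  \<comment> \<open>The two contributions of \<open>f (N j)\<close> cancel, since a covariance does
    not see constants.\<close>
  also have "E (\<lambda>x. 1 * (f (x j) - f (N j))) = - f (N j)"
    using E1 Ef by (simp add: E_def right_diff_distrib sum_subtractf)
  also have "E (\<lambda>x. J x * (f (x j) - f (N j))) = E (\<lambda>x. J x * f (x j)) - E J * f (N j)"
    by (simp add: E_def right_diff_distrib sum_subtractf sum_distrib_right mult.assoc)
  finally show "vec_index (mn_cov \<alpha> i j *\<^sub>v Matrix.vec (mn_dim N j) (\<lambda>l. f (Suc l) - f (N j))) k =
      vec_index (Matrix.vec (mn_dim N i) (\<lambda>k. \<Sum>x\<in>fibre \<alpha> i (Suc k). b (Factor \<alpha> x) * f (x j))) k"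
    using k by (simp add: E_def J_def sum_indicator_fibre[OF \<alpha>])
qed (use mn_cov_carrier[of \<alpha> i j] in auto)

lemma states_split:
  assumes "i \<in> V"
  shows "(\<Sum>k\<in>states N i. g k) = (\<Sum>k<mn_dim N i. g (Suc k)) + (g (N i) :: real)"
proof -
  obtain m where m: "N i = Suc m" using N_pos[OF assms] by (cases "N i") auto
  have "(\<Sum>k\<in>states N i. g k) = (\<Sum>k\<in>{Suc 0..<Suc (Suc m)}. g k)"
    by (intro sum.cong) (auto simp: states_def m)
  also have "\<dots> = (\<Sum>k\<in>{0..<Suc m}. g (Suc k))" by (rule sum.shift_bounds_Suc_ivl)
  finally show ?thesis by (simp add: mn_dim_def m lessThan_atLeast0)
qed

text \<open>The form is sum p u^2 - (sum p u)^2. Cauchy-Schwarz bounds the second term by the first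
  times sum p, and this mass is strictly below 1 because the omitted last state has positive
  probability.\<close>

lemma mn_var_pos_def:
  assumes i: "i \<in> V"
  shows "pos_def_mat (mn_dim N i) (mn_var i)"
  unfolding pos_def_mat_def
proof (intro conjI ballI impI)
  show "mn_var i \<in> carrier_mat (mn_dim N i) (mn_dim N i)" by (simp add: mn_var_def)
  show "transpose_mat (mn_var i) = mn_var i"
    by (intro eq_matI) (auto simp: mn_var_def)
  fix v :: "real vec" assume v: "v \<in> carrier_vec (mn_dim N i)" "v \<noteq> 0\<^sub>v (mn_dim N i)"
  define p where "p k = b (Node i (Suc k))" for k
  define u where "u k = vec_index v k" for k
  have p: "0 < p k" if "k < mn_dim N i" for k
    using mn_L_pos(2)[OF b i Suc_state[OF that]] by (simp add: p_def)
  have "0 < b (Node i (N i))" using mn_L_pos(2)[OF b i] N_pos[OF i] by (simp add: states_def)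
  then have S: "(\<Sum>k<mn_dim N i. p k) < 1"
    using states_split[OF i, of "\<lambda>k. b (Node i k)"] b i by (simp add: mn_L_def p_def)
  obtain k where k: "k < mn_dim N i" "u k \<noteq> 0"
    using v by (metis carrier_vecD eq_vecI index_zero_vec u_def)
  have W: "0 < (\<Sum>k<mn_dim N i. p k * (u k)\<^sup>2)"
    using k p by (intro sum_pos2[of _ k]) (auto simp: less_imp_le)
  have "(\<Sum>k<mn_dim N i. sqrt (p k) * (sqrt (p k) * u k))\<^sup>2 \<le>
      (\<Sum>k<mn_dim N i. (sqrt (p k))\<^sup>2) * (\<Sum>k<mn_dim N i. (sqrt (p k) * u k)\<^sup>2)"
    by (rule Cauchy_Schwarz_ineq_sum)
  moreover have "sqrt (p k) * (sqrt (p k) * u k) = p k * u k" "(sqrt (p k))\<^sup>2 = p k"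
    "(sqrt (p k) * u k)\<^sup>2 = p k * (u k)\<^sup>2" if "k < mn_dim N i" for k
    using p[OF that] by (auto simp: power_mult_distrib simp flip: mult.assoc)
  ultimately have "(\<Sum>k<mn_dim N i. p k * u k)\<^sup>2 \<le>
      (\<Sum>k<mn_dim N i. p k) * (\<Sum>k<mn_dim N i. p k * (u k)\<^sup>2)"
    by simp
  also have "\<dots> < (\<Sum>k<mn_dim N i. p k * (u k)\<^sup>2)"
    using S W by simp
  finally have CS: "(\<Sum>k<mn_dim N i. p k * u k)\<^sup>2 < (\<Sum>k<mn_dim N i. p k * (u k)\<^sup>2)" .
  have "scalar_prod v (mn_var i *\<^sub>v v) =
      (\<Sum>k<mn_dim N i. \<Sum>l<mn_dim N i. u k * ((if k = l then p k else 0) - p k * p l) * u l)"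
    unfolding p_def u_def by (subst scalar_prod_mult_mat_vec_sum[OF _ v(1) v(1)]) (auto simp: mn_var_def)
  also have "\<dots> = (\<Sum>k<mn_dim N i. \<Sum>l<mn_dim N i. (if k = l then p k * (u k)\<^sup>2 else 0) - (p k * u k) * (p l * u l))"
    by (intro sum.cong refl) (auto simp: algebra_simps power2_eq_square)
  also have "\<dots> = (\<Sum>k<mn_dim N i. p k * (u k)\<^sup>2) - (\<Sum>k<mn_dim N i. p k * u k)\<^sup>2"
    by (simp add: sum_subtractf sum.delta power2_eq_square sum_product)
  finally show "0 < scalar_prod v (mn_var i *\<^sub>v v)" using CS by simp
qed

lemma inv_sqrt_mn_var_carrier:
  "i \<in> V \<Longrightarrow> inv_sqrt_mat (mn_dim N i) (mn_var i) \<in> carrier_mat (mn_dim N i) (mn_dim N i)"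
  using inv_sqrt_mat_pos_def[OF mn_var_pos_def] unfolding pos_def_mat_def by blast

lemma whiten_carrier: "i \<in> V \<Longrightarrow> whiten i f \<in> carrier_vec (mn_dim N i)"
  unfolding whiten_def by (rule mult_mat_vec_carrier[OF inv_sqrt_mn_var_carrier]) auto

text \<open>The inverse square root on the right of the correlation matrix and the one inside
  \<open>whiten\<close> combine to the inverse variance, which recovers the coefficients of
  \<open>f\<close> in the statistic; the covariance then yields the conditional expectation times
  the node belief. So operator norms of correlation matrices bound conditional expectations.\<close>

lemma whiten_corr:
  assumes \<alpha>: "\<alpha> \<in> F" and i: "i \<in> \<alpha>" and j: "j \<in> \<alpha>" and f: "centered b j f"
  shows "mn_corr N b \<alpha> i j *\<^sub>v whiten j f = whiten i (cond b \<alpha> i j f)"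
proof -
  have iV: "i \<in> V" and jV: "j \<in> V" using factor_sub[OF \<alpha>] i j by auto
  let ?Bi = "inv_sqrt_mat (mn_dim N i) (mn_var i)" and ?Bj = "inv_sqrt_mat (mn_dim N j) (mn_var j)"
  let ?a = "Matrix.vec (mn_dim N j) (\<lambda>k. b (Node j (Suc k)) * f (Suc k))"
  let ?\<theta> = "Matrix.vec (mn_dim N j) (\<lambda>l. f (Suc l) - f (N j))"
  have Bi: "?Bi \<in> carrier_mat (mn_dim N i) (mn_dim N i)" and Bj: "?Bj \<in> carrier_mat (mn_dim N j) (mn_dim N j)"
    by (rule inv_sqrt_mn_var_carrier[OF iV], rule inv_sqrt_mn_var_carrier[OF jV])
  have Vj: "mn_var j \<in> carrier_mat (mn_dim N j) (mn_dim N j)" by (simp add: mn_var_def)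
  note C = mn_cov_carrier[of \<alpha> i j]
  have corr: "mn_corr N b \<alpha> i j = ?Bi * mn_cov \<alpha> i j * ?Bj"
    unfolding mn_corr_def Corr_def mn_cov_def[symmetric] mn_cov_self[OF \<alpha> i] mn_cov_self[OF \<alpha> j] ..
  \<comment> \<open>The case \<open>i = j\<close> of \<open>mn_cov_mult\<close>: on a fibre of
    \<open>j\<close> itself, f(x_j) is constant.\<close>
  have Va: "mn_var j *\<^sub>v ?\<theta> = ?a"
  proof -
    have "(\<Sum>x\<in>fibre \<alpha> j (Suc k). b (Factor \<alpha> x) * f (x j)) = b (Node j (Suc k)) * f (Suc k)"
      if "k < mn_dim N j" for k
      unfolding mn_L_node[OF b \<alpha> j Suc_state[OF that], symmetric] sum_distrib_right
      by (intro sum.cong) auto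
    then have "Matrix.vec (mn_dim N j) (\<lambda>k. \<Sum>x\<in>fibre \<alpha> j (Suc k). b (Factor \<alpha> x) * f (x j)) = ?a"
      by (intro eq_vecI) simp_all
    then show ?thesis
      using mn_cov_mult[OF \<alpha> j j f] mn_cov_self[OF \<alpha> j] by simp
  qed
  have BBV: "?Bj *\<^sub>v (?Bj *\<^sub>v ?a) = ?\<theta>"
  proof -
    have "?Bj *\<^sub>v (?Bj *\<^sub>v (mn_var j *\<^sub>v ?\<theta>)) = (?Bj * ?Bj * mn_var j) *\<^sub>v ?\<theta>"
      using Bj Vj by (simp add: assoc_mult_mat_vec[of _ "mn_dim N j" "mn_dim N j" _ "mn_dim N j"])
    then show ?thesis
      unfolding inv_sqrt_mat_left[OF mn_var_pos_def[OF jV]] Va by simp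
  qed
  have "mn_corr N b \<alpha> i j *\<^sub>v whiten j f = (?Bi * mn_cov \<alpha> i j) *\<^sub>v (?Bj *\<^sub>v (?Bj *\<^sub>v ?a))"
    unfolding corr whiten_def by (rule assoc_mult_mat_vec[OF mult_carrier_mat[OF Bi C] Bj]) (use Bj in simp)
  also have "\<dots> = ?Bi *\<^sub>v (mn_cov \<alpha> i j *\<^sub>v ?\<theta>)"
    unfolding BBV by (rule assoc_mult_mat_vec[OF Bi C]) simp
  also have "\<dots> = whiten i (cond b \<alpha> i j f)"
    unfolding mn_cov_mult[OF \<alpha> i j f] whiten_def
  proof (intro arg_cong2[where f = "(*\<^sub>v)"] refl eq_vecI)
    fix k assume "k < dim_vec (Matrix.vec (mn_dim N i) (\<lambda>k. b (Node i (Suc k)) * cond b \<alpha> i j f (Suc k)))"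
    then have k: "k < mn_dim N i" by simp
    show "vec_index (Matrix.vec (mn_dim N i) (\<lambda>k. \<Sum>x\<in>fibre \<alpha> i (Suc k). b (Factor \<alpha> x) * f (x j))) k =
        vec_index (Matrix.vec (mn_dim N i) (\<lambda>k. b (Node i (Suc k)) * cond b \<alpha> i j f (Suc k))) k"
      using k mn_L_pos(2)[OF b iV Suc_state[OF k]] by (simp add: cond_def)
  qed simp
  finally show ?thesis .
qed

text \<open>Invertibility of the whitening matrix kills the values at all states but the last, and
  the centering condition kills that one.\<close>

lemma whiten_definite:
  assumes i: "i \<in> V" and f: "centered b i f" and zero: "whiten i f = 0\<^sub>v (mn_dim N i)" and k: "k \<in> states N i"
  shows "f k = 0"
proof -
  let ?B = "inv_sqrt_mat (mn_dim N i) (mn_var i)"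
  let ?a = "Matrix.vec (mn_dim N i) (\<lambda>k. b (Node i (Suc k)) * f (Suc k))"
  have B: "?B \<in> carrier_mat (mn_dim N i) (mn_dim N i)"
    by (rule inv_sqrt_mn_var_carrier[OF i])
  have V: "mn_var i \<in> carrier_mat (mn_dim N i) (mn_dim N i)" by (simp add: mn_var_def)
  have "?a = (mn_var i * (?B * ?B)) *\<^sub>v ?a"
    unfolding inv_sqrt_mat_right[OF mn_var_pos_def[OF i]] by simp
  also have "\<dots> = mn_var i *\<^sub>v (?B *\<^sub>v whiten i f)"
    using B V by (simp add: whiten_def assoc_mult_mat_vec[of _ "mn_dim N i" "mn_dim N i" _ "mn_dim N i"])
  also have "\<dots> = 0\<^sub>v (mn_dim N i)"
    unfolding zero mult_mat_zero_vec[OF B] by (rule mult_mat_zero_vec[OF V])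
  finally have a: "?a = 0\<^sub>v (mn_dim N i)" .
  have below: "f (Suc k) = 0" if "k < mn_dim N i" for k
    using arg_cong[OF a, of "\<lambda>v. vec_index v k"] that mn_L_pos(2)[OF b i Suc_state[OF that]] by simp
  have "b (Node i (N i)) * f (N i) = 0"
    using f below by (simp add: centered_def states_split[OF i])
  moreover have "0 < b (Node i (N i))" using mn_L_pos(2)[OF b i] N_pos[OF i] by (simp add: states_def)
  ultimately have top: "f (N i) = 0" by simp
  show ?thesis
  proof (cases "k = N i")
    case False
    then obtain k' where "k = Suc k'" "k' < mn_dim N i"
      using k by (cases k) (auto simp: states_def mn_dim_def)
    then show ?thesis using below by simp
  qed (simp add: top)
qed

text \<open>The seminorm of a function is the given norm of its whitened coordinates, and the
  contraction constant is the largest of the finitely many operator norms in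
  \<open>S\<close>.\<close>

lemma mn_hess_pos_of_corr:
  assumes norm: "\<And>i. i \<in> V \<Longrightarrow> is_norm (mn_dim N i) (\<nu> i)"
    and corr: "b \<in> mn_L_rho V F N \<nu>"
    and h: "h \<in> mn_T V F N" "h \<noteq> (\<lambda>c. 0)"
  shows "0 < mn_hess V F N b h h"
proof -
  define S where "S = (\<lambda>(\<alpha>, i, j). op_norm (\<nu> i) (\<nu> j) (mn_corr N b \<alpha> i j)) `
    {(\<alpha>, i, j). \<alpha> \<in> F \<and> i \<in> \<alpha> \<and> j \<in> \<alpha> \<and> i \<noteq> j}"
  have corr_carrier: "mn_corr N b \<alpha> i j \<in> carrier_mat (mn_dim N i) (mn_dim N j)"
    if "\<alpha> \<in> F" "i \<in> \<alpha>" "j \<in> \<alpha>" for \<alpha> i j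
  proof -
    have V: "i \<in> V" "j \<in> V" using factor_sub that by auto
    show ?thesis
      unfolding mn_corr_def Corr_def mn_cov_def[symmetric] mn_cov_self[OF that(1,2)] mn_cov_self[OF that(1,3)]
      by (rule mult_carrier_mat[OF mult_carrier_mat[OF inv_sqrt_mn_var_carrier[OF V(1)] mn_cov_carrier] inv_sqrt_mn_var_carrier[OF V(2)]])
  qed
  have "finite S" unfolding S_def
    by (rule finite_imageI, rule finite_subset[of _ "F \<times> V \<times> V"])
      (use factor_sub finite_F finite_V in auto)
  moreover have "0 \<le> x \<and> ereal x < inverse (ereal (rho F))" if x: "x \<in> S" for x
  proof -
    obtain \<alpha> i j where \<alpha>: "\<alpha> \<in> F" "i \<in> \<alpha>" "j \<in> \<alpha>" "i \<noteq> j"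
      and x: "x = op_norm (\<nu> i) (\<nu> j) (mn_corr N b \<alpha> i j)"
      using x by (auto simp: S_def)
    have V: "i \<in> V" "j \<in> V" using factor_sub \<alpha> by auto
    show ?thesis unfolding x
      using op_norm_nonneg[OF corr_carrier[OF \<alpha>(1-3)] norm[OF V(1)] norm[OF V(2)]] corr \<alpha>
      unfolding mn_L_rho_def by blast
  qed
  ultimately obtain c where c: "0 \<le> c" "c * rho F < 1" "\<And>x. x \<in> S \<Longrightarrow> x \<le> c"
    using exists_common_rate by blast
  show ?thesis
  proof (rule mn_hess_pos[where n = "\<lambda>i f. \<nu> i (whiten i f)" and c = c, OF b _ _ _ _ _ _ c(1,2) h])
    fix i :: 'v and f g :: "nat \<Rightarrow> real" and a :: real assume i: "i \<in> V"
    show "0 \<le> \<nu> i (whiten i f)" using norm[OF i] whiten_carrier[OF i] by (simp add: is_norm_def)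
    have "whiten i (\<lambda>k. f k + g k) = whiten i f + whiten i g"
      unfolding whiten_def
      by (subst mult_add_distrib_mat_vec[OF inv_sqrt_mn_var_carrier[OF i], symmetric])
        (auto intro!: arg_cong2[where f = "(*\<^sub>v)"] simp: distrib_left)
    then show "\<nu> i (whiten i (\<lambda>k. f k + g k)) \<le> \<nu> i (whiten i f) + \<nu> i (whiten i g)"
      using is_norm_triangle[OF norm[OF i] whiten_carrier[OF i] whiten_carrier[OF i]] by simp
    have "whiten i (\<lambda>k. a * f k) = a \<cdot>\<^sub>v whiten i f"
      unfolding whiten_def
      by (subst mult_mat_vec[OF inv_sqrt_mn_var_carrier[OF i], symmetric])
        (auto intro!: arg_cong2[where f = "(*\<^sub>v)"])
    then show "\<nu> i (whiten i (\<lambda>k. a * f k)) = \<bar>a\<bar> * \<nu> i (whiten i f)"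
      using is_norm_smult[OF norm[OF i] whiten_carrier[OF i]] by simp
    show "\<nu> i (whiten i f) = \<nu> i (whiten i g)" if "\<And>k. k \<in> states N i \<Longrightarrow> f k = g k"
      using that Suc_state by (auto simp: whiten_def intro!: arg_cong[where f = "\<nu> i"] arg_cong2[where f = "(*\<^sub>v)"])
    show "f k = 0" if "centered b i f" "\<nu> i (whiten i f) = 0" "k \<in> states N i" for k
      using whiten_definite[OF i that(1) _ that(3)] that(2) norm[OF i] whiten_carrier[OF i, of f]
      by (simp add: is_norm_def)
  next
    fix \<alpha> i j f assume \<alpha>: "\<alpha> \<in> F" "i \<in> \<alpha>" "j \<in> \<alpha>" "i \<noteq> j" and f: "centered b j f"
    have iV: "i \<in> V" and jV: "j \<in> V" using factor_sub[OF \<alpha>(1)] \<alpha> by auto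
    have "\<nu> i (whiten i (cond b \<alpha> i j f)) \<le> op_norm (\<nu> i) (\<nu> j) (mn_corr N b \<alpha> i j) * \<nu> j (whiten j f)"
      unfolding whiten_corr[OF \<alpha>(1-3) f, symmetric]
      by (rule op_norm_bound[OF corr_carrier[OF \<alpha>(1-3)] norm[OF iV] norm[OF jV] whiten_carrier[OF jV]])
    also have "\<dots> \<le> c * \<nu> j (whiten j f)"
    proof (intro mult_right_mono c(3))
      show "op_norm (\<nu> i) (\<nu> j) (mn_corr N b \<alpha> i j) \<in> S"
        unfolding S_def by (rule image_eqI[of _ _ "(\<alpha>, i, j)"]) (use \<alpha> in auto)
      show "0 \<le> \<nu> j (whiten j f)" using norm[OF jV] whiten_carrier[OF jV] by (simp add: is_norm_def)
    qed
    finally show "\<nu> i (whiten i (cond b \<alpha> i j f)) \<le> c * \<nu> j (whiten j f)" .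
  qed
qed

end

end

lemma mn_hessian_pos_def:
  assumes hyp: "hypergraph V F" and N: "\<And>i. i \<in> V \<Longrightarrow> 1 \<le> N i"
    and norm: "\<And>i. i \<in> V \<Longrightarrow> is_norm (mn_dim N i) (\<nu> i)"
    and b: "b \<in> mn_L_rho V F N \<nu>"
  shows "hessian_pos_def (mn_L V F N) (mn_bethe V F N \<Psi>) b"
proof -
  interpret mn_family V F N by unfold_locales (use hyp N in auto)
  have L: "b \<in> mn_L V F N" using b by (simp add: mn_L_rho_def)
  show ?thesis
    unfolding hessian_pos_def_def pos_def_form_def tangent_dirs_mn_L[OF L]
    using has_hessian_mn_bethe[OF L] mn_hess_sym mn_hess_linear mn_hess_pos_of_corr[OF L norm b]
    by blast
qed

section \<open>The fixed-mean Gaussian family\<close>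

text \<open>The moments are taken about \<open>\<xi>\<close>, which differs from the mean by
  \<open>m\<close>. The polynomial is expanded in powers of the distance from the mean, where odd
  moments vanish and the even ones are 1, \<open>\<sigma>^2\<close> and
  \<open>3 * \<sigma>^4\<close>.\<close>

lemma normal_moments:
  assumes "0 < \<sigma>"
  shows "has_bochner_integral lborel
    (\<lambda>y. normal_density (\<xi> + m) \<sigma> y * (p0 + p2 * (y - \<xi>)^2 + p4 * (y - \<xi>)^4))
    (p0 + p2 * (\<sigma>^2 + m^2) + p4 * (3 * \<sigma>^4 + 6 * \<sigma>^2 * m^2 + m^4))"
proof -
  define M where "M = \<xi> + m"
  let ?N = "normal_density M \<sigma>"
  have m0: "has_bochner_integral lborel ?N 1"
    using normal_moment_even[OF assms, of M 0] by simp
  have m1: "has_bochner_integral lborel (\<lambda>y. ?N y * (y - M)) 0"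
    using normal_moment_odd[OF assms, of M 0] by simp
  have m2: "has_bochner_integral lborel (\<lambda>y. ?N y * (y - M)^2) (\<sigma>^2)"
  proof -
    have "fact (2 * 1) / ((2 / \<sigma>\<^sup>2)^1 * fact 1) = \<sigma>^2"
      using assms by (simp add: fact_numeral)
    then show ?thesis using normal_moment_even[OF assms, of M 1] by simp
  qed
  have m3: "has_bochner_integral lborel (\<lambda>y. ?N y * (y - M)^3) 0"
    using normal_moment_odd[OF assms, of M 1] by simp
  have m4: "has_bochner_integral lborel (\<lambda>y. ?N y * (y - M)^4) (3 * \<sigma>^4)"
  proof -
    have "fact (2 * 2) / ((2 / \<sigma>\<^sup>2)^2 * fact 2) = 3 * \<sigma>^4"
      using assms by (simp add: fact_numeral power_divide flip: power_mult)
    then show ?thesis using normal_moment_even[OF assms, of M 2] by simp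
  qed
  have "has_bochner_integral lborel
    (\<lambda>y. (p0 + p2 * m^2 + p4 * m^4) * ?N y + (2 * p2 * m + 4 * p4 * m^3) * (?N y * (y - M)) +
      (p2 + 6 * p4 * m^2) * (?N y * (y - M)^2) + (4 * p4 * m) * (?N y * (y - M)^3) + p4 * (?N y * (y - M)^4))
    ((p0 + p2 * m^2 + p4 * m^4) * 1 + (2 * p2 * m + 4 * p4 * m^3) * 0 +
      (p2 + 6 * p4 * m^2) * \<sigma>^2 + (4 * p4 * m) * 0 + p4 * (3 * \<sigma>^4))"
    by (intro has_bochner_integral_add has_bochner_integral_mult_right m0 m1 m2 m3 m4)
  moreover have "(p0 + p2 * m^2 + p4 * m^4) * ?N y + (2 * p2 * m + 4 * p4 * m^3) * (?N y * (y - M)) +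
      (p2 + 6 * p4 * m^2) * (?N y * (y - M)^2) + (4 * p4 * m) * (?N y * (y - M)^3) + p4 * (?N y * (y - M)^4) =
      ?N y * (p0 + p2 * (y - \<xi>)^2 + p4 * (y - \<xi>)^4)" for y
  proof -
    have "(p0 + p2 * m^2 + p4 * m^4) * t + (2 * p2 * m + 4 * p4 * m^3) * (t * z) +
      (p2 + 6 * p4 * m^2) * (t * z^2) + (4 * p4 * m) * (t * z^3) + p4 * (t * z^4) =
      t * (p0 + p2 * (z + m)^2 + p4 * (z + m)^4)" for t z :: real
    proof -
      have "(z + m)^4 = ((z + m)^2)^2" by simp
      also have "\<dots> = z^4 + 4 * z^3 * m + 6 * z^2 * m^2 + 4 * z * m^3 + m^4"
        unfolding power2_sum
        by (simp add: power2_eq_square power3_eq_cube power4_eq_xxxx distrib_left distrib_right mult_ac)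
      finally show ?thesis unfolding power2_sum by (simp add: algebra_simps)
    qed
    from this[of "?N y" "y - M"] show ?thesis by (simp add: M_def)
  qed
  moreover have "(p0 + p2 * m^2 + p4 * m^4) * 1 + (2 * p2 * m + 4 * p4 * m^3) * 0 +
      (p2 + 6 * p4 * m^2) * \<sigma>^2 + (4 * p4 * m) * 0 + p4 * (3 * \<sigma>^4) =
      p0 + p2 * (\<sigma>^2 + m^2) + p4 * (3 * \<sigma>^4 + 6 * \<sigma>^2 * m^2 + m^4)"
    by (simp add: algebra_simps)
  ultimately show ?thesis by (simp only: M_def)
qed

lemma nn_normal_moments:
  assumes "0 < \<sigma>" "0 \<le> p0" "0 \<le> p2" "0 \<le> p4"
  shows "(\<integral>\<^sup>+y. ennreal (normal_density (\<xi> + m) \<sigma> y * (p0 + p2 * (y - \<xi>)^2 + p4 * (y - \<xi>)^4)) \<partial>lborel) =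
    ennreal (p0 + p2 * (\<sigma>^2 + m^2) + p4 * (3 * \<sigma>^4 + 6 * \<sigma>^2 * m^2 + m^4))"
proof -
  have h: "has_bochner_integral lborel
    (\<lambda>y. normal_density (\<xi> + m) \<sigma> y * (p0 + p2 * (y - \<xi>)^2 + p4 * (y - \<xi>)^4))
    (p0 + p2 * (\<sigma>^2 + m^2) + p4 * (3 * \<sigma>^4 + 6 * \<sigma>^2 * m^2 + m^4))"
    by (rule normal_moments[OF assms(1)])
  have "0 \<le> normal_density (\<xi> + m) \<sigma> y * (p0 + p2 * (y - \<xi>)^2 + p4 * (y - \<xi>)^4)" for y
    using assms by (intro mult_nonneg_nonneg add_nonneg_nonneg) auto
  then show ?thesis
    using nn_integral_eq_integral[OF integrable.intros[OF h]] has_bochner_integral_integral_eq[OF h]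
    by simp
qed

text \<open>Conditionally on the first coordinate \<open>x\<close>, the second one is normal with mean
  \<open>\<mu>\<^sub>j + (c / a) (x - \<mu>\<^sub>i)\<close> and variance \<open>(a d - c\<^sup>2) / a\<close>.\<close>

lemma bivariate_normal_density:
  fixes a c d :: real
  assumes a: "0 < a" and D: "0 < a * d - c\<^sup>2"
  shows "exp (- (d * X\<^sup>2 - 2 * c * X * (y - \<xi>) + a * (y - \<xi>)\<^sup>2) / (2 * (a * d - c\<^sup>2))) /
      (2 * pi * sqrt (a * d - c\<^sup>2)) =
    normal_density 0 (sqrt a) X * normal_density (\<xi> + c / a * X) (sqrt ((a * d - c\<^sup>2) / a)) y"
proof -
  define D where "D = a * d - c\<^sup>2"
  have D0: "0 < D" using assms by (simp add: D_def)
  have e: "- (d * X\<^sup>2 - 2 * c * X * (y - \<xi>) + a * (y - \<xi>)\<^sup>2) / (2 * D) =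
      - X\<^sup>2 / (2 * a) + - (y - (\<xi> + c / a * X))\<^sup>2 / (2 * (D / a))"
  proof -
    have "d = (D + c\<^sup>2) / a" using a by (simp add: D_def)
    then show ?thesis using a D0 by (simp add: divide_simps) (simp add: algebra_simps power2_eq_square)
  qed
  have "2 * pi * sqrt D = sqrt (2 * pi * a) * sqrt (2 * pi * (D / a))"
  proof -
    have "sqrt (2 * pi * a) * sqrt (2 * pi * (D / a)) = sqrt ((2 * pi)\<^sup>2 * D)"
      using a by (simp add: real_sqrt_mult[symmetric] power2_eq_square)
    then show ?thesis by (simp add: real_sqrt_mult)
  qed
  then show ?thesis
    unfolding D_def[symmetric] e exp_add normal_density_def using a D0 by simp
qed

text \<open>Tonelli: for nonnegative \<open>G\<close> the double integral can be iterated without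
  prior integrability. The inner integral is over a normal law of variance \<open>s\<close> whose
  mean is shifted by \<open>k\<close> times the deviation of \<open>x\<close>; hypothesis
  \<open>q\<close> says that its value is again an even quartic, so the same moment formula
  evaluates the outer one.\<close>

lemma integral_ga_law:
  fixes G :: "real \<times> real \<Rightarrow> real"
  assumes a: "0 < \<eta> (Diag i)" and D: "0 < \<eta> (Diag i) * \<eta> (Diag j) - (\<eta> (Off {i, j}))\<^sup>2"
    and s: "s = (\<eta> (Diag i) * \<eta> (Diag j) - (\<eta> (Off {i, j}))\<^sup>2) / \<eta> (Diag i)"
    and k: "k = \<eta> (Off {i, j}) / \<eta> (Diag i)"
    and G: "G \<in> borel_measurable borel"
      "\<And>x y. G (x, y) = p0 x + p2 x * (y - \<mu> j)^2 + p4 x * (y - \<mu> j)^4"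
      "\<And>x. 0 \<le> p0 x" "\<And>x. 0 \<le> p2 x" "\<And>x. 0 \<le> p4 x"
    and q: "\<And>x. p0 x + p2 x * (s + (k * (x - \<mu> i))\<^sup>2) +
        p4 x * (3 * s^2 + 6 * s * (k * (x - \<mu> i))\<^sup>2 + (k * (x - \<mu> i))^4) =
      A0 + A2 * (x - \<mu> i)^2 + A4 * (x - \<mu> i)^4" "0 \<le> A0" "0 \<le> A2" "0 \<le> A4"
  shows "(LINT w|ga_law \<mu> \<eta> i j. G w) = A0 + A2 * \<eta> (Diag i) + A4 * (3 * (\<eta> (Diag i))^2)"
proof -
  define a where "a = \<eta> (Diag i)"
  define d where "d = \<eta> (Diag j)"
  define c where "c = \<eta> (Off {i, j})"
  have a0: "0 < a" and D0: "0 < a * d - c\<^sup>2" using a D by (auto simp: a_def d_def c_def)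
  have s0: "0 < s" and s': "s = (a * d - c\<^sup>2) / a" and k': "k = c / a"
    using a0 D0 s k by (auto simp: a_def d_def c_def)
  define f where "f = (\<lambda>(x, y). exp (- (d * (x - \<mu> i)\<^sup>2 - 2 * c * (x - \<mu> i) * (y - \<mu> j) + a * (y - \<mu> j)\<^sup>2) /
      (2 * (a * d - c\<^sup>2))) / (2 * pi * sqrt (a * d - c\<^sup>2)))"
  have law: "ga_law \<mu> \<eta> i j = density lborel (\<lambda>w. ennreal (f w))"
    unfolding ga_law_def Let_def f_def a_def d_def c_def
    by (rule arg_cong[where f = "density lborel"]) (simp only: fun_eq_iff split_paired_All case_prod_conv simp_thms)
  have f_eq: "f (x, y) = normal_density 0 (sqrt a) (x - \<mu> i) * normal_density (\<mu> j + k * (x - \<mu> i)) (sqrt s) y" for x y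
    unfolding f_def case_prod_conv bivariate_normal_density[OF a0 D0] s' k' ..
  have f_meas: "f \<in> borel_measurable borel"
    unfolding f_def borel_prod[symmetric] by measurable
  have f0: "0 \<le> f w" for w by (cases w) (simp add: f_eq)
  have G0: "0 \<le> G w" for w by (cases w) (simp add: G(2-5))
  have meas: "(\<lambda>w. ennreal (f w * G w)) \<in> borel_measurable (lborel \<Otimes>\<^sub>M lborel)"
    using f_meas G(1) unfolding lborel_prod by measurable
  have "(\<integral>\<^sup>+w. ennreal (f w * G w) \<partial>lborel) = (\<integral>\<^sup>+w. ennreal (f w * G w) \<partial>(lborel \<Otimes>\<^sub>M lborel))"
    by (simp only: lborel_prod)
  also have "\<dots> = (\<integral>\<^sup>+x. \<integral>\<^sup>+y. ennreal (f (x, y) * G (x, y)) \<partial>lborel \<partial>lborel)"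
    by (rule lborel.nn_integral_fst[OF meas, symmetric])
  also have "\<dots> = (\<integral>\<^sup>+x. ennreal (normal_density (\<mu> i + 0) (sqrt a) x *
      (A0 + A2 * (x - \<mu> i)^2 + A4 * (x - \<mu> i)^4)) \<partial>lborel)"
  proof (rule nn_integral_cong)
    fix x
    have "(\<integral>\<^sup>+y. ennreal (f (x, y) * G (x, y)) \<partial>lborel) =
        (\<integral>\<^sup>+y. ennreal (normal_density 0 (sqrt a) (x - \<mu> i)) *
          ennreal (normal_density (\<mu> j + k * (x - \<mu> i)) (sqrt s) y * (p0 x + p2 x * (y - \<mu> j)^2 + p4 x * (y - \<mu> j)^4)) \<partial>lborel)"
      by (simp add: f_eq G(2) mult.assoc flip: ennreal_mult')
    also have "\<dots> = ennreal (normal_density 0 (sqrt a) (x - \<mu> i)) *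
        ennreal (p0 x + p2 x * ((sqrt s)^2 + (k * (x - \<mu> i))^2) +
          p4 x * (3 * (sqrt s)^4 + 6 * (sqrt s)^2 * (k * (x - \<mu> i))^2 + (k * (x - \<mu> i))^4))"
      using s0 G(3-5) by (subst nn_integral_cmult) (auto simp: nn_normal_moments)
    also have "(sqrt s)^4 = s^2" using s0 by (simp add: power4_eq_xxxx power2_eq_square)
    also have "(sqrt s)^2 = s" using s0 by simp
    also note q(1)
    also have "normal_density 0 (sqrt a) (x - \<mu> i) = normal_density (\<mu> i + 0) (sqrt a) x"
      by (simp add: normal_density_def)
    finally show "(\<integral>\<^sup>+y. ennreal (f (x, y) * G (x, y)) \<partial>lborel) = ennreal (normal_density (\<mu> i + 0) (sqrt a) x *
        (A0 + A2 * (x - \<mu> i)^2 + A4 * (x - \<mu> i)^4))"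
      by (simp add: ennreal_mult')
  qed
  also have "\<dots> = ennreal (A0 + A2 * ((sqrt a)^2 + 0^2) + A4 * (3 * (sqrt a)^4 + 6 * (sqrt a)^2 * 0^2 + 0^4))"
    using a0 q by (intro nn_normal_moments) auto
  also have "A0 + A2 * ((sqrt a)^2 + 0^2) + A4 * (3 * (sqrt a)^4 + 6 * (sqrt a)^2 * 0^2 + 0^4) =
      A0 + A2 * a + A4 * (3 * a^2)"
  proof -
    have "(sqrt a)^4 = a^2" using a0 by (simp add: power4_eq_xxxx power2_eq_square)
    then show ?thesis using a0 by simp
  qed
  finally have nn: "(\<integral>\<^sup>+w. ennreal (f w * G w) \<partial>lborel) = ennreal (A0 + A2 * a + A4 * (3 * a^2))" .
  have "(LINT w|ga_law \<mu> \<eta> i j. G w) = (LINT w|lborel. f w * G w)"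
    unfolding law using f_meas G(1) f0 by (subst integral_density) auto
  also have "\<dots> = enn2real (\<integral>\<^sup>+w. ennreal (f w * G w) \<partial>lborel)"
    using f_meas G(1) f0 G0 by (intro integral_eq_nn_integral) auto
  also have "\<dots> = A0 + A2 * a + A4 * (3 * a^2)"
    unfolding nn using a0 q by (intro enn2real_ennreal) auto
  finally show ?thesis by (simp only: a_def)
qed

lemma ga_moments:
  assumes a: "0 < \<eta> (Diag i)" and D: "0 < \<eta> (Diag i) * \<eta> (Diag j) - (\<eta> (Off {i, j}))\<^sup>2"
  shows "(LINT w|ga_law \<mu> \<eta> i j. (fst w - \<mu> i)^2) = \<eta> (Diag i)"
    and "(LINT w|ga_law \<mu> \<eta> i j. (snd w - \<mu> j)^2) = \<eta> (Diag j)"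
    and "(LINT w|ga_law \<mu> \<eta> i j. (fst w - \<mu> i)^4) = 3 * (\<eta> (Diag i))^2"
    and "(LINT w|ga_law \<mu> \<eta> i j. (snd w - \<mu> j)^4) = 3 * (\<eta> (Diag j))^2"
    and "(LINT w|ga_law \<mu> \<eta> i j. (fst w - \<mu> i)^2 * (snd w - \<mu> j)^2) =
      \<eta> (Diag i) * \<eta> (Diag j) + 2 * (\<eta> (Off {i, j}))^2"
proof -
  define a where "a = \<eta> (Diag i)"
  define d where "d = \<eta> (Diag j)"
  define c where "c = \<eta> (Off {i, j})"
  define s where "s = (a * d - c\<^sup>2) / a"
  define k where "k = c / a"
  have a0: "0 < a" and D0: "0 < a * d - c\<^sup>2" using a D by (auto simp: a_def d_def c_def)
  have s0: "0 < s" using a0 D0 by (simp add: s_def)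
  \<comment> \<open>The law of total variance: conditional variance plus variance of the conditional
    mean.\<close>
  have sd: "s + k\<^sup>2 * a = d" using a0 by (simp add: s_def k_def field_simps power2_eq_square)
  note int = integral_ga_law[OF a D s_def[unfolded a_def d_def c_def] k_def[unfolded a_def c_def]]
  have m: "(\<lambda>w :: real \<times> real. fst w) \<in> borel_measurable borel" "(\<lambda>w :: real \<times> real. snd w) \<in> borel_measurable borel"
    by (auto simp: borel_prod[symmetric])
  note [measurable] = m
  show "(LINT w|ga_law \<mu> \<eta> i j. (fst w - \<mu> i)^2) = \<eta> (Diag i)"
    using int[of "\<lambda>w. (fst w - \<mu> i)^2" "\<lambda>x. (x - \<mu> i)^2" "\<lambda>_. 0" \<mu> "\<lambda>_. 0" 0 1 0] by simp
  show "(LINT w|ga_law \<mu> \<eta> i j. (fst w - \<mu> i)^4) = 3 * (\<eta> (Diag i))^2"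
    using int[of "\<lambda>w. (fst w - \<mu> i)^4" "\<lambda>x. (x - \<mu> i)^4" "\<lambda>_. 0" \<mu> "\<lambda>_. 0" 0 0 1]
    by simp
  have "(LINT w|ga_law \<mu> \<eta> i j. (snd w - \<mu> j)^2) = s + k\<^sup>2 * a + 0"
    using int[of "\<lambda>w. (snd w - \<mu> j)^2" "\<lambda>_. 0" "\<lambda>_. 1" \<mu> "\<lambda>_. 0" s "k\<^sup>2" 0] s0
    by (simp add: power_mult_distrib a_def)
  then show "(LINT w|ga_law \<mu> \<eta> i j. (snd w - \<mu> j)^2) = \<eta> (Diag j)"
    using sd by (simp add: d_def)
  have "(LINT w|ga_law \<mu> \<eta> i j. (snd w - \<mu> j)^4) = 3 * s\<^sup>2 + 6 * s * k\<^sup>2 * a + k^4 * (3 * a\<^sup>2)"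
    using int[of "\<lambda>w. (snd w - \<mu> j)^4" "\<lambda>_. 0" "\<lambda>_. 0" \<mu> "\<lambda>_. 1" "3 * s\<^sup>2" "6 * s * k\<^sup>2" "k^4"] s0
    by (simp add: power_mult_distrib a_def)
  also have "\<dots> = 3 * (s + k\<^sup>2 * a)\<^sup>2" by (simp add: power2_eq_square power4_eq_xxxx algebra_simps)
  finally show "(LINT w|ga_law \<mu> \<eta> i j. (snd w - \<mu> j)^4) = 3 * (\<eta> (Diag j))^2"
    unfolding sd by (simp add: d_def)
  have q: "(x - \<mu> i)^2 * (s + (k * (x - \<mu> i))^2) = s * (x - \<mu> i)^2 + k\<^sup>2 * (x - \<mu> i)^4" for x
    by (simp add: power_mult_distrib distrib_left)
  have "(LINT w|ga_law \<mu> \<eta> i j. (fst w - \<mu> i)^2 * (snd w - \<mu> j)^2) = 0 + s * a + k\<^sup>2 * (3 * a\<^sup>2)"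
    using int[of "\<lambda>w. (fst w - \<mu> i)^2 * (snd w - \<mu> j)^2" "\<lambda>_. 0" "\<lambda>x. (x - \<mu> i)^2" \<mu> "\<lambda>_. 0" 0 s "k\<^sup>2"] s0
    by (simp add: q a_def)
  also have "\<dots> = a * (s + k\<^sup>2 * a) + 2 * (k * a)\<^sup>2" by (simp add: power2_eq_square algebra_simps)
  also have "k * a = c" using a0 by (simp add: k_def)
  finally show "(LINT w|ga_law \<mu> \<eta> i j. (fst w - \<mu> i)^2 * (snd w - \<mu> j)^2) =
      \<eta> (Diag i) * \<eta> (Diag j) + 2 * (\<eta> (Off {i, j}))^2"
    unfolding sd by (simp add: a_def d_def c_def)
qed

lemma inv_sqrt_mat_1:
  assumes "0 < (a::real)"
  shows "inv_sqrt_mat 1 (mat 1 1 (\<lambda>_. a\<^sup>2)) = mat 1 1 (\<lambda>_. 1 / a)"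
proof -
  have pd: "pos_def_mat 1 (mat 1 1 (\<lambda>_. r))" if "0 < r" for r :: real
    unfolding pos_def_mat_def
  proof (intro conjI ballI impI)
    fix v :: "real vec" assume v: "v \<in> carrier_vec 1" "v \<noteq> 0\<^sub>v 1"
    then have "vec_index v 0 \<noteq> 0" by (metis carrier_vecD eq_vecI index_zero_vec less_one)
    then show "0 < scalar_prod v (mat 1 1 (\<lambda>_. r) *\<^sub>v v)"
      using v(1) mult_pos_pos[OF that, of "(vec_index v 0)\<^sup>2", unfolded zero_less_power2]
      by (subst scalar_prod_mult_mat_vec_sum[of _ 1]) (auto simp: power2_eq_square mult_ac)
  qed (auto intro!: eq_matI)
  show ?thesis
  proof (rule inv_sqrt_mat_unique)
    show "mat 1 1 (\<lambda>_. a\<^sup>2) * (mat 1 1 (\<lambda>_. 1 / a) * mat 1 1 (\<lambda>_. 1 / a)) = 1\<^sub>m 1"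
      using assms by (intro eq_matI) (auto simp: scalar_prod_def power2_eq_square)
    show "pos_def_mat 1 (mat 1 1 (\<lambda>_. a\<^sup>2))" "pos_def_mat 1 (mat 1 1 (\<lambda>_. 1 / a))"
      using assms by (auto intro!: pd simp del: One_nat_def)
  qed
qed

text \<open>By the fourth moments the variances of the squares are 2 eta_ii^2 and 2 eta_jj^2 and
  their covariance is 2 eta_ij^2. The factors 2 cancel: the correlation of the squares is the square
  of the correlation coefficient.\<close>

lemma ga_corr_eq:
  assumes a: "0 < \<eta> (Diag i)" and d: "0 < \<eta> (Diag j)"
    and D: "0 < \<eta> (Diag i) * \<eta> (Diag j) - (\<eta> (Off {i, j}))\<^sup>2"
  shows "ga_corr \<mu> \<eta> i j = mat 1 1 (\<lambda>_. (\<eta> (Off {i, j}))\<^sup>2 / (\<eta> (Diag i) * \<eta> (Diag j)))"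
proof -
  let ?p = "ga_law \<mu> \<eta> i j"
  let ?x = "\<lambda>w. ga_stat \<mu> i (fst w)" and ?y = "\<lambda>w. ga_stat \<mu> j (snd w)"
  note mom = ga_moments[OF a D, of \<mu>]
  have "Cov ?p 1 ?x 1 ?x = mat 1 1 (\<lambda>_. (sqrt 2 * \<eta> (Diag i))\<^sup>2)"
    by (intro eq_matI) (simp_all add: Cov_def ga_stat_def mom power_mult_distrib, simp add: power2_eq_square)
  moreover have "Cov ?p 1 ?y 1 ?y = mat 1 1 (\<lambda>_. (sqrt 2 * \<eta> (Diag j))\<^sup>2)"
    by (intro eq_matI) (simp_all add: Cov_def ga_stat_def mom power_mult_distrib, simp add: power2_eq_square)
  moreover have "Cov ?p 1 ?x 1 ?y = mat 1 1 (\<lambda>_. 2 * (\<eta> (Off {i, j}))\<^sup>2)"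
    by (intro eq_matI) (simp_all add: Cov_def ga_stat_def mom)
  moreover have "inv_sqrt_mat 1 (mat 1 1 (\<lambda>_. (sqrt 2 * r)\<^sup>2)) = mat 1 1 (\<lambda>_. 1 / (sqrt 2 * r))" if "0 < r" for r
    using that by (intro inv_sqrt_mat_1) simp
  ultimately have "ga_corr \<mu> \<eta> i j = mat 1 1 (\<lambda>_. 1 / (sqrt 2 * \<eta> (Diag i))) *
      mat 1 1 (\<lambda>_. 2 * (\<eta> (Off {i, j}))\<^sup>2) * mat 1 1 (\<lambda>_. 1 / (sqrt 2 * \<eta> (Diag j)))"
    unfolding ga_corr_def Corr_def using a d by simp
  also have "\<dots> = mat 1 1 (\<lambda>_. (\<eta> (Off {i, j}))\<^sup>2 / (\<eta> (Diag i) * \<eta> (Diag j)))"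
    by (intro eq_matI) (simp_all add: scalar_prod_def field_simps)
  finally show ?thesis .
qed

text \<open>Edges are unordered; \<open>u\<close> and \<open>v\<close> fix an order of the
  endpoints, so that determinants and their derivatives become polynomials in named
  coordinates.\<close>

locale ga_family =
  fixes V :: "'v set" and E :: "'v set set" and u v :: "'v set \<Rightarrow> 'v"
  assumes finite_V: "finite V"
    and edge: "\<And>e. e \<in> E \<Longrightarrow> e = {u e, v e}" "\<And>e. e \<in> E \<Longrightarrow> u e \<noteq> v e" "\<And>e. e \<in> E \<Longrightarrow> e \<subseteq> V"
begin

lemma hyp: "hypergraph V E"
  using finite_V edge unfolding hypergraph_def by fastforce

lemma finite_E: "finite E"
  using finite_V edge(3) by (meson Pow_iff finite_Pow_iff finite_subset subsetI)

lemma uv_in: "e \<in> E \<Longrightarrow> u e \<in> e" "e \<in> E \<Longrightarrow> v e \<in> e"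
  using edge(1) by blast+

lemma uv_V: "e \<in> E \<Longrightarrow> u e \<in> V" "e \<in> E \<Longrightarrow> v e \<in> V"
  using edge(3) uv_in by blast+

section \<open>The Hessian form of the Gaussian Bethe free energy\<close>

definition coords :: "'v ga_coord set" where
  "coords = Diag ` V \<union> Off ` E"

lemma finite_coords: "finite coords"
  by (simp add: coords_def finite_V finite_E)

definition ga_T :: "('v ga_coord \<Rightarrow> real) set" where
  "ga_T = {h. \<forall>c. c \<notin> coords \<longrightarrow> h c = 0}"

definition edet :: "('v ga_coord \<Rightarrow> real) \<Rightarrow> 'v set \<Rightarrow> real" where
  "edet \<eta> e = \<eta> (Diag (u e)) * \<eta> (Diag (v e)) - (\<eta> (Off e))\<^sup>2"

text \<open>The polarization of the quadratic form \<open>edet\<close>. It serves as first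
  derivative at \<open>\<eta>\<close> along \<open>h\<close> and, with two directions as arguments,
  as mixed second derivative.\<close>

definition edet' :: "('v ga_coord \<Rightarrow> real) \<Rightarrow> ('v ga_coord \<Rightarrow> real) \<Rightarrow> 'v set \<Rightarrow> real" where
  "edet' \<eta> h e = h (Diag (u e)) * \<eta> (Diag (v e)) + \<eta> (Diag (u e)) * h (Diag (v e)) - 2 * \<eta> (Off e) * h (Off e)"

text \<open>The edge terms are f_hk / f - f_h f_k / f^2, the second derivative of ln f. The node
  terms change sign because the second derivative of ln x is -1 / x^2.\<close>

definition ga_hess :: "('v ga_coord \<Rightarrow> real) \<Rightarrow> ('v ga_coord \<Rightarrow> real) \<Rightarrow> ('v ga_coord \<Rightarrow> real) \<Rightarrow> real" where
  "ga_hess \<eta> h k =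
     - 1/2 * (\<Sum>e\<in>E. edet' h k e / edet \<eta> e - edet' \<eta> h e * edet' \<eta> k e / (edet \<eta> e)\<^sup>2)
     + 1/2 * (\<Sum>i\<in>V. (1 - real (degree_of E i)) * (h (Diag i) * k (Diag i) / (\<eta> (Diag i))\<^sup>2))"

lemma ga_L_iff:
  "\<eta> \<in> ga_L V E \<longleftrightarrow> (\<forall>c. c \<notin> coords \<longrightarrow> \<eta> c = 0) \<and> (\<forall>i\<in>V. 0 < \<eta> (Diag i)) \<and> (\<forall>e\<in>E. 0 < edet \<eta> e)"
proof -
  have "(\<forall>i j. i \<noteq> j \<and> {i, j} \<in> E \<longrightarrow> 0 < \<eta> (Diag i) * \<eta> (Diag j) - (\<eta> (Off {i, j}))\<^sup>2) \<longleftrightarrow>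
      (\<forall>e\<in>E. 0 < edet \<eta> e)"
  proof (intro iffI ballI allI impI)
    fix e assume A: "\<forall>i j. i \<noteq> j \<and> {i, j} \<in> E \<longrightarrow> 0 < \<eta> (Diag i) * \<eta> (Diag j) - (\<eta> (Off {i, j}))\<^sup>2"
      and e: "e \<in> E"
    show "0 < edet \<eta> e"
      using A[rule_format, of "u e" "v e"] edge(2)[OF e] e unfolding edge(1)[OF e, symmetric] edet_def by blast
  next
    fix i j assume A: "\<forall>e\<in>E. 0 < edet \<eta> e" and ij: "i \<noteq> j \<and> {i, j} \<in> E"
    then have "{i, j} = {u {i, j}, v {i, j}}" using edge(1) by blast
    then have "(u {i, j} = i \<and> v {i, j} = j) \<or> (u {i, j} = j \<and> v {i, j} = i)"
      unfolding doubleton_eq_iff by auto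
    moreover have "0 < edet \<eta> {i, j}" using A ij by blast
    ultimately show "0 < \<eta> (Diag i) * \<eta> (Diag j) - (\<eta> (Off {i, j}))\<^sup>2"
      by (auto simp: edet_def mult.commute)
  qed
  then show ?thesis by (auto simp: ga_L_def coords_def)
qed

lemma edet_shift: "edet (\<lambda>c. \<eta> c + t * k c) e = edet \<eta> e + t * edet' \<eta> k e + t\<^sup>2 * edet k e"
  by (simp add: edet_def edet'_def algebra_simps power2_eq_square)

lemma edet'_shift: "edet' (\<lambda>c. \<eta> c + s * h c) k e = edet' \<eta> k e + s * edet' h k e"
  by (simp add: edet'_def algebra_simps)

lemma eventually_ga_L:
  assumes L: "\<eta> \<in> ga_L V E" and h: "h \<in> ga_T"
  shows "\<forall>\<^sub>F t in nhds (0::real). (\<lambda>c. \<eta> c + t * h c) \<in> ga_L V E"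
proof -
  have "((\<lambda>t. \<eta> (Diag i) + t * h (Diag i)) \<longlongrightarrow> \<eta> (Diag i) + 0 * h (Diag i)) (nhds 0)" for i
    by (intro tendsto_intros filterlim_ident)
  then have "\<forall>\<^sub>F t in nhds (0::real). 0 < \<eta> (Diag i) + t * h (Diag i)" if "i \<in> V" for i
    using that L by (intro order_tendstoD(1)) (auto simp: ga_L_iff)
  then have 1: "\<forall>\<^sub>F t in nhds (0::real). \<forall>i\<in>V. 0 < \<eta> (Diag i) + t * h (Diag i)"
    by (intro eventually_ball_finite finite_V) auto
  have "((\<lambda>t. edet (\<lambda>c. \<eta> c + t * h c) e) \<longlongrightarrow> edet \<eta> e + 0 * edet' \<eta> h e + 0\<^sup>2 * edet h e) (nhds 0)" for e
    unfolding edet_shift by (intro tendsto_intros filterlim_ident)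
  then have "\<forall>\<^sub>F t in nhds (0::real). 0 < edet (\<lambda>c. \<eta> c + t * h c) e" if "e \<in> E" for e
    using that L by (intro order_tendstoD(1)) (auto simp: ga_L_iff)
  then have 2: "\<forall>\<^sub>F t in nhds (0::real). \<forall>e\<in>E. 0 < edet (\<lambda>c. \<eta> c + t * h c) e"
    by (intro eventually_ball_finite finite_E) auto
  from 1 2 show ?thesis
    by eventually_elim (use L h in \<open>auto simp: ga_L_iff ga_T_def\<close>)
qed

lemma tangent_dirs_ga_L:
  assumes L: "\<eta> \<in> ga_L V E"
  shows "tangent_dirs (ga_L V E) \<eta> = ga_T"
proof
  show "ga_T \<subseteq> tangent_dirs (ga_L V E) \<eta>"
    using eventually_ga_L[OF L] by (auto simp: tangent_dirs_def)
  show "tangent_dirs (ga_L V E) \<eta> \<subseteq> ga_T"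
  proof
    fix h assume "h \<in> tangent_dirs (ga_L V E) \<eta>"
    then obtain r where "r > 0" "\<And>t. dist t 0 < r \<Longrightarrow> (\<lambda>c. \<eta> c + t * h c) \<in> ga_L V E"
      by (auto simp: tangent_dirs_def eventually_nhds_metric)
    from this(2)[of "r / 2"] this(1) have "(\<lambda>c. \<eta> c + (r / 2) * h c) \<in> ga_L V E" by simp
    then have "(r / 2) * h c = 0" if "c \<notin> coords" for c
      using that L by (simp add: ga_L_iff)
    then show "h \<in> ga_T" using \<open>r > 0\<close> by (simp add: ga_T_def)
  qed
qed

lemma ga_bethe_eq:
  "ga_bethe V E lin \<kappa> \<eta> = (\<Sum>c\<in>coords. lin c * \<eta> c) - 1/2 * (\<Sum>e\<in>E. ln (edet \<eta> e))
    - 1/2 * (\<Sum>i\<in>V. (1 - real (degree_of E i)) * ln (\<eta> (Diag i))) + \<kappa>"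
proof -
  have "(\<Prod>i\<in>e. \<eta> (Diag i)) - (\<eta> (Off e))\<^sup>2 = edet \<eta> e" if "e \<in> E" for e
  proof -
    have "(\<Prod>i\<in>e. \<eta> (Diag i)) = (\<Prod>i\<in>{u e, v e}. \<eta> (Diag i))" using edge(1)[OF that] by simp
    then show ?thesis using edge(2)[OF that] by (simp add: edet_def)
  qed
  then show ?thesis by (simp add: ga_bethe_def coords_def)
qed

lemma has_hessian_ga_bethe:
  assumes L: "\<eta> \<in> ga_L V E"
  shows "has_hessian (ga_L V E) (ga_bethe V E lin \<kappa>) \<eta> (ga_hess \<eta>)"
  unfolding has_hessian_def tangent_dirs_ga_L[OF L]
proof (intro ballI exI conjI)
  fix h k assume h: "h \<in> ga_T" and k: "k \<in> ga_T"
  define g where "g s = (\<Sum>c\<in>coords. lin c * k c)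
     - 1/2 * (\<Sum>e\<in>E. edet' (\<lambda>c. \<eta> c + s * h c) k e / edet (\<lambda>c. \<eta> c + s * h c) e)
     - 1/2 * (\<Sum>i\<in>V. (1 - real (degree_of E i)) * (k (Diag i) / (\<eta> (Diag i) + s * h (Diag i))))" for s
  show "\<forall>\<^sub>F s in nhds 0. ((\<lambda>t. ga_bethe V E lin \<kappa> (\<lambda>c. \<eta> c + s * h c + t * k c)) has_real_derivative g s) (at 0)"
    using eventually_ga_L[OF L h]
  proof eventually_elim
    case (elim s)
    have lin: "((\<lambda>t. p * (a + t * k)) has_real_derivative p * k) (at 0)" for a k p :: real
      by (auto intro!: derivative_eq_intros)
    have ln1: "((\<lambda>t. ln (a + t * k)) has_real_derivative k / a) (at 0)" if "0 < a" for a k :: real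
      using that by (auto intro!: derivative_eq_intros)
    have ln2: "((\<lambda>t. ln (edet (\<lambda>c. \<eta> c + s * h c + t * k c) e)) has_real_derivative
        edet' (\<lambda>c. \<eta> c + s * h c) k e / edet (\<lambda>c. \<eta> c + s * h c) e) (at 0)"
      if "0 < edet (\<lambda>c. \<eta> c + s * h c) e" for e
      unfolding edet_shift[of "\<lambda>c. \<eta> c + s * h c"] using that
      by (auto intro!: derivative_eq_intros)
    have "((\<lambda>t. ga_bethe V E lin \<kappa> (\<lambda>c. \<eta> c + s * h c + t * k c)) has_real_derivative g s + 0) (at 0)"
      unfolding ga_bethe_eq g_def
      by (intro DERIV_add DERIV_diff DERIV_sum DERIV_cmult DERIV_const lin ln1 ln2)
        (use elim in \<open>auto simp: ga_L_iff\<close>)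
    then show ?case by simp
  qed
  have inv: "((\<lambda>s. k / (a + s * h)) has_real_derivative - (h * k / a\<^sup>2)) (at 0)"
    if "0 < a" for a h k :: real
    using that by (auto intro!: derivative_eq_intros simp: power2_eq_square)
  have quot: "((\<lambda>s. edet' (\<lambda>c. \<eta> c + s * h c) k e / edet (\<lambda>c. \<eta> c + s * h c) e) has_real_derivative
      edet' h k e / edet \<eta> e - edet' \<eta> h e * edet' \<eta> k e / (edet \<eta> e)\<^sup>2) (at 0)"
    if "0 < edet \<eta> e" for e
    unfolding edet_shift edet'_shift using that
    by (auto intro!: derivative_eq_intros simp: power2_eq_square field_simps)
  have "(g has_real_derivative 0
     - 1/2 * (\<Sum>e\<in>E. edet' h k e / edet \<eta> e - edet' \<eta> h e * edet' \<eta> k e / (edet \<eta> e)\<^sup>2)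
     - 1/2 * (\<Sum>i\<in>V. (1 - real (degree_of E i)) * - (h (Diag i) * k (Diag i) / (\<eta> (Diag i))\<^sup>2))) (at 0)"
    unfolding g_def
    by (intro DERIV_diff DERIV_sum DERIV_cmult DERIV_const inv quot)
      (use L in \<open>auto simp: ga_L_iff\<close>)
  then show "(g has_real_derivative ga_hess \<eta> h k) (at 0)"
    by (simp add: ga_hess_def sum_negf)
qed

lemma ga_hess_sym: "ga_hess \<eta> h k = ga_hess \<eta> k h"
proof -
  have "edet' h k e = edet' k h e" for e by (simp add: edet'_def mult_ac)
  then show ?thesis by (simp add: ga_hess_def mult_ac)
qed

lemma ga_hess_linear:
  "ga_hess \<eta> (\<lambda>c. p * h c + q * h' c) k = p * ga_hess \<eta> h k + q * ga_hess \<eta> h' k"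
proof -
  have e: "edet' (\<lambda>c. p * h c + q * h' c) k e = p * edet' h k e + q * edet' h' k e"
    "edet' \<eta> (\<lambda>c. p * h c + q * h' c) e = p * edet' \<eta> h e + q * edet' \<eta> h' e" for e
    by (simp_all add: edet'_def algebra_simps)
  have "(\<Sum>e\<in>E. edet' (\<lambda>c. p * h c + q * h' c) k e / edet \<eta> e -
        edet' \<eta> (\<lambda>c. p * h c + q * h' c) e * edet' \<eta> k e / (edet \<eta> e)\<^sup>2) =
      p * (\<Sum>e\<in>E. edet' h k e / edet \<eta> e - edet' \<eta> h e * edet' \<eta> k e / (edet \<eta> e)\<^sup>2) +
      q * (\<Sum>e\<in>E. edet' h' k e / edet \<eta> e - edet' \<eta> h' e * edet' \<eta> k e / (edet \<eta> e)\<^sup>2)"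
    unfolding e sum_distrib_left sum.distrib[symmetric]
    by (intro sum.cong refl) (simp add: algebra_simps add_divide_distrib)
  moreover have "(\<Sum>i\<in>V. (1 - real (degree_of E i)) * ((p * h (Diag i) + q * h' (Diag i)) * k (Diag i) / (\<eta> (Diag i))\<^sup>2)) =
      p * (\<Sum>i\<in>V. (1 - real (degree_of E i)) * (h (Diag i) * k (Diag i) / (\<eta> (Diag i))\<^sup>2)) +
      q * (\<Sum>i\<in>V. (1 - real (degree_of E i)) * (h' (Diag i) * k (Diag i) / (\<eta> (Diag i))\<^sup>2))"
    unfolding sum_distrib_left sum.distrib[symmetric]
    by (intro sum.cong refl) (simp add: algebra_simps add_divide_distrib)
  ultimately show ?thesis unfolding ga_hess_def by (simp add: algebra_simps)
qed

section \<open>Null vectors of the Gaussian Hessian as messages\<close>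

definition other :: "'v set \<Rightarrow> 'v \<Rightarrow> 'v" where
  "other e i = (if i = u e then v e else u e)"

lemma edge_cases:
  assumes "e \<in> E" "i \<in> e"
  obtains "i = u e" "other e i = v e" | "i = v e" "other e i = u e"
proof -
  have "i = u e \<or> i = v e" using edge(1)[OF assms(1)] assms(2) by blast
  then show ?thesis using that edge(2)[OF assms(1)] by (metis other_def)
qed

lemma other_in: "e \<in> E \<Longrightarrow> i \<in> e \<Longrightarrow> other e i \<in> e"
  using uv_in by (simp add: other_def)

lemma other_other:
  assumes "e \<in> E" "i \<in> e"
  shows "other e (other e i) = i"
  using edge_cases[OF assms] edge(2)[OF assms(1)] by (metis other_def)

lemma edge_minus:
  assumes "e \<in> E" "i \<in> e"
  shows "e - {i} = {other e i}"
proof -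
  have "e - {i} = {u e, v e} - {i}" by (rule arg_cong[OF edge(1)[OF assms(1)]])
  also have "\<dots> = {other e i}"
    using edge_cases[OF assms] edge(2)[OF assms(1)] by (metis Diff_insert_absorb insert_commute singletonD insert_iff)
  finally show ?thesis .
qed

lemma edet_other:
  assumes "e \<in> E" "i \<in> e"
  shows "edet \<eta> e = \<eta> (Diag i) * \<eta> (Diag (other e i)) - (\<eta> (Off e))\<^sup>2"
    and "edet' \<eta> h e = h (Diag i) * \<eta> (Diag (other e i)) + \<eta> (Diag i) * h (Diag (other e i)) - 2 * \<eta> (Off e) * h (Off e)"
  by (rule edge_cases[OF assms]; simp add: edet_def edet'_def algebra_simps)+

text \<open>On each edge the relative changes x_i of the variances split as x_i = y_i + r y_o, where
  o is the other endpoint and r = eta_io^2 / (eta_ii eta_oo) is the correlation of the squares. Thus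
  r y_o is the message, and r acts as the conditional expectation does in the multinomial
  case.\<close>

lemma ga_hess_nondegenerate:
  assumes L: "\<eta> \<in> ga_L V E" and h: "h \<in> ga_T"
    and null: "\<And>k. k \<in> ga_T \<Longrightarrow> ga_hess \<eta> h k = 0"
    and q: "\<And>i. i \<in> V \<Longrightarrow> 0 < q i"
    and contr: "\<And>e i. e \<in> E \<Longrightarrow> i \<in> e \<Longrightarrow>
      q i * ((\<eta> (Off e))\<^sup>2 / (\<eta> (Diag i) * \<eta> (Diag (other e i)))) \<le> K * q (other e i)"
    and K: "0 \<le> K" "K * rho E < 1"
  shows "h = (\<lambda>c. 0)"
proof -
  define x where "x i = h (Diag i) / \<eta> (Diag i)" for i
  define R where "R e i = \<eta> (Diag i) * \<eta> (Diag (other e i)) + (\<eta> (Off e))\<^sup>2" for e i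
  \<comment> \<open>Solution of x_i = y_i + r y_o and x_o = y_o + r y_i. The denominator comes from
    1 - r^2, whose two factors are \<open>edet\<close> and \<open>R\<close> up to the product of the
    variances.\<close>
  define y where "y e i = \<eta> (Diag i) * ((\<eta> (Diag (other e i)))\<^sup>2 * h (Diag i) - (\<eta> (Off e))\<^sup>2 * h (Diag (other e i))) /
    (edet \<eta> e * R e i)" for e i
  define msg where "msg e i = x i - y e i" for e i
  have D: "0 < \<eta> (Diag i)" if "i \<in> V" for i using L that by (simp add: ga_L_iff)
  have P: "0 < edet \<eta> e" if "e \<in> E" for e using L that by (simp add: ga_L_iff)
  have inV: "i \<in> V" if "e \<in> E" "i \<in> e" for e i using edge(3) that by blast
  have R: "0 < R e i" if "e \<in> E" "i \<in> e" for e i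
    unfolding R_def using D[OF inV[OF that]] D[OF inV[OF that(1) other_in[OF that]]]
    by (intro add_pos_nonneg mult_pos_pos) auto
  \<comment> \<open>Testing against the coordinate \<open>Off e\<close> alone, which occurs in a
    single edge term.\<close>
  have off: "h (Off e) * edet \<eta> e = \<eta> (Off e) * edet' \<eta> h e" if e: "e \<in> E" for e
  proof -
    let ?k = "\<lambda>c. if c = Off e then 1 else 0 :: real"
    have "?k \<in> ga_T" using e by (simp add: ga_T_def coords_def)
    then have "0 = ga_hess \<eta> h ?k" using null by simp
    also have "\<dots> = - 1/2 * (\<Sum>e'\<in>E. if e' = e then - 2 * h (Off e) / edet \<eta> e + 2 * \<eta> (Off e) * edet' \<eta> h e / (edet \<eta> e)\<^sup>2 else 0)"
      unfolding ga_hess_def by (simp add: edet'_def cong: if_cong) (auto intro!: sum.cong)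
    also have "\<dots> = h (Off e) / edet \<eta> e - \<eta> (Off e) * edet' \<eta> h e / (edet \<eta> e)\<^sup>2"
      using e finite_E by (simp add: sum.delta field_simps)
    finally show ?thesis using P[OF e] by (simp add: field_simps power2_eq_square)
  qed
  \<comment> \<open>Here \<open>off\<close> eliminates the component \<open>h (Off e)\<close>;
    afterwards only the variance components of \<open>h\<close> are left.\<close>
  have edet'_h: "edet' \<eta> h e * R e i = (h (Diag i) * \<eta> (Diag (other e i)) + \<eta> (Diag i) * h (Diag (other e i))) * edet \<eta> e"
    if e: "e \<in> E" "i \<in> e" for e i
  proof -
    have "edet' \<eta> h e * edet \<eta> e = (h (Diag i) * \<eta> (Diag (other e i)) + \<eta> (Diag i) * h (Diag (other e i))) * edet \<eta> e
        - 2 * \<eta> (Off e) * (h (Off e) * edet \<eta> e)"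
      unfolding edet_other(2)[OF e] by (simp add: algebra_simps)
    then have "edet' \<eta> h e * (edet \<eta> e + 2 * (\<eta> (Off e))\<^sup>2) =
        (h (Diag i) * \<eta> (Diag (other e i)) + \<eta> (Diag i) * h (Diag (other e i))) * edet \<eta> e"
      unfolding off[OF e(1)] by (simp add: algebra_simps power2_eq_square)
    moreover have "edet \<eta> e + 2 * (\<eta> (Off e))\<^sup>2 = R e i"
      unfolding edet_other(1)[OF e] R_def by simp
    ultimately show ?thesis by simp
  qed
  have y_eq: "\<eta> (Diag i) * (edet' \<eta> h e * \<eta> (Diag (other e i)) / (edet \<eta> e)\<^sup>2 - h (Diag (other e i)) / edet \<eta> e) = y e i"
    if e: "e \<in> E" "i \<in> e" for e i
  proof -
    let ?a = "\<eta> (Diag i)" and ?d = "\<eta> (Diag (other e i))" and ?hi = "h (Diag i)" and ?ho = "h (Diag (other e i))"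
    have X: "edet' \<eta> h e = (?hi * ?d + ?a * ?ho) * edet \<eta> e / R e i"
      using edet'_h[OF e] R[OF e] by (simp add: field_simps)
    have num: "(?hi * ?d + ?a * ?ho) * ?d - ?ho * R e i = ?d\<^sup>2 * ?hi - (\<eta> (Off e))\<^sup>2 * ?ho"
      unfolding R_def by (simp add: algebra_simps power2_eq_square)
    have frac: "a * (t * p / q * d / p\<^sup>2 - o' / p) = a * (t * d - o' * q) / (p * q)"
      if "0 < p" "0 < q" for a t p q d o' :: real
      using that by (simp add: power2_eq_square field_simps)
    show ?thesis
      unfolding X frac[OF P[OF e(1)] R[OF e]] num y_def ..
  qed
  \<comment> \<open>Testing against the coordinate \<open>Diag i\<close> and multiplying by
    \<open>\<eta> (Diag i)\<close> gives sum y + (1 - d_i) x_i = 0, and \<open>y = x - msg\<close>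
    cancels the degree.\<close>
  have x_sum: "x i = (\<Sum>e\<in>{e\<in>E. i \<in> e}. msg e i)" if i: "i \<in> V" for i
  proof -
    let ?t = "\<lambda>e. h (Diag (other e i)) / edet \<eta> e - edet' \<eta> h e * \<eta> (Diag (other e i)) / (edet \<eta> e)\<^sup>2"
    let ?k = "\<lambda>c. if c = Diag i then 1 else 0 :: real"
    have "?k \<in> ga_T" using i by (simp add: ga_T_def coords_def)
    then have "0 = ga_hess \<eta> h ?k" using null by simp
    also have "\<dots> = - 1/2 * (\<Sum>e\<in>E. if i \<in> e then ?t e else 0) +
        1/2 * (\<Sum>j\<in>V. if j = i then (1 - real (degree_of E i)) * (h (Diag i) / (\<eta> (Diag i))\<^sup>2) else 0)"
    proof -
      have edge_term: "edet' h ?k e / edet \<eta> e - edet' \<eta> h e * edet' \<eta> ?k e / (edet \<eta> e)\<^sup>2 =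
          (if i \<in> e then ?t e else 0)"
        if e: "e \<in> E" for e
      proof (cases "i \<in> e")
        case True
        then have "other e i \<noteq> i" using edge(2)[OF e] by (auto simp: other_def)
        then show ?thesis using True unfolding edet_other(2)[OF e True] by simp
      next
        case False
        then have "i \<noteq> u e" "i \<noteq> v e" using uv_in[OF e] by auto
        then show ?thesis using False by (simp add: edet'_def)
      qed
      have "(\<Sum>e\<in>E. edet' h ?k e / edet \<eta> e - edet' \<eta> h e * edet' \<eta> ?k e / (edet \<eta> e)\<^sup>2) =
          (\<Sum>e\<in>E. if i \<in> e then ?t e else 0)"
        by (intro sum.cong refl edge_term)
      moreover have "(\<Sum>j\<in>V. (1 - real (degree_of E j)) * (h (Diag j) * ?k (Diag j) / (\<eta> (Diag j))\<^sup>2)) =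
          (\<Sum>j\<in>V. if j = i then (1 - real (degree_of E i)) * (h (Diag i) / (\<eta> (Diag i))\<^sup>2) else 0)"
        by (intro sum.cong) auto
      ultimately show ?thesis unfolding ga_hess_def by (simp only:)
    qed
    also have "\<dots> = - 1/2 * (\<Sum>e\<in>{e\<in>E. i \<in> e}. ?t e) +
        1/2 * ((1 - real (degree_of E i)) * (h (Diag i) / (\<eta> (Diag i))\<^sup>2))"
      using finite_V i by (simp add: sum.inter_filter[OF finite_E] sum.delta)
    finally have "0 = \<eta> (Diag i) * (- (\<Sum>e\<in>{e\<in>E. i \<in> e}. ?t e) +
        (1 - real (degree_of E i)) * (h (Diag i) / (\<eta> (Diag i))\<^sup>2))" by simp
    also have "\<dots> = (\<Sum>e\<in>{e\<in>E. i \<in> e}. \<eta> (Diag i) * (edet' \<eta> h e * \<eta> (Diag (other e i)) / (edet \<eta> e)\<^sup>2 -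
          h (Diag (other e i)) / edet \<eta> e)) + (1 - real (degree_of E i)) * x i"
      using D[OF i] unfolding distrib_left sum_negf[symmetric] sum_distrib_left
      by (simp add: x_def power2_eq_square)
    also have "\<dots> = (\<Sum>e\<in>{e\<in>E. i \<in> e}. y e i) + (1 - real (degree_of E i)) * x i"
      by (simp add: y_eq)
    also have "\<dots> = x i - (\<Sum>e\<in>{e\<in>E. i \<in> e}. msg e i)"
      by (simp add: msg_def sum_subtractf degree_of_def algebra_simps)
    finally show ?thesis by simp
  qed
  have msg_y: "msg e i = (\<eta> (Off e))\<^sup>2 / (\<eta> (Diag i) * \<eta> (Diag (other e i))) * y e (other e i)"
    if e: "e \<in> E" "i \<in> e" for e i
  proof -
    let ?a = "\<eta> (Diag i)" and ?d = "\<eta> (Diag (other e i))" and ?c = "\<eta> (Off e)"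
      and ?hi = "h (Diag i)" and ?ho = "h (Diag (other e i))"
    have a: "0 < ?a" and d: "0 < ?d" using D inV e other_in by blast+
    have Po: "edet \<eta> e = ?a * ?d - ?c\<^sup>2" by (rule edet_other(1)[OF e])
    have Ro: "R e (other e i) = R e i" "R e i = ?a * ?d + ?c\<^sup>2"
      by (simp_all add: R_def other_other[OF e] mult.commute)
    have PR: "0 < edet \<eta> e * R e i" using P[OF e(1)] R[OF e] by simp
    have num: "?hi * (edet \<eta> e * R e i) - ?a\<^sup>2 * (?d\<^sup>2 * ?hi - ?c\<^sup>2 * ?ho) = ?c\<^sup>2 * (?a\<^sup>2 * ?ho - ?c\<^sup>2 * ?hi)"
      unfolding Po Ro(2) by (simp add: algebra_simps power2_eq_square)
    have frac: "x' / a - a * z / p = (x' * p - a\<^sup>2 * z) / (a * p)" if "0 < a" "0 < p" for x' a z p :: real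
      using that by (simp add: power2_eq_square field_simps)
    have "msg e i = ?c\<^sup>2 * (?a\<^sup>2 * ?ho - ?c\<^sup>2 * ?hi) / (?a * (edet \<eta> e * R e i))"
      unfolding msg_def x_def y_def frac[OF a PR] num ..
    also have "\<dots> = ?c\<^sup>2 / (?a * ?d) * (?d * (?a\<^sup>2 * ?ho - ?c\<^sup>2 * ?hi) / (edet \<eta> e * R e i))"
      using a d by simp
    finally show ?thesis by (simp add: y_def other_other[OF e] Ro(1))
  qed
  have y_sum: "y e i = (\<Sum>e'\<in>{e'\<in>E. i \<in> e'} - {e}. msg e' i)" if e: "e \<in> E" "i \<in> e" for e i
    using x_sum[OF inV[OF e]] e finite_E
    by (subst (asm) sum.remove[of _ e]) (auto simp: msg_def)
  have "q i * \<bar>msg e i\<bar> = 0" if e: "e \<in> E" "i \<in> e" for e i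
  proof (rule messages_zero[OF hyp _ K _ e])
    show "0 \<le> q i * \<bar>msg e i\<bar>" if "e \<in> E" "i \<in> e" for e i using q[OF inV[OF that]] by simp
    fix e i assume e: "e \<in> E" "i \<in> e"
    let ?o = "other e i"
    have r0: "0 \<le> (\<eta> (Off e))\<^sup>2 / (\<eta> (Diag i) * \<eta> (Diag ?o))"
      using D[OF inV[OF e]] D[OF inV[OF e(1) other_in[OF e]]] by simp
    have "q i * \<bar>msg e i\<bar> = (q i * ((\<eta> (Off e))\<^sup>2 / (\<eta> (Diag i) * \<eta> (Diag ?o)))) * \<bar>y e ?o\<bar>"
      using r0 by (simp only: msg_y[OF e] abs_mult abs_of_nonneg mult.assoc)
    also have "\<dots> \<le> (K * q ?o) * \<bar>y e ?o\<bar>"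
      by (intro mult_right_mono contr[OF e]) simp
    also have "\<dots> \<le> (K * q ?o) * (\<Sum>e'\<in>{e'\<in>E. ?o \<in> e'} - {e}. \<bar>msg e' ?o\<bar>)"
      unfolding y_sum[OF e(1) other_in[OF e]]
      using K(1) q[OF inV[OF e(1) other_in[OF e]]] by (intro mult_left_mono sum_abs) auto
    finally show "q i * \<bar>msg e i\<bar> \<le> K * (\<Sum>j\<in>e - {i}. \<Sum>e'\<in>{e'\<in>E. j \<in> e'} - {e}. q j * \<bar>msg e' j\<bar>)"
      unfolding edge_minus[OF e] by (simp add: sum_distrib_left mult.assoc)
  qed
  then have msg0: "msg e i = 0" if "e \<in> E" "i \<in> e" for e i
    using that q[OF inV[OF that]] by force
  have diag: "h (Diag i) = 0" if "i \<in> V" for i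
    using x_sum[OF that] msg0 D[OF that] by (simp add: x_def)
  \<comment> \<open>With the variance components gone, \<open>edet'_h\<close> annihilates the
    derivative of the determinant, and \<open>off\<close> then the covariance component.\<close>
  have "h (Off e) = 0" if e: "e \<in> E" for e
  proof -
    have "edet' \<eta> h e * R e (u e) = 0"
      unfolding edet'_h[OF e uv_in(1)[OF e]]
      using diag inV[OF e] uv_in[OF e] other_in[OF e] by simp
    then show ?thesis using off[OF e] R[OF e uv_in(1)[OF e]] P[OF e] by simp
  qed
  then have "h c = 0" for c
    using diag h by (cases "c \<in> coords") (auto simp: coords_def ga_T_def)
  then show ?thesis by auto
qed

section \<open>The path from a diagonal covariance to the given one\<close>

definition ga_path :: "('v ga_coord \<Rightarrow> real) \<Rightarrow> real \<Rightarrow> 'v ga_coord \<Rightarrow> real" where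
  "ga_path \<eta> t c = (case c of Diag i \<Rightarrow> \<eta> c | Off e \<Rightarrow> t * \<eta> c)"

lemma ga_path_simps [simp]: "ga_path \<eta> t (Diag i) = \<eta> (Diag i)" "ga_path \<eta> t (Off e) = t * \<eta> (Off e)"
  by (simp_all add: ga_path_def)

lemma ga_path_1: "ga_path \<eta> 1 = \<eta>"
  by (auto simp: ga_path_def split: ga_coord.splits)

lemma power2_scale_le: "t \<in> {0..1} \<Longrightarrow> (t * c)\<^sup>2 \<le> (c::real)\<^sup>2"
  by (auto simp: power_mult_distrib abs_square_le_1 intro!: mult_left_le_one_le)

text \<open>Shrinking the covariances while keeping the variances can only increase the
  determinants.\<close>

lemma ga_path_in_L:
  assumes L: "\<eta> \<in> ga_L V E" and t: "t \<in> {0..1}"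
  shows "ga_path \<eta> t \<in> ga_L V E"
proof -
  have "edet \<eta> e \<le> edet (ga_path \<eta> t) e" for e
    using power2_scale_le[OF t, of "\<eta> (Off e)"] by (simp add: edet_def)
  moreover have "ga_path \<eta> t c = 0" if "c \<notin> coords" for c
    using that L by (cases c) (auto simp: ga_L_iff)
  ultimately show ?thesis using L by (force simp: ga_L_iff intro: less_le_trans)
qed

text \<open>For zero covariances everything is explicit: an edge contributes \<open>z e\<close> plus
  half of \<open>x\<close> at its two endpoints, the endpoint terms cancel the degrees, and what
  remains is the sum of all \<open>z\<close> plus half the sum of all \<open>x\<close>.\<close>

lemma ga_hess_diagonal_pos:
  assumes L: "\<eta> \<in> ga_L V E" and h: "h \<in> ga_T" "h \<noteq> (\<lambda>c. 0)"
  shows "0 < ga_hess (ga_path \<eta> 0) h h"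
proof -
  define x where "x i = (h (Diag i) / \<eta> (Diag i))\<^sup>2" for i
  define z where "z e = (h (Off e))\<^sup>2 / (\<eta> (Diag (u e)) * \<eta> (Diag (v e)))" for e
  have D: "0 < \<eta> (Diag i)" if "i \<in> V" for i using L that by (simp add: ga_L_iff)
  have edge_term: "edet' h h e / edet (ga_path \<eta> 0) e - edet' (ga_path \<eta> 0) h e * edet' (ga_path \<eta> 0) h e / (edet (ga_path \<eta> 0) e)\<^sup>2 =
      - 2 * z e - (\<Sum>i\<in>e. x i)" if e: "e \<in> E" for e
  proof -
    have "(\<Sum>i\<in>e. x i) = (\<Sum>i\<in>{u e, v e}. x i)" using edge(1)[OF e] by simp
    also have "\<dots> = x (u e) + x (v e)" using edge(2)[OF e] by simp
    finally have s: "(\<Sum>i\<in>e. x i) = x (u e) + x (v e)" .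
    show ?thesis unfolding s using D[OF uv_V(1)[OF e]] D[OF uv_V(2)[OF e]]
      by (simp add: edet_def edet'_def x_def z_def power2_eq_square divide_simps) (simp add: algebra_simps)
  qed
  have "ga_hess (ga_path \<eta> 0) h h = - 1/2 * (\<Sum>e\<in>E. - 2 * z e - (\<Sum>i\<in>e. x i)) +
      1/2 * (\<Sum>i\<in>V. (1 - real (degree_of E i)) * x i)"
  proof -
    have "(\<Sum>e\<in>E. edet' h h e / edet (ga_path \<eta> 0) e -
          edet' (ga_path \<eta> 0) h e * edet' (ga_path \<eta> 0) h e / (edet (ga_path \<eta> 0) e)\<^sup>2) =
        (\<Sum>e\<in>E. - 2 * z e - (\<Sum>i\<in>e. x i))"
      by (intro sum.cong refl edge_term)
    moreover have "h (Diag i) * h (Diag i) / (\<eta> (Diag i))\<^sup>2 = x i" for i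
      by (simp add: x_def power2_eq_square)
    ultimately show ?thesis unfolding ga_hess_def ga_path_simps by simp
  qed
  also have "(\<Sum>e\<in>E. - 2 * z e - (\<Sum>i\<in>e. x i)) = - 2 * (\<Sum>e\<in>E. z e) - (\<Sum>i\<in>V. real (degree_of E i) * x i)"
    unfolding sum_over_factors_eq_degree_sum[OF hyp, symmetric] by (simp add: sum_subtractf sum_distrib_left)
  finally have eq: "ga_hess (ga_path \<eta> 0) h h = (\<Sum>e\<in>E. z e) + 1/2 * (\<Sum>i\<in>V. x i)"
    by (simp add: left_diff_distrib sum_subtractf diff_divide_distrib)
  have z0: "0 \<le> z e" if "e \<in> E" for e
    using D[OF uv_V(1)[OF that]] D[OF uv_V(2)[OF that]] by (simp add: z_def)
  have x0: "0 \<le> x i" for i by (simp add: x_def)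
  obtain c where c: "h c \<noteq> 0" using h(2) by auto
  then have "c \<in> coords" using h(1) by (auto simp: ga_T_def)
  then consider i where "c = Diag i" "i \<in> V" | e where "c = Off e" "e \<in> E" by (auto simp: coords_def)
  then show ?thesis
  proof cases
    case (1 i)
    have "0 < x i" using c 1 D[OF 1(2)] by (simp add: x_def)
    then have "0 < (\<Sum>i\<in>V. x i)" using 1 finite_V x0 by (intro sum_pos2[of _ i]) auto
    then show ?thesis unfolding eq using z0 by (intro add_nonneg_pos sum_nonneg) auto
  next
    case (2 e)
    have "0 < z e" using c 2 D[OF uv_V(1)[OF 2(2)]] D[OF uv_V(2)[OF 2(2)]] by (simp add: z_def)
    then have "0 < (\<Sum>e\<in>E. z e)" using 2 finite_E z0 by (intro sum_pos2[of _ e]) auto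
    then show ?thesis unfolding eq using x0 by (intro add_pos_nonneg mult_nonneg_nonneg sum_nonneg) auto
  qed
qed

lemma continuous_ga_hess_path:
  assumes L: "\<eta> \<in> ga_L V E"
  shows "continuous_on ({0..1} \<times> UNIV) (\<lambda>(t, h). ga_hess (ga_path \<eta> t) h h)"
proof -
  have nz: "\<eta> (Diag (u e)) * \<eta> (Diag (v e)) - (fst p * \<eta> (Off e))\<^sup>2 \<noteq> 0"
    if "e \<in> E" "p \<in> {0..1} \<times> UNIV" for e and p :: "real \<times> ('v ga_coord \<Rightarrow> real)"
  proof -
    have "0 < edet (ga_path \<eta> (fst p)) e"
      using ga_path_in_L[OF L, of "fst p"] that by (auto simp: ga_L_iff)
    then show ?thesis by (simp add: edet_def)
  qed
  have nz': "\<eta> (Diag i) \<noteq> 0" if "i \<in> V" for i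
    using L that by (auto simp: ga_L_iff)
  have "continuous_on ({0..1} \<times> UNIV) (\<lambda>p. ga_hess (ga_path \<eta> (fst p)) (snd p) (snd p))"
    unfolding ga_hess_def edet_def edet'_def ga_path_simps
    by (intro continuous_intros continuous_on_product_then_coordinatewise[OF continuous_on_snd] ballI)
      (use nz nz' in auto)
  then show ?thesis by (simp add: case_prod_beta)
qed

lemma closed_ga_T: "closed ga_T"
proof -
  have "ga_T = (\<Inter>c\<in>- coords. {h. h c = 0})" by (auto simp: ga_T_def)
  also have "closed \<dots>"
    by (intro closed_INT ballI closed_Collect_eq continuous_intros continuous_on_product_coordinates)
  finally show ?thesis .
qed

lemma ga_hess_pos:
  assumes L: "\<eta> \<in> ga_L V E"
    and q: "\<And>i. i \<in> V \<Longrightarrow> 0 < q i"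
    and contr: "\<And>e i. e \<in> E \<Longrightarrow> i \<in> e \<Longrightarrow>
      q i * ((\<eta> (Off e))\<^sup>2 / (\<eta> (Diag i) * \<eta> (Diag (other e i)))) \<le> K * q (other e i)"
    and K: "0 \<le> K" "K * rho E < 1"
    and h: "h \<in> ga_T" "h \<noteq> (\<lambda>c. 0)"
  shows "0 < ga_hess \<eta> h h"
proof -
  have "0 < ga_hess (ga_path \<eta> 1) h h"
  proof (rule pos_def_homotopy[where Q = "\<lambda>t. ga_hess (ga_path \<eta> t)", OF finite_coords closed_ga_T])
    show "h c = 0" if "h \<in> ga_T" "c \<notin> coords" for h c
      using that by (simp add: ga_T_def)
    show "(\<lambda>c. a * h c + b * k c) \<in> ga_T" if "h \<in> ga_T" "k \<in> ga_T" for h k a b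
      using that by (simp add: ga_T_def)
    fix t :: real and h assume t: "t \<in> {0..1}" and h: "h \<in> ga_T"
      and null: "\<And>k. k \<in> ga_T \<Longrightarrow> ga_hess (ga_path \<eta> t) h k = 0"
    show "h = (\<lambda>c. 0)"
    proof (rule ga_hess_nondegenerate[where q = q and K = K, OF ga_path_in_L[OF L t] h])
      show "ga_hess (ga_path \<eta> t) h k = 0" if "k \<in> ga_T" for k by (rule null[OF that])
      show "0 < q i" if "i \<in> V" for i by (rule q[OF that])
      fix e i assume e: "e \<in> E" "i \<in> e"
      then have "i \<in> V" "other e i \<in> V" using edge(3) other_in by blast+
      then have "0 < \<eta> (Diag i)" "0 < \<eta> (Diag (other e i))" "0 < q i" using L q by (auto simp: ga_L_iff)
      then have "q i * ((t * \<eta> (Off e))\<^sup>2 / (\<eta> (Diag i) * \<eta> (Diag (other e i)))) \<le>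
          q i * ((\<eta> (Off e))\<^sup>2 / (\<eta> (Diag i) * \<eta> (Diag (other e i))))"
        using power2_scale_le[OF t] by (intro mult_left_mono divide_right_mono) auto
      also note contr[OF e]
      finally show "q i * ((ga_path \<eta> t (Off e))\<^sup>2 / (ga_path \<eta> t (Diag i) * ga_path \<eta> t (Diag (other e i)))) \<le>
          K * q (other e i)" by simp
    qed (rule K)+
  qed (rule h ga_hess_sym ga_hess_linear continuous_ga_hess_path[OF L] ga_hess_diagonal_pos[OF L]; assumption)+
  then show ?thesis by (simp add: ga_path_1)
qed

text \<open>In dimension one a norm is a multiple of the absolute value. The weight \<open>q\<close>
  is its value at the unit vector, and evaluating the operator norm there gives the weighted
  contraction.\<close>

lemma ga_hess_pos_of_corr:
  assumes norm: "\<And>i. i \<in> V \<Longrightarrow> is_norm 1 (\<nu> i)"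
    and corr: "\<eta> \<in> ga_L_rho V E \<mu> \<nu>"
    and h: "h \<in> ga_T" "h \<noteq> (\<lambda>c. 0)"
  shows "0 < ga_hess \<eta> h h"
proof -
  have L: "\<eta> \<in> ga_L V E" using corr by (simp add: ga_L_rho_def)
  define S where "S = (\<lambda>(e, i). op_norm (\<nu> i) (\<nu> (other e i)) (ga_corr \<mu> \<eta> i (other e i))) ` (SIGMA e:E. e)"
  define one where "one = (Matrix.vec 1 (\<lambda>_. 1) :: real vec)"
  have one: "one \<in> carrier_vec 1" "one \<noteq> 0\<^sub>v 1"
  proof -
    have "vec_index one 0 = 1" by (simp add: one_def)
    then show "one \<noteq> 0\<^sub>v 1" by auto
  qed (simp add: one_def)
  have edge_pair: "{i, other e i} = e" "i \<noteq> other e i" "i \<in> V" "other e i \<in> V" if "e \<in> E" "i \<in> e" for e i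
    using that edge[OF that(1)] by (auto simp: other_def)
  have corr_eq: "ga_corr \<mu> \<eta> i (other e i) = mat 1 1 (\<lambda>_. (\<eta> (Off e))\<^sup>2 / (\<eta> (Diag i) * \<eta> (Diag (other e i))))"
    if e: "e \<in> E" "i \<in> e" for e i
  proof -
    have "0 < edet \<eta> e" "0 < \<eta> (Diag i)" "0 < \<eta> (Diag (other e i))"
      using L e edge_pair[OF e] by (auto simp: ga_L_iff)
    then show ?thesis
      using ga_corr_eq[of \<eta> i "other e i" \<mu>] unfolding edge_pair(1)[OF e] edet_other(1)[OF e] by blast
  qed
  have carrier: "ga_corr \<mu> \<eta> i (other e i) \<in> carrier_mat 1 1" if "e \<in> E" "i \<in> e" for e i
    unfolding corr_eq[OF that] by simp
  have "finite S" unfolding S_def using finite_E finite_subset[OF edge(3) finite_V] by (intro finite_imageI finite_SigmaI) auto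
  moreover have "0 \<le> x \<and> ereal x < inverse (ereal (rho E))" if x: "x \<in> S" for x
  proof -
    obtain e i where e: "e \<in> E" "i \<in> e"
      and x: "x = op_norm (\<nu> i) (\<nu> (other e i)) (ga_corr \<mu> \<eta> i (other e i))"
      using x unfolding S_def by (elim imageE SigmaE) (simp only: case_prod_conv)
    have "{i, other e i} \<in> E" using edge_pair(1)[OF e] e(1) by simp
    then show ?thesis unfolding x
      using op_norm_nonneg[OF carrier[OF e] norm norm, OF edge_pair(3,4)[OF e]] edge_pair(2)[OF e] corr
      unfolding ga_L_rho_def by blast
  qed
  ultimately obtain K where K: "0 \<le> K" "K * rho E < 1" "\<And>x. x \<in> S \<Longrightarrow> x \<le> K"
    using exists_common_rate by blast
  have q: "0 < \<nu> i one" if "i \<in> V" for i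
    using norm[OF that] one by (metis is_norm_def order_le_imp_less_or_eq)
  show ?thesis
  proof (rule ga_hess_pos[where q = "\<lambda>i. \<nu> i one" and K = K, OF L q _ K(1,2) h])
    fix e i assume e: "e \<in> E" "i \<in> e"
    let ?r = "(\<eta> (Off e))\<^sup>2 / (\<eta> (Diag i) * \<eta> (Diag (other e i)))"
    have "0 < \<eta> (Diag i)" "0 < \<eta> (Diag (other e i))" using L edge_pair(3,4)[OF e] by (simp_all add: ga_L_iff)
    then have "0 \<le> ?r" by simp
    have "ga_corr \<mu> \<eta> i (other e i) *\<^sub>v one = ?r \<cdot>\<^sub>v one"
      unfolding corr_eq[OF e] one_def by (intro eq_vecI) (simp_all add: scalar_prod_def)
    then have "\<nu> i one * ?r = \<nu> i (ga_corr \<mu> \<eta> i (other e i) *\<^sub>v one)"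
      using is_norm_smult[OF norm[OF edge_pair(3)[OF e]] one(1), of ?r] \<open>0 \<le> ?r\<close>
      by (simp only: abs_of_nonneg mult.commute)
    also have "\<dots> \<le> op_norm (\<nu> i) (\<nu> (other e i)) (ga_corr \<mu> \<eta> i (other e i)) * \<nu> (other e i) one"
      by (rule op_norm_bound[OF carrier[OF e] norm[OF edge_pair(3)[OF e]] norm[OF edge_pair(4)[OF e]] one(1)])
    also have "\<dots> \<le> K * \<nu> (other e i) one"
    proof (intro mult_right_mono K(3))
      show "op_norm (\<nu> i) (\<nu> (other e i)) (ga_corr \<mu> \<eta> i (other e i)) \<in> S"
        unfolding S_def by (rule image_eqI[of _ _ "(e, i)"]) (use e in auto)
      show "0 \<le> \<nu> (other e i) one" using q[OF edge_pair(4)[OF e]] by simp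
    qed
    finally show "\<nu> i one * ?r \<le> K * \<nu> (other e i) one" .
  qed
qed

end

lemma ga_hessian_pos_def:
  assumes G: "simple_graph V E"
    and norm: "\<And>i. i \<in> V \<Longrightarrow> is_norm 1 (\<nu> i)"
    and \<eta>: "\<eta> \<in> ga_L_rho V E \<mu> \<nu>"
  shows "hessian_pos_def (ga_L V E) (ga_bethe V E lin \<kappa>) \<eta>"
proof -
  have "\<forall>e\<in>E. \<exists>i j. e = {i, j} \<and> i \<noteq> j"
    using G by (auto simp: simple_graph_def card_2_iff)
  then obtain u v where uv: "\<And>e. e \<in> E \<Longrightarrow> e = {u e, v e} \<and> u e \<noteq> v e" by metis
  interpret ga_family V E u v
  proof
    show "finite V" using G by (simp add: simple_graph_def)
    fix e assume e: "e \<in> E"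
    show "e = {u e, v e}" "u e \<noteq> v e" using uv[OF e] by (rule conjunct1, rule conjunct2)
    show "e \<subseteq> V" using G e by (simp add: simple_graph_def)
  qed
  have L: "\<eta> \<in> ga_L V E" using \<eta> by (simp add: ga_L_rho_def)
  have "ga_hess \<eta> h k = ga_hess \<eta> k h" for h k by (rule ga_hess_sym)
  then show ?thesis
    unfolding hessian_pos_def_def pos_def_form_def tangent_dirs_ga_L[OF L]
    using has_hessian_ga_bethe[OF L] ga_hess_linear ga_hess_pos_of_corr[OF norm \<eta>]
    by blast
qed

theorem theorem4p9:
  fixes V :: "'v set" and F :: "'v set set" and \<nu> :: "'v \<Rightarrow> real vec \<Rightarrow> real"
  assumes "hypergraph V F"
  shows
    "(\<forall>(N :: 'v \<Rightarrow> nat) \<Psi>.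
        (\<forall>i\<in>V. 1 \<le> N i) \<longrightarrow>
        (\<forall>\<alpha>\<in>F. \<forall>x\<in>configs N \<alpha>. 0 < \<Psi> \<alpha> x) \<longrightarrow>
        (\<forall>i\<in>V. is_norm (mn_dim N i) (\<nu> i)) \<longrightarrow>
        (\<forall>b\<in>mn_L_rho V F N \<nu>. hessian_pos_def (mn_L V F N) (mn_bethe V F N \<Psi>) b)) \<and>
     (\<forall>(\<mu> :: 'v \<Rightarrow> real) lin \<kappa>.
        simple_graph V F \<longrightarrow>
        (\<forall>i\<in>V. is_norm 1 (\<nu> i)) \<longrightarrow>
        (\<forall>\<eta>\<in>ga_L_rho V F \<mu> \<nu>. hessian_pos_def (ga_L V F) (ga_bethe V F lin \<kappa>) \<eta>))"
proof (intro conjI allI impI ballI)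
  fix N :: "'v \<Rightarrow> nat" and \<Psi> b
  assume "\<forall>i\<in>V. 1 \<le> N i" "\<forall>i\<in>V. is_norm (mn_dim N i) (\<nu> i)" "b \<in> mn_L_rho V F N \<nu>"
  then show "hessian_pos_def (mn_L V F N) (mn_bethe V F N \<Psi>) b"
    by (intro mn_hessian_pos_def[OF assms]) auto
next
  fix \<mu> :: "'v \<Rightarrow> real" and lin \<kappa> \<eta>
  assume "simple_graph V F" "\<forall>i\<in>V. is_norm 1 (\<nu> i)" "\<eta> \<in> ga_L_rho V F \<mu> \<nu>"
  then show "hessian_pos_def (ga_L V F) (ga_bethe V F lin \<kappa>) \<eta>"
    by (intro ga_hessian_pos_def) auto
qed

end
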